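(* Let $H_1,\dots,H_n,G$ be Hilbert spaces over the same field ($\mathbb R$ or $\mathbb C$). For $1\le p<\infty$, $$\mathcal L_{HS}(H_1,\dots,H_n;G)=\Pi_p^{Lip,H}(H_1,\dots,H_n;G),$$ and for $T$ in this class $\|T\|_{HS}\le\pi_2^{Lip,H}(T)\le B_p^n\,\|T\|_{HS}$, where $B_p$ is the constant in Khintchine's inequality.
   Context: $H_1\hat\otimes_H\cdots\hat\otimes_H H_n$ is the Hilbert space (Hilbert-Schmidt) tensor product, i.e. the completion of $H_1\otimes\cdots\otimes H_n$ for the inner product with $\langle x_1\otimes\cdots\otimes x_n,y_1\otimes\cdots\otimes y_n\rangle=\prod_i\langle x_i,y_i\rangle$. $\mathcal L_H(H_1,\dots,H_n;G)$ is the space of $n$-linear operators $T:H_1\times\cdots\times H_n\to G$ whose associated linear map $\hat T$, $\hat T(x_1\otimes\cdots\otimes x_n)=T(x_1,\dots,x_n)$, is continuous on $H_1\hat\otimes_H\cdots\hat\otimes_HH_n$; $\mathcal L_H(H_1,\dots,H_n)$ is the scalar-valued case, normed by $\|\varphi\|=\|\hat\varphi\|$, with closed unit ball $B_{\mathcal L_H(H_1,\dots,H_n)}$. $T\in\mathcal L_H(H_1,\dots,H_n;G)$ is $H$-Lipschitz $p$-summing, $T\in\Pi_p^{Lip,H}(H_1,\dots,H_n;G)$, if there is $c>0$ such that for all $k\in\mathbb N$ and all $u_1,\dots,u_k,v_1,\dots,v_k\in H_1\times\cdots\times H_n$, $$\Big(\sum_{i=1}^k\|T(u_i)-T(v_i)\|^p\Big)^{1/p}\le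 c\cdot\sup_{\varphi\in B_{\mathcal L_H(H_1,\dots,H_n)}}\Big(\sum_{i=1}^k|\varphi(u_i)-\varphi(v_i)|^p\Big)^{1/p};$$ the best such $c$ is $\pi_p^{Lip,H}(T)$. A bounded $n$-linear operator $T$ is Hilbert-Schmidt, $T\in\mathcal L_{HS}(H_1,\dots,H_n;G)$, if there are orthonormal bases $(e^k_j)_{j\in J_k}$ of $H_k$, $k=1,\dots,n$, such that $$\|T\|_{HS}:=\Big(\sum_{j_k\in J_k,\ k=1,\dots,n}\|T(e^1_{j_1},\dots,e^n_{j_n})\|^2\Big)^{1/2}<\infty.$$ $B_p$ is the (upper) Khintchine constant: $\big(\int_0^1|\sum_m a_mr_m(t)|^p\,dt\big)^{1/p}\le B_p\big(\sum_m|a_m|^2\big)^{1/2}$ for all finite scalar sequences $(a_m)$, $r_m$ being the Rademacher functions. *)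

theory Defs
  imports "HOL-Analysis.Analysis" "HOL-Algebra.Module"
begin

section \<open>Hilbert spaces over the real or complex numbers\<close>

text \<open>
  The scalar field is a set \<open>K\<close> of complex numbers, which is \<open>\<real>\<close> or \<open>UNIV\<close>; conjugation is the
  identity in the first case. Hilbert spaces are given by explicit carriers, with an inner product
  added to the module record. This makes it possible to speak about a family
  \<open>H 0, \<dots>, H (n - 1)\<close> of unrelated spaces (each has its own carrier, operations and inner product)
  for arbitrary \<open>n\<close>. As for every module in HOL-Algebra, the record fields \<open>mult\<close> and \<open>one\<close> of the
  vector space are irrelevant.
\<close>

definition scalar_field :: "complex set \<Rightarrow> complex ring" where
  "scalar_field K = \<lparr>carrier = K, mult = (*), one = 1, zero = 0, add = (+)\<rparr>"

record 'a hspace = "(complex, 'a) module" +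
  hinner :: "'a \<Rightarrow> 'a \<Rightarrow> complex"

definition hnorm :: "'a hspace \<Rightarrow> 'a \<Rightarrow> real" where
  "hnorm H x = sqrt (Re (hinner H x x))"

text \<open>\<open>Metric_space\<close> requires symmetry and nonnegativity outside the carrier, too.\<close>

definition hdist :: "'a hspace \<Rightarrow> 'a \<Rightarrow> 'a \<Rightarrow> real" where
  "hdist H x y = (if x \<in> carrier H \<and> y \<in> carrier H then hnorm H (x \<ominus>\<^bsub>H\<^esub> y) else 0)"

definition htop :: "'a hspace \<Rightarrow> 'a topology" where
  "htop H = Metric_space.mtopology (carrier H) (hdist H)"

definition hilbert_space :: "complex set \<Rightarrow> 'a hspace \<Rightarrow> bool" where
  "hilbert_space K H \<longleftrightarrow>
     module (scalar_field K) H \<and>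
     (\<forall>x\<in>carrier H. \<forall>y\<in>carrier H. hinner H x y \<in> K) \<and>
     (\<forall>a\<in>K. \<forall>x\<in>carrier H. \<forall>y\<in>carrier H. \<forall>z\<in>carrier H.
        hinner H (a \<odot>\<^bsub>H\<^esub> x \<oplus>\<^bsub>H\<^esub> y) z = a * hinner H x z + hinner H y z) \<and>
     (\<forall>x\<in>carrier H. \<forall>y\<in>carrier H. hinner H y x = cnj (hinner H x y)) \<and>
     (\<forall>x\<in>carrier H. 0 \<le> Re (hinner H x x)) \<and>
     (\<forall>x\<in>carrier H. hinner H x x = 0 \<longrightarrow> x = \<zero>\<^bsub>H\<^esub>) \<and>
     Metric_space.mcomplete (carrier H) (hdist H)"

definition scalar_space :: "complex set \<Rightarrow> complex hspace" where
  "scalar_space K = \<lparr>carrier = K, mult = (*), one = 1, zero = 0, add = (+), smult = (*),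
     hinner = (\<lambda>x y. x * cnj y)\<rparr>"

definition hspan :: "complex set \<Rightarrow> 'a hspace \<Rightarrow> 'a set \<Rightarrow> 'a set" where
  "hspan K H S = {(\<Oplus>\<^bsub>H\<^esub>b\<in>F. a b \<odot>\<^bsub>H\<^esub> b) | F a. finite F \<and> F \<subseteq> S \<and> a \<in> F \<rightarrow> K}"

text \<open>An orthonormal basis is given as a set, that is, as a family indexed by itself.\<close>

definition orthonormal_basis :: "complex set \<Rightarrow> 'a hspace \<Rightarrow> 'a set \<Rightarrow> bool" where
  "orthonormal_basis K H B \<longleftrightarrow>
     B \<subseteq> carrier H \<and>
     (\<forall>b\<in>B. \<forall>b'\<in>B. hinner H b b' = (if b = b' then 1 else 0)) \<and>
     htop H closure_of (hspan K H B) = carrier H"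

definition linear_map :: "complex set \<Rightarrow> 'a hspace \<Rightarrow> 'b hspace \<Rightarrow> ('a \<Rightarrow> 'b) \<Rightarrow> bool" where
  "linear_map K E G f \<longleftrightarrow>
     f \<in> carrier E \<rightarrow> carrier G \<and>
     (\<forall>a\<in>K. \<forall>x\<in>carrier E. \<forall>y\<in>carrier E. f (a \<odot>\<^bsub>E\<^esub> x \<oplus>\<^bsub>E\<^esub> y) = a \<odot>\<^bsub>G\<^esub> f x \<oplus>\<^bsub>G\<^esub> f y)"

definition op_norm :: "'a hspace \<Rightarrow> 'b hspace \<Rightarrow> ('a \<Rightarrow> 'b) \<Rightarrow> real" where
  "op_norm E G f = (SUP z\<in>{z \<in> carrier E. hnorm E z \<le> 1}. hnorm G (f z))"


section \<open>Multilinear operators and the Hilbert space tensor product\<close>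

text \<open>Elements of \<open>H 0 \<times> \<dots> \<times> H (n - 1)\<close> are extensional functions on \<open>{..<n}\<close>.\<close>

definition tuples :: "nat \<Rightarrow> (nat \<Rightarrow> 'a hspace) \<Rightarrow> (nat \<Rightarrow> 'a) set" where
  "tuples n H = (\<Pi>\<^sub>E i\<in>{..<n}. carrier (H i))"

definition multilinear ::
    "complex set \<Rightarrow> nat \<Rightarrow> (nat \<Rightarrow> 'a hspace) \<Rightarrow> 'b hspace \<Rightarrow> ((nat \<Rightarrow> 'a) \<Rightarrow> 'b) \<Rightarrow> bool" where
  "multilinear K n H G T \<longleftrightarrow>
     T \<in> tuples n H \<rightarrow> carrier G \<and>
     (\<forall>u\<in>tuples n H. \<forall>i<n. \<forall>a\<in>K. \<forall>x\<in>carrier (H i). \<forall>y\<in>carrier (H i).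
        T (u(i := a \<odot>\<^bsub>H i\<^esub> x \<oplus>\<^bsub>H i\<^esub> y)) = a \<odot>\<^bsub>G\<^esub> T (u(i := x)) \<oplus>\<^bsub>G\<^esub> T (u(i := y)))"

definition bounded_multilinear ::
    "complex set \<Rightarrow> nat \<Rightarrow> (nat \<Rightarrow> 'a hspace) \<Rightarrow> 'b hspace \<Rightarrow> ((nat \<Rightarrow> 'a) \<Rightarrow> 'b) \<Rightarrow> bool" where
  "bounded_multilinear K n H G T \<longleftrightarrow>
     multilinear K n H G T \<and>
     (\<exists>C. \<forall>u\<in>tuples n H. hnorm G (T u) \<le> C * (\<Prod>i<n. hnorm (H i) (u i)))"

text \<open>
  The Hilbert space \<open>E\<close>, with elementary tensors \<open>tens u = u 0 \<otimes> \<dots> \<otimes> u (n - 1)\<close>, is the completion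
  of the algebraic tensor product of \<open>H 0, \<dots>, H (n - 1)\<close> for the inner product that is
  multiplicative on elementary tensors. The linear span of the elementary tensors in \<open>E\<close> is the
  algebraic tensor product: by the inner product formula, a linear combination of elementary
  tensors vanishes in \<open>E\<close> only if it does so in the algebraic tensor product, on which that formula
  defines a positive definite form. As usual, \<open>(E, tens)\<close> is determined up to a unique isometric
  isomorphism that respects the elementary tensors.
\<close>

definition hilbert_tensor ::
    "complex set \<Rightarrow> nat \<Rightarrow> (nat \<Rightarrow> 'a hspace) \<Rightarrow> 'e hspace \<Rightarrow> ((nat \<Rightarrow> 'a) \<Rightarrow> 'e) \<Rightarrow> bool" where
  "hilbert_tensor K n H E tens \<longleftrightarrow>
     hilbert_space K E \<and>
     multilinear K n H E tens \<and>
     (\<forall>u\<in>tuples n H. \<forall>v\<in>tuples n H.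
        hinner E (tens u) (tens v) = (\<Prod>i<n. hinner (H i) (u i) (v i))) \<and>
     htop E closure_of (hspan K E (tens ` tuples n H)) = carrier E"

text \<open>\<open>f\<close> is a continuous linear map on the tensor product with \<open>f (u 0 \<otimes> \<dots> \<otimes> u (n - 1)) = T u\<close>.\<close>

definition is_linearization ::
    "complex set \<Rightarrow> nat \<Rightarrow> (nat \<Rightarrow> 'a hspace) \<Rightarrow> 'e hspace \<Rightarrow> ((nat \<Rightarrow> 'a) \<Rightarrow> 'e) \<Rightarrow> 'b hspace \<Rightarrow>
      ((nat \<Rightarrow> 'a) \<Rightarrow> 'b) \<Rightarrow> ('e \<Rightarrow> 'b) \<Rightarrow> bool" where
  "is_linearization K n H E tens G T f \<longleftrightarrow>
     linear_map K E G f \<and> continuous_map (htop E) (htop G) f \<and>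
     (\<forall>u\<in>tuples n H. f (tens u) = T u)"

definition LH ::
    "complex set \<Rightarrow> nat \<Rightarrow> (nat \<Rightarrow> 'a hspace) \<Rightarrow> 'e hspace \<Rightarrow> ((nat \<Rightarrow> 'a) \<Rightarrow> 'e) \<Rightarrow> 'b hspace \<Rightarrow>
      ((nat \<Rightarrow> 'a) \<Rightarrow> 'b) set" where
  "LH K n H E tens G =
     {T. multilinear K n H G T \<and> (\<exists>f. is_linearization K n H E tens G T f)}"

text \<open>The linearization is unique on the carrier of \<open>E\<close>, so the choice below is immaterial.\<close>

definition LH_norm ::
    "complex set \<Rightarrow> nat \<Rightarrow> (nat \<Rightarrow> 'a hspace) \<Rightarrow> 'e hspace \<Rightarrow> ((nat \<Rightarrow> 'a) \<Rightarrow> 'e) \<Rightarrow>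
      ((nat \<Rightarrow> 'a) \<Rightarrow> complex) \<Rightarrow> real" where
  "LH_norm K n H E tens \<phi> =
     op_norm E (scalar_space K) (SOME f. is_linearization K n H E tens (scalar_space K) \<phi> f)"

definition LH_ball ::
    "complex set \<Rightarrow> nat \<Rightarrow> (nat \<Rightarrow> 'a hspace) \<Rightarrow> 'e hspace \<Rightarrow> ((nat \<Rightarrow> 'a) \<Rightarrow> 'e) \<Rightarrow>
      ((nat \<Rightarrow> 'a) \<Rightarrow> complex) set" where
  "LH_ball K n H E tens =
     {\<phi> \<in> LH K n H E tens (scalar_space K). LH_norm K n H E tens \<phi> \<le> 1}"


section \<open>H-Lipschitz p-summing operators\<close>

definition lip_summing_const ::
    "complex set \<Rightarrow> nat \<Rightarrow> (nat \<Rightarrow> 'a hspace) \<Rightarrow> 'e hspace \<Rightarrow> ((nat \<Rightarrow> 'a) \<Rightarrow> 'e) \<Rightarrow> 'b hspace \<Rightarrow>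
      real \<Rightarrow> ((nat \<Rightarrow> 'a) \<Rightarrow> 'b) \<Rightarrow> real \<Rightarrow> bool" where
  "lip_summing_const K n H E tens G p T c \<longleftrightarrow>
     (\<forall>k. \<forall>u v :: nat \<Rightarrow> nat \<Rightarrow> 'a.
        u \<in> {..<k} \<rightarrow> tuples n H \<longrightarrow> v \<in> {..<k} \<rightarrow> tuples n H \<longrightarrow>
        (\<Sum>i<k. hnorm G (T (u i) \<ominus>\<^bsub>G\<^esub> T (v i)) powr p) powr (1 / p)
          \<le> c * (SUP \<phi>\<in>LH_ball K n H E tens.
                   (\<Sum>i<k. cmod (\<phi> (u i) - \<phi> (v i)) powr p) powr (1 / p)))"

definition Pi_Lip ::
    "complex set \<Rightarrow> nat \<Rightarrow> (nat \<Rightarrow> 'a hspace) \<Rightarrow> 'e hspace \<Rightarrow> ((nat \<Rightarrow> 'a) \<Rightarrow> 'e) \<Rightarrow> 'b hspace \<Rightarrow>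
      real \<Rightarrow> ((nat \<Rightarrow> 'a) \<Rightarrow> 'b) set" where
  "Pi_Lip K n H E tens G p =
     {T \<in> LH K n H E tens G. \<exists>c>0. lip_summing_const K n H E tens G p T c}"

definition pi_Lip_norm ::
    "complex set \<Rightarrow> nat \<Rightarrow> (nat \<Rightarrow> 'a hspace) \<Rightarrow> 'e hspace \<Rightarrow> ((nat \<Rightarrow> 'a) \<Rightarrow> 'e) \<Rightarrow> 'b hspace \<Rightarrow>
      real \<Rightarrow> ((nat \<Rightarrow> 'a) \<Rightarrow> 'b) \<Rightarrow> real" where
  "pi_Lip_norm K n H E tens G p T = Inf {c. c > 0 \<and> lip_summing_const K n H E tens G p T c}"


section \<open>Hilbert-Schmidt multilinear operators\<close>

definition HS_bases ::
    "complex set \<Rightarrow> nat \<Rightarrow> (nat \<Rightarrow> 'a hspace) \<Rightarrow> 'b hspace \<Rightarrow> ((nat \<Rightarrow> 'a) \<Rightarrow> 'b) \<Rightarrow>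
      (nat \<Rightarrow> 'a set) \<Rightarrow> bool" where
  "HS_bases K n H G T B \<longleftrightarrow>
     (\<forall>i<n. orthonormal_basis K (H i) (B i)) \<and>
     (\<lambda>e. (hnorm G (T e))\<^sup>2) summable_on (\<Pi>\<^sub>E i\<in>{..<n}. B i)"

definition L_HS ::
    "complex set \<Rightarrow> nat \<Rightarrow> (nat \<Rightarrow> 'a hspace) \<Rightarrow> 'b hspace \<Rightarrow> ((nat \<Rightarrow> 'a) \<Rightarrow> 'b) set" where
  "L_HS K n H G = {T. bounded_multilinear K n H G T \<and> (\<exists>B. HS_bases K n H G T B)}"

text \<open>The value does not depend on the choice of the orthonormal bases.\<close>

definition HS_norm ::
    "complex set \<Rightarrow> nat \<Rightarrow> (nat \<Rightarrow> 'a hspace) \<Rightarrow> 'b hspace \<Rightarrow> ((nat \<Rightarrow> 'a) \<Rightarrow> 'b) \<Rightarrow> real" where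
  "HS_norm K n H G T =
     sqrt (\<Sum>\<^sub>\<infinity>e\<in>(\<Pi>\<^sub>E i\<in>{..<n}. (SOME B. HS_bases K n H G T B) i). (hnorm G (T e))\<^sup>2)"


section \<open>The constant in Khintchine's inequality\<close>

definition rademacher :: "nat \<Rightarrow> real \<Rightarrow> real" where
  "rademacher m t = sgn (sin (2 ^ m * pi * t))"

text \<open>
  The least constant in the upper inequality, with scalars in \<open>K\<close>. The Rademacher functions are
  \<open>rademacher 1, rademacher 2, \<dots>\<close>, whence the shift of the index.
\<close>

definition khintchine_const :: "complex set \<Rightarrow> real \<Rightarrow> real" where
  "khintchine_const K p = Inf {B.
     \<forall>(N::nat) (a :: nat \<Rightarrow> complex). a \<in> {..<N} \<rightarrow> K \<longrightarrow>
       (integral {0..1}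
          (\<lambda>t. cmod (\<Sum>m<N. a m * complex_of_real (rademacher (Suc m) t)) powr p)) powr (1 / p)
         \<le> B * sqrt (\<Sum>m<N. (cmod (a m))\<^sup>2)}"

end

theory Submission
  imports Defs
begin

text \<open>
  An operator \<open>T\<close> with linearization \<open>f\<close> on the tensor product \<open>E\<close> is studied through \<open>f\<close>. The unit
  ball in the definition of summing operators consists of the functionals of norm at most \<open>1\<close> on
  \<open>E\<close> (\<open>LH_ballD\<close>, \<open>LH_ballI\<close>). Hence \<open>T\<close> is summing if and only if \<open>f\<close> satisfies the inequality of
  a linear \<open>p\<close>-summing operator on differences of two elementary tensors.

  Hilbert-Schmidt operators are summing. If \<open>\<parallel>T e\<parallel>\<^sup>2\<close> is summable over the tuples \<open>e\<close> of vectors from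
  orthonormal bases, then \<open>f z = \<Sum> \<langle>z, tens e\<rangle> T e\<close> converges and is the linearization of \<open>T\<close>, and the
  functional \<open>z \<mapsto> \<langle>f z, w\<rangle>\<close> has norm at most \<open>(\<Sum> \<bar>\<langle>T e, w\<rangle>\<bar>\<^sup>2)\<^sup>1\<^sup>/\<^sup>2\<close>. For finitely many vectors \<open>x i\<close>, the
  numbers \<open>\<parallel>f (x i)\<parallel>\<^sup>2\<close> are sums of \<open>\<bar>\<langle>f (x i), g\<rangle>\<bar>\<^sup>2\<close> over one finite orthonormal set. Summing the
  weak bounds of these functionals yields the inequality for \<open>p = 2\<close> with the Hilbert-Schmidt norm as
  constant (\<open>two_summing_extension\<close>). For \<open>p = 1\<close> the square root of the sum is first replaced by an
  average over signs (\<open>Khintchine_lower\<close>, \<open>one_summing_extension\<close>). All other exponents follow from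
  \<open>p = 1\<close>: a summing constant for \<open>p\<close> is one for every larger exponent, because the weights in
  Hoelder's inequality can be absorbed into the first coordinate (\<open>lip_summing_const_mono\<close>).

  Summing operators are Hilbert-Schmidt. By the same monotonicity let \<open>p \<ge> 2\<close>. The operator is tested
  on tuples of sign vectors \<open>\<Sum> \<epsilon> b\<close>, with \<open>b\<close> in a finite part of a basis and independent signs. The
  values of \<open>T\<close> have second moment \<open>\<Sum> \<parallel>T e\<parallel>\<^sup>2\<close>. The \<open>p\<close>-th moment of a form in the unit ball is bounded
  by a constant that depends only on \<open>n\<close> and \<open>p\<close>, which is Khintchine's inequality for signed sums of
  vectors in a Hilbert space, applied to one coordinate after the other (\<open>vector_Khintchine\<close>,
  \<open>chaos_moment\<close>, \<open>summing_basis_sum_le\<close>). The vector-valued inequality itself comes from the bound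
  \<open>exp (\<sigma> / 2)\<close> for the average of \<open>cosh\<close> of the norm, \<open>\<sigma>\<close> being the sum of the squared norms
  (\<open>cosh_rad_sum\<close>).

  The norms. The norm \<open>\<pi>\<^sub>2\<close> equals the Hilbert-Schmidt norm (\<open>pi_Lip_norm_2\<close>): one inequality is the case
  \<open>p = 2\<close> above, and the other one results from testing on elementary tensors of basis vectors, which are
  orthonormal. The upper estimate with the factor \<open>B\<^sub>p\<^sup>n\<close> then only requires \<open>B\<^sub>p \<ge> 1\<close>
  (\<open>khintchine_const_ge_1\<close>).
\<close>

section \<open>Inner product spaces\<close>

text \<open>
  Completeness is split off, because the scalars, as the target of the functionals on the tensor
  product, enter only as an inner product space.
\<close>

locale inner_space =
  fixes K :: "complex set" and H :: "'a hspace" (structure)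
  assumes K_cases: "K = \<real> \<or> K = UNIV"
    and module: "module (scalar_field K) H"
    and hinner_K: "x \<in> carrier H \<Longrightarrow> y \<in> carrier H \<Longrightarrow> hinner H x y \<in> K"
    and hinner_lin: "a \<in> K \<Longrightarrow> x \<in> carrier H \<Longrightarrow> y \<in> carrier H \<Longrightarrow> z \<in> carrier H \<Longrightarrow>
        hinner H (a \<odot> x \<oplus> y) z = a * hinner H x z + hinner H y z"
    and hinner_cnj: "x \<in> carrier H \<Longrightarrow> y \<in> carrier H \<Longrightarrow> hinner H y x = cnj (hinner H x y)"
    and hinner_nonneg: "x \<in> carrier H \<Longrightarrow> 0 \<le> Re (hinner H x x)"
    and hinner_zeroD: "x \<in> carrier H \<Longrightarrow> hinner H x x = 0 \<Longrightarrow> x = \<zero>"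

locale complete_inner_space = inner_space +
  assumes mcomplete: "Metric_space.mcomplete (carrier H) (hdist H)"

lemma complete_inner_space_iff:
  "complete_inner_space K H \<longleftrightarrow> (K = \<real> \<or> K = UNIV) \<and> hilbert_space K H"
  unfolding complete_inner_space_def inner_space_def complete_inner_space_axioms_def
    hilbert_space_def
  by blast

lemma K_closed:
  assumes "K = \<real> \<or> K = (UNIV :: complex set)"
  shows K_0: "0 \<in> K" and K_1: "1 \<in> K" and K_of_real: "complex_of_real r \<in> K"
    and K_add: "a \<in> K \<Longrightarrow> b \<in> K \<Longrightarrow> a + b \<in> K"
    and K_minus: "a \<in> K \<Longrightarrow> - a \<in> K"
    and K_mult: "a \<in> K \<Longrightarrow> b \<in> K \<Longrightarrow> a * b \<in> K"
    and K_cnj: "a \<in> K \<Longrightarrow> cnj a \<in> K"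
    and K_divide: "a \<in> K \<Longrightarrow> b \<in> K \<Longrightarrow> a / b \<in> K"
  using assms by (auto simp: Reals_cnj_iff)

context inner_space
begin

lemmas K_simps [simp] = K_closed[OF K_cases]

interpretation M: module "scalar_field K" H by (rule module)

lemma add_closed [simp]: "x \<in> carrier H \<Longrightarrow> y \<in> carrier H \<Longrightarrow> x \<oplus> y \<in> carrier H"
  by simp

lemma zero_closed [simp]: "\<zero> \<in> carrier H"
  by simp

lemma minus_closed [simp]: "x \<in> carrier H \<Longrightarrow> y \<in> carrier H \<Longrightarrow> x \<ominus> y \<in> carrier H"
  by simp

lemma smult_closed [simp]: "a \<in> K \<Longrightarrow> x \<in> carrier H \<Longrightarrow> a \<odot> x \<in> carrier H"
  using M.smult_closed by (simp add: scalar_field_def)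

lemma add_zero [simp]: "x \<in> carrier H \<Longrightarrow> x \<oplus> \<zero> = x" "x \<in> carrier H \<Longrightarrow> \<zero> \<oplus> x = x"
  by simp_all

lemma smult_one [simp]: "x \<in> carrier H \<Longrightarrow> 1 \<odot> x = x"
  using M.smult_one by (simp add: scalar_field_def)

lemma smult_zero [simp]: "a \<in> K \<Longrightarrow> a \<odot> \<zero> = \<zero>"
  using M.smult_r_null by (simp add: scalar_field_def)

lemma zero_smult [simp]: "x \<in> carrier H \<Longrightarrow> 0 \<odot> x = \<zero>"
  using M.smult_l_null by (simp add: scalar_field_def)

lemma finsum_closed [simp]: "x \<in> F \<rightarrow> carrier H \<Longrightarrow> finsum H x F \<in> carrier H"
  by (rule M.finsum_closed)

lemma minus_eq: "x \<in> carrier H \<Longrightarrow> y \<in> carrier H \<Longrightarrow> x \<ominus> y = (-1) \<odot> y \<oplus> x"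
proof -
  assume x: "x \<in> carrier H" and y: "y \<in> carrier H"
  have "(-1) \<odot> y \<oplus> y = ((-1) + 1) \<odot> y"
    using M.smult_l_distr[of "-1" 1 y] y by (simp add: scalar_field_def)
  then have "(-1) \<odot> y = \<ominus> y"
    using y by (metis K_simps(2) K_simps(5) M.minus_equality add.left_inverse smult_closed zero_smult)
  then show ?thesis
    using x y by (simp add: a_minus_def M.a_comm)
qed

lemma minus_self [simp]: "x \<in> carrier H \<Longrightarrow> x \<ominus> x = \<zero>"
  by (simp add: M.r_neg a_minus_def)

lemma add_minus_cancel [simp]: "x \<in> carrier H \<Longrightarrow> y \<in> carrier H \<Longrightarrow> (x \<ominus> y) \<oplus> y = x"
  unfolding a_minus_def using M.a_assoc[of x "\<ominus> y" y] M.l_neg[of y] by simp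

lemma minus_zero_imp_eq:
  assumes "x \<in> carrier H" "y \<in> carrier H" "x \<ominus> y = \<zero>" shows "x = y"
  using add_minus_cancel[OF assms(1,2)] unfolding assms(3) using assms(2) by simp

lemma minus_triangle:
  assumes "x \<in> carrier H" "y \<in> carrier H" "z \<in> carrier H"
  shows "(x \<ominus> y) \<oplus> (y \<ominus> z) = x \<ominus> z"
  using M.a_assoc[of "x \<ominus> y" y "\<ominus> z"] add_minus_cancel[of x y] assms
  unfolding a_minus_def[of H y z] a_minus_def[of H x z] by simp

lemma minus_zero [simp]: "x \<in> carrier H \<Longrightarrow> x \<ominus> \<zero> = x"
  by (simp add: a_minus_def)

lemma finsum_empty [simp]: "finsum H x {} = \<zero>"
  by (rule M.finsum_empty)

lemma finsum_insert [simp]: "finite F \<Longrightarrow> i \<notin> F \<Longrightarrow> x \<in> F \<rightarrow> carrier H \<Longrightarrow> x i \<in> carrier H \<Longrightarrow>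
    finsum H x (insert i F) = x i \<oplus> finsum H x F"
  by (rule M.finsum_insert)

lemma finsum_cong: "(\<And>i. i \<in> F \<Longrightarrow> x i = y i) \<Longrightarrow> y \<in> F \<rightarrow> carrier H \<Longrightarrow> finsum H x F = finsum H y F"
  by (rule M.finsum_cong') auto

lemma finsum_Un_disjoint: "finite A \<Longrightarrow> finite B \<Longrightarrow> A \<inter> B = {} \<Longrightarrow> x \<in> A \<rightarrow> carrier H \<Longrightarrow>
    x \<in> B \<rightarrow> carrier H \<Longrightarrow> finsum H x (A \<union> B) = finsum H x A \<oplus> finsum H x B"
  by (rule M.finsum_Un_disjoint)

lemma add_minus_cancel': "x \<in> carrier H \<Longrightarrow> y \<in> carrier H \<Longrightarrow> (x \<oplus> y) \<ominus> x = y"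
  by (simp add: M.a_assoc M.a_comm M.r_neg1 a_minus_def)

lemma hinner_add_left:
  assumes "x \<in> carrier H" "y \<in> carrier H" "z \<in> carrier H"
  shows "hinner H (x \<oplus> y) z = hinner H x z + hinner H y z"
  using hinner_lin[of 1 x y z] assms by simp

lemma hinner_zero_left [simp]: "z \<in> carrier H \<Longrightarrow> hinner H \<zero> z = 0"
  using hinner_add_left[of \<zero> \<zero> z] by simp

lemma hinner_smult_left:
  assumes "a \<in> K" "x \<in> carrier H" "z \<in> carrier H"
  shows "hinner H (a \<odot> x) z = a * hinner H x z"
  using hinner_lin[of a x \<zero> z] assms by simp

lemma hinner_minus_left:
  assumes "x \<in> carrier H" "y \<in> carrier H" "z \<in> carrier H"
  shows "hinner H (x \<ominus> y) z = hinner H x z - hinner H y z"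
  using assms by (simp add: minus_eq hinner_lin)

lemma hinner_zero_right [simp]: "z \<in> carrier H \<Longrightarrow> hinner H z \<zero> = 0"
  using hinner_cnj[of \<zero> z] by simp

lemma hinner_add_right:
  assumes "x \<in> carrier H" "y \<in> carrier H" "z \<in> carrier H"
  shows "hinner H z (x \<oplus> y) = hinner H z x + hinner H z y"
  using assms by (simp add: hinner_cnj[of _ z] hinner_add_left)

lemma hinner_smult_right:
  assumes "a \<in> K" "x \<in> carrier H" "z \<in> carrier H"
  shows "hinner H z (a \<odot> x) = cnj a * hinner H z x"
  using assms by (simp add: hinner_cnj[of _ z] hinner_smult_left)

lemma hinner_minus_right:
  assumes "x \<in> carrier H" "y \<in> carrier H" "z \<in> carrier H"
  shows "hinner H z (x \<ominus> y) = hinner H z x - hinner H z y"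
  using assms by (simp add: hinner_cnj[of _ z] hinner_minus_left)

lemma hinner_finsum_left:
  assumes "x \<in> F \<rightarrow> carrier H" "z \<in> carrier H" "finite F"
  shows "hinner H (finsum H x F) z = (\<Sum>i\<in>F. hinner H (x i) z)"
  using assms(3,1) by (induction F) (auto simp: hinner_add_left assms(2) Pi_iff)

lemma hinner_finsum_right:
  assumes "x \<in> F \<rightarrow> carrier H" "z \<in> carrier H" "finite F"
  shows "hinner H z (finsum H x F) = (\<Sum>i\<in>F. hinner H z (x i))"
  using assms(3,1) by (induction F) (auto simp: hinner_add_right assms(2) Pi_iff)

lemma hnorm_nonneg [simp]: "x \<in> carrier H \<Longrightarrow> 0 \<le> hnorm H x"
  by (simp add: hnorm_def hinner_nonneg)

lemma hnorm_sq: "x \<in> carrier H \<Longrightarrow> (hnorm H x)\<^sup>2 = Re (hinner H x x)"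
  by (simp add: hnorm_def hinner_nonneg)

lemma hinner_self: "x \<in> carrier H \<Longrightarrow> hinner H x x = complex_of_real ((hnorm H x)\<^sup>2)"
  using hinner_cnj[of x x] by (simp add: hnorm_sq complex_eq_iff)

lemma hnorm_zero [simp]: "hnorm H \<zero> = 0"
  by (simp add: hnorm_def)

lemma hnorm_eq_0: "x \<in> carrier H \<Longrightarrow> hnorm H x = 0 \<longleftrightarrow> x = \<zero>"
  using hinner_zeroD[of x] hinner_self[of x] by auto

lemma hnorm_smult:
  assumes "a \<in> K" "x \<in> carrier H" shows "hnorm H (a \<odot> x) = cmod a * hnorm H x"
proof -
  have "hinner H (a \<odot> x) (a \<odot> x) = complex_of_real ((cmod a)\<^sup>2) * hinner H x x"
    using assms by (simp add: hinner_smult_left hinner_smult_right complex_norm_square mult_ac del: of_real_power)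
  then have "(hnorm H (a \<odot> x))\<^sup>2 = (cmod a * hnorm H x)\<^sup>2"
    using assms by (simp add: hnorm_sq power_mult_distrib)
  then show ?thesis
    using assms by (metis hnorm_nonneg mult_nonneg_nonneg norm_ge_zero power2_eq_imp_eq smult_closed)
qed

lemma hnorm_add_sq:
  assumes "x \<in> carrier H" "y \<in> carrier H"
  shows "(hnorm H (x \<oplus> y))\<^sup>2 = (hnorm H x)\<^sup>2 + (hnorm H y)\<^sup>2 + 2 * Re (hinner H x y)"
  using assms hinner_cnj[of x y] by (simp add: hnorm_sq hinner_add_left hinner_add_right)

lemma hnorm_minus_sq:
  assumes "x \<in> carrier H" "y \<in> carrier H"
  shows "(hnorm H (x \<ominus> y))\<^sup>2 = (hnorm H x)\<^sup>2 + (hnorm H y)\<^sup>2 - 2 * Re (hinner H x y)"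
  using assms hinner_cnj[of x y] by (simp add: hnorm_sq hinner_minus_left hinner_minus_right)

section \<open>Orthonormal families\<close>

definition orthonormal_on :: "'i set \<Rightarrow> ('i \<Rightarrow> 'a) \<Rightarrow> bool" where
  "orthonormal_on A g \<longleftrightarrow> g \<in> A \<rightarrow> carrier H \<and>
     (\<forall>i\<in>A. \<forall>j\<in>A. hinner H (g i) (g j) = (if i = j then 1 else 0))"

lemma orthonormal_on_subset: "orthonormal_on A g \<Longrightarrow> B \<subseteq> A \<Longrightarrow> orthonormal_on B g"
  unfolding orthonormal_on_def by blast

lemma hnorm_lincomb:
  assumes "orthonormal_on F g" "finite F" "a \<in> F \<rightarrow> K"
  shows "(hnorm H (\<Oplus>i\<in>F. a i \<odot> g i))\<^sup>2 = (\<Sum>i\<in>F. (cmod (a i))\<^sup>2)"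
proof -
  have g: "g i \<in> carrier H" if "i \<in> F" for i using assms that by (auto simp: orthonormal_on_def)
  have a: "a i \<in> K" if "i \<in> F" for i using assms that by auto
  have ag: "(\<lambda>i. a i \<odot> g i) \<in> F \<rightarrow> carrier H" using g a by auto
  have "hinner H (\<Oplus>i\<in>F. a i \<odot> g i) (\<Oplus>i\<in>F. a i \<odot> g i)
      = (\<Sum>i\<in>F. \<Sum>j\<in>F. hinner H (a i \<odot> g i) (a j \<odot> g j))"
    unfolding hinner_finsum_left[OF ag finsum_closed[OF ag] assms(2)]
    using ag assms(2) by (intro sum.cong refl hinner_finsum_right) auto
  also have "\<dots> = (\<Sum>i\<in>F. \<Sum>j\<in>F. if i = j then a i * cnj (a i) else 0)"
    using assms(1) g a
    by (intro sum.cong refl) (auto simp: hinner_smult_left hinner_smult_right orthonormal_on_def)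
  also have "\<dots> = (\<Sum>i\<in>F. complex_of_real ((cmod (a i))\<^sup>2))"
    using assms(2) by (simp add: complex_norm_square del: of_real_power)
  finally show ?thesis using ag by (simp add: hnorm_sq)
qed

text \<open>
  The residual of the orthogonal projection onto a finite orthonormal family: its norm gives
  Bessel's inequality, and its orthogonality is what lets such a family be enlarged.
\<close>

lemma hnorm_residual:
  assumes "orthonormal_on F g" "finite F" "x \<in> carrier H"
  defines "r \<equiv> x \<ominus> (\<Oplus>i\<in>F. hinner H x (g i) \<odot> g i)"
  shows "(hnorm H r)\<^sup>2 = (hnorm H x)\<^sup>2 - (\<Sum>i\<in>F. (cmod (hinner H x (g i)))\<^sup>2)"
    and "j \<in> F \<Longrightarrow> hinner H r (g j) = 0"
proof -
  have g: "g i \<in> carrier H" if "i \<in> F" for i using assms that by (auto simp: orthonormal_on_def)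
  have ag: "(\<lambda>i. hinner H x (g i) \<odot> g i) \<in> F \<rightarrow> carrier H" using g assms(3) hinner_K by auto
  have "hinner H x (\<Oplus>i\<in>F. hinner H x (g i) \<odot> g i) = (\<Sum>i\<in>F. complex_of_real ((cmod (hinner H x (g i)))\<^sup>2))"
    using ag g assms(2,3) by (simp add: hinner_finsum_right hinner_smult_right hinner_K complex_norm_square mult_ac del: of_real_power)
  moreover have "(hnorm H (\<Oplus>i\<in>F. hinner H x (g i) \<odot> g i))\<^sup>2 = (\<Sum>i\<in>F. (cmod (hinner H x (g i)))\<^sup>2)"
    using assms g by (intro hnorm_lincomb) (auto intro: hinner_K)
  ultimately show "(hnorm H r)\<^sup>2 = (hnorm H x)\<^sup>2 - (\<Sum>i\<in>F. (cmod (hinner H x (g i)))\<^sup>2)"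
    unfolding r_def using ag assms(3) by (simp add: hnorm_minus_sq)
  assume j: "j \<in> F"
  have "hinner H (\<Oplus>i\<in>F. hinner H x (g i) \<odot> g i) (g j) = (\<Sum>i\<in>F. hinner H x (g i) * hinner H (g i) (g j))"
    using ag g j assms(2,3) by (simp add: hinner_finsum_left hinner_smult_left hinner_K)
  also have "\<dots> = (\<Sum>i\<in>F. if i = j then hinner H x (g i) else 0)"
    using assms(1) j by (intro sum.cong refl) (auto simp: orthonormal_on_def)
  also have "\<dots> = hinner H x (g j)"
    using assms(2) j by simp
  finally show "hinner H r (g j) = 0"
    unfolding r_def using ag assms(3) g j by (simp add: hinner_minus_left)
qed

lemma Bessel:
  assumes "orthonormal_on F g" "finite F" "x \<in> carrier H"
  shows "(\<Sum>i\<in>F. (cmod (hinner H x (g i)))\<^sup>2) \<le> (hnorm H x)\<^sup>2"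
proof -
  have "0 \<le> (hnorm H x)\<^sup>2 - (\<Sum>i\<in>F. (cmod (hinner H x (g i)))\<^sup>2)"
    unfolding hnorm_residual(1)[OF assms, symmetric] by simp
  then show ?thesis by simp
qed

lemma orthonormal_on_normalize:
  assumes "x \<in> carrier H" "x \<noteq> \<zero>"
  defines "e \<equiv> complex_of_real (1 / hnorm H x) \<odot> x"
  shows "e \<in> carrier H" "hinner H e e = 1" "y \<in> carrier H \<Longrightarrow> hinner H x y = 0 \<Longrightarrow> hinner H e y = 0"
    "y \<in> carrier H \<Longrightarrow> hinner H x y = 0 \<Longrightarrow> hinner H y e = 0"
proof -
  have n: "hnorm H x \<noteq> 0" using assms by (simp add: hnorm_eq_0)
  show e: "e \<in> carrier H" unfolding e_def by (intro smult_closed K_simps assms(1))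
  have "hnorm H e = 1" unfolding e_def using assms(1) n by (subst hnorm_smult) (auto simp del: of_real_divide simp: norm_of_real)
  then show "hinner H e e = 1" using e by (simp add: hinner_self)
  show *: "hinner H e y = 0" if "y \<in> carrier H" "hinner H x y = 0"
    unfolding e_def using assms(1) that by (subst hinner_smult_left) (auto simp del: of_real_divide)
  show "hinner H y e = 0" if "y \<in> carrier H" "hinner H x y = 0"
    using *[OF that] e that by (simp add: hinner_cnj[of e y])
qed

section \<open>The metric\<close>

text \<open>
  This is Bessel's inequality for the family that consists of the normalized vector \<open>y\<close>.
\<close>

lemma Cauchy_Schwarz:
  assumes "x \<in> carrier H" "y \<in> carrier H"
  shows "cmod (hinner H x y) \<le> hnorm H x * hnorm H y"
proof (cases "y = \<zero>")
  case True then show ?thesis using assms by simp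
next
  case False
  define e where "e = complex_of_real (1 / hnorm H y) \<odot> y"
  have n: "hnorm H y > 0" using assms False by (metis hnorm_eq_0 hnorm_nonneg less_eq_real_def)
  have "orthonormal_on {()} (\<lambda>_. e)"
    using orthonormal_on_normalize(1,2)[OF assms(2) False] by (simp add: orthonormal_on_def e_def)
  then have "(cmod (hinner H x e))\<^sup>2 \<le> (hnorm H x)\<^sup>2"
    using Bessel[of "{()}" "\<lambda>_. e" x] assms by simp
  then have "cmod (hinner H x e) \<le> hnorm H x"
    using assms(1) power2_le_imp_le by auto
  moreover have "hinner H x e = complex_of_real (1 / hnorm H y) * hinner H x y"
    unfolding e_def using assms by (subst hinner_smult_right) (auto simp del: of_real_divide)
  then have "cmod (hinner H x e) = cmod (hinner H x y) / hnorm H y"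
    using n by (simp add: norm_mult norm_divide)
  ultimately show ?thesis
    using n by (simp add: field_simps)
qed

lemma hnorm_triangle:
  assumes "x \<in> carrier H" "y \<in> carrier H"
  shows "hnorm H (x \<oplus> y) \<le> hnorm H x + hnorm H y"
proof -
  have "(hnorm H (x \<oplus> y))\<^sup>2 \<le> (hnorm H x + hnorm H y)\<^sup>2"
    using Cauchy_Schwarz[OF assms] complex_Re_le_cmod[of "hinner H x y"]
    unfolding hnorm_add_sq[OF assms] power2_sum by linarith
  then show ?thesis
    by (rule power2_le_imp_le) (use assms in simp)
qed

lemma hnorm_minus_commute:
  assumes "x \<in> carrier H" "y \<in> carrier H"
  shows "hnorm H (x \<ominus> y) = hnorm H (y \<ominus> x)"
proof -
  have "(hnorm H (x \<ominus> y))\<^sup>2 = (hnorm H (y \<ominus> x))\<^sup>2"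
    using assms hinner_cnj[of x y] by (simp add: hnorm_minus_sq)
  then show ?thesis using assms by (simp add: power2_eq_iff_nonneg)
qed

lemma hdist_eq: "x \<in> carrier H \<Longrightarrow> y \<in> carrier H \<Longrightarrow> hdist H x y = hnorm H (x \<ominus> y)"
  by (simp add: hdist_def)

sublocale metric: Metric_space "carrier H" "hdist H"
proof
  show "0 \<le> hdist H x y" for x y by (simp add: hdist_def)
  show "hdist H x y = hdist H y x" for x y using hnorm_minus_commute by (simp add: hdist_def)
  show "hdist H x y = 0 \<longleftrightarrow> x = y" if "x \<in> carrier H" "y \<in> carrier H" for x y
    using that minus_zero_imp_eq[OF that] by (auto simp: hdist_eq hnorm_eq_0)
  show "hdist H x z \<le> hdist H x y + hdist H y z"
    if "x \<in> carrier H" "y \<in> carrier H" "z \<in> carrier H" for x y z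
    using hnorm_triangle[OF minus_closed[OF that(1,2)] minus_closed[OF that(2,3)]]
    unfolding hdist_eq[OF that(1,2)] hdist_eq[OF that(1,3)] hdist_eq[OF that(2,3)]
      minus_triangle[OF that] .
qed

lemma in_closure_iff:
  "x \<in> htop H closure_of S \<longleftrightarrow>
     x \<in> carrier H \<and> (\<forall>\<epsilon>>0. \<exists>y\<in>S. y \<in> carrier H \<and> hnorm H (x \<ominus> y) < \<epsilon>)"
proof -
  have "(\<exists>y\<in>S. y \<in> metric.mball x e) \<longleftrightarrow> (\<exists>y\<in>S. y \<in> carrier H \<and> hnorm H (x \<ominus> y) < e)"
    if "x \<in> carrier H" for e
    unfolding metric.in_mball using that hdist_eq[OF that] by (intro bex_cong) auto
  then show ?thesis
    unfolding htop_def metric.metric_closure_of mem_Collect_eq by (simp cong: conj_cong)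
qed

lemma hspanE:
  assumes "x \<in> hspan K H S"
  obtains F a where "finite F" "F \<subseteq> S" "a \<in> F \<rightarrow> K" "x = (\<Oplus>b\<in>F. a b \<odot> b)"
  using assms unfolding hspan_def mem_Collect_eq by (elim exE conjE)

lemma eq_if_hinner_eq:
  assumes "x \<in> carrier H" "y \<in> carrier H" "\<And>w. w \<in> carrier H \<Longrightarrow> hinner H x w = hinner H y w"
  shows "x = y"
proof -
  have "hinner H (x \<ominus> y) (x \<ominus> y) = 0"
    using assms by (simp add: hinner_minus_left)
  then have "x \<ominus> y = \<zero>"
    by (intro hinner_zeroD minus_closed assms)
  then show ?thesis
    by (rule minus_zero_imp_eq[OF assms(1,2)])
qed

end

section \<open>Unordered sums in Hilbert spaces\<close>

context inner_space
begin

lemma finsum_Diff: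
  assumes "finite F" "G \<subseteq> F" "x \<in> F \<rightarrow> carrier H"
  shows "finsum H x F \<ominus> finsum H x G = finsum H x (F - G)"
proof -
  have G: "x \<in> G \<rightarrow> carrier H" "x \<in> F - G \<rightarrow> carrier H" "finite G"
    using assms finite_subset by auto
  have "finsum H x (G \<union> (F - G)) = finsum H x G \<oplus> finsum H x (F - G)"
    by (rule finsum_Un_disjoint) (use assms G in auto)
  moreover have "G \<union> (F - G) = F" using assms(2) by blast
  ultimately have "finsum H x F = finsum H x G \<oplus> finsum H x (F - G)" by simp
  then show ?thesis
    using add_minus_cancel'[OF finsum_closed[OF G(1)] finsum_closed[OF G(2)]] by simp
qed

text \<open>
  Convergence of the net of finite partial sums; sums over uncountable index sets occur, since
  the Hilbert spaces are not assumed to be separable.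
\<close>

definition norm_sums :: "'i set \<Rightarrow> ('i \<Rightarrow> 'a) \<Rightarrow> 'a \<Rightarrow> bool" where
  "norm_sums A x y \<longleftrightarrow> (\<forall>\<epsilon>>0. \<exists>G. finite G \<and> G \<subseteq> A \<and>
     (\<forall>F. finite F \<longrightarrow> G \<subseteq> F \<longrightarrow> F \<subseteq> A \<longrightarrow> hnorm H (y \<ominus> finsum H x F) < \<epsilon>))"

lemma norm_sumsE:
  assumes "norm_sums A x y" "\<epsilon> > 0"
  obtains G where "finite G" "G \<subseteq> A"
    "\<forall>F. finite F \<longrightarrow> G \<subseteq> F \<longrightarrow> F \<subseteq> A \<longrightarrow> hnorm H (y \<ominus> finsum H x F) < \<epsilon>"
  using assms unfolding norm_sums_def by metis

end

context complete_inner_space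
begin

text \<open>
  The finite partial sums form a Cauchy net, because the tails of \<open>s\<close> control them. The limit is
  taken along an increasing sequence of finite sets \<open>G k\<close> that exhaust \<open>s\<close> up to \<open>1 / (k + 1)\<close>;
  from then on every larger finite set is as good as the sequence itself. The two instances are
  Fourier series (\<open>C = 1\<close>) and series \<open>\<Sum> \<langle>z, t\<^sub>e\<rangle> S\<^sub>e\<close>, where \<open>C\<close> is the square of the norm of \<open>z\<close>.
\<close>

lemma norm_limit_if_dominated:
  fixes x :: "'i \<Rightarrow> 'a" and s :: "'i \<Rightarrow> real"
  assumes x: "x \<in> A \<rightarrow> carrier H" and s: "s summable_on A" "\<And>i. i \<in> A \<Longrightarrow> 0 \<le> s i" and C: "0 \<le> C"
    and dom: "\<And>F. finite F \<Longrightarrow> F \<subseteq> A \<Longrightarrow> (hnorm H (finsum H x F))\<^sup>2 \<le> C * sum s F"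
  obtains y where "y \<in> carrier H" "norm_sums A x y"
proof -
  have fs: "finsum H x F \<in> carrier H" if "F \<subseteq> A" for F
    using x that by (intro finsum_closed) auto
  have "\<exists>G. finite G \<and> G \<subseteq> A \<and> infsum s A - sum s G < 1 / real (Suc k)" for k
  proof (rule ccontr)
    assume "\<nexists>G. finite G \<and> G \<subseteq> A \<and> infsum s A - sum s G < 1 / real (Suc k)"
    then have "sum s G \<le> infsum s A - 1 / real (Suc k)" if "finite G" "G \<subseteq> A" for G
      using that by (metis diff_le_eq le_diff_eq linorder_not_less diff_add_cancel add.commute)
    then have "infsum s A \<le> infsum s A - 1 / real (Suc k)"
      by (rule infsum_le_finite_sums[OF s(1)])
    then show False by simp
  qed
  then obtain G0 where G0: "\<And>k. finite (G0 k)" "\<And>k. G0 k \<subseteq> A"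
      "\<And>k. infsum s A - sum s (G0 k) < 1 / real (Suc k)"
    by metis
  define G where "G k = (\<Union>j\<le>k. G0 j)" for k
  have G: "finite (G k)" "G k \<subseteq> A" for k
    unfolding G_def using G0 by auto
  have mono: "G k \<subseteq> G l" if "k \<le> l" for k l
    unfolding G_def using that by (auto intro: order_trans)
  have tail: "(hnorm H (finsum H x F \<ominus> finsum H x (G k)))\<^sup>2 \<le> C / real (Suc k)"
    if F: "finite F" "F \<subseteq> A" "G k \<subseteq> F" for F k
  proof -
    have "sum s (F - G k) = sum s F - sum s (G k)"
      using F by (simp add: sum_diff)
    moreover have "sum s F \<le> infsum s A"
      by (rule finite_sum_le_infsum) (use F s in auto)
    moreover have "sum s (G0 k) \<le> sum s (G k)"
    proof (rule sum_mono2[OF G(1)])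
      show "G0 k \<subseteq> G k" by (auto simp: G_def)
      show "0 \<le> s b" if "b \<in> G k - G0 k" for b using that G(2) s(2) by blast
    qed
    ultimately have "sum s (F - G k) \<le> 1 / real (Suc k)"
      using G0(3)[of k] by linarith
    then have "C * sum s (F - G k) \<le> C / real (Suc k)"
      using C mult_left_mono by fastforce
    moreover have "(hnorm H (finsum H x (F - G k)))\<^sup>2 \<le> C * sum s (F - G k)"
      by (rule dom) (use F in auto)
    moreover have "finsum H x F \<ominus> finsum H x (G k) = finsum H x (F - G k)"
      by (rule finsum_Diff) (use F x in auto)
    ultimately show ?thesis by simp
  qed
  have small: "\<exists>k0. \<forall>k\<ge>k0. \<forall>F. finite F \<longrightarrow> F \<subseteq> A \<longrightarrow> G k \<subseteq> F \<longrightarrow>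
      hnorm H (finsum H x F \<ominus> finsum H x (G k)) < \<epsilon>" if e: "\<epsilon> > 0" for \<epsilon>
  proof -
    obtain k0 where k0: "C / \<epsilon>\<^sup>2 < real (Suc k0)"
      using reals_Archimedean2 by (metis less_Suc_eq of_nat_less_iff order.strict_trans)
    have "hnorm H (finsum H x F \<ominus> finsum H x (G k)) < \<epsilon>"
      if k: "k \<ge> k0" and F: "finite F" "F \<subseteq> A" "G k \<subseteq> F" for k F
    proof -
      have "C / \<epsilon>\<^sup>2 < real (Suc k)" using k k0 by (meson less_le_trans of_nat_le_iff Suc_le_mono)
      then have "C / real (Suc k) < \<epsilon>\<^sup>2" using e by (simp add: field_simps)
      then have "(hnorm H (finsum H x F \<ominus> finsum H x (G k)))\<^sup>2 < \<epsilon>\<^sup>2"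
        using tail[OF F] by linarith
      then show ?thesis
        using e by (simp add: power_less_imp_less_base)
    qed
    then show ?thesis by blast
  qed
  have "metric.MCauchy (\<lambda>k. finsum H x (G k))"
    unfolding metric.MCauchy_def
  proof (intro conjI allI impI)
    show "range (\<lambda>k. finsum H x (G k)) \<subseteq> carrier H" by (intro image_subsetI fs G)
    fix \<epsilon> :: real assume "\<epsilon> > 0"
    from small[OF this] obtain k0 where k0: "\<forall>k\<ge>k0. \<forall>F. finite F \<longrightarrow> F \<subseteq> A \<longrightarrow> G k \<subseteq> F \<longrightarrow>
        hnorm H (finsum H x F \<ominus> finsum H x (G k)) < \<epsilon>" ..
    have *: "hdist H (finsum H x (G l)) (finsum H x (G k)) < \<epsilon>" if "k0 \<le> k" "k \<le> l" for k l
      using k0[rule_format, OF that(1) G mono[OF that(2)]] fs G by (simp add: hdist_eq)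
    show "\<exists>N. \<forall>n n'. N \<le> n \<longrightarrow> N \<le> n' \<longrightarrow> hdist H (finsum H x (G n)) (finsum H x (G n')) < \<epsilon>"
      by (metis * metric.commute nat_le_linear)
  qed
  then obtain y where y: "limitin metric.mtopology (\<lambda>k. finsum H x (G k)) y sequentially"
    using mcomplete metric.mcomplete_def by blast
  then have yc: "y \<in> carrier H"
    and yl: "\<And>\<epsilon>. \<epsilon> > 0 \<Longrightarrow> \<exists>N. \<forall>k\<ge>N. hdist H (finsum H x (G k)) y < \<epsilon>"
    unfolding metric.limit_metric_sequentially by blast+
  have "\<exists>G. finite G \<and> G \<subseteq> A \<and>
            (\<forall>F. finite F \<longrightarrow> G \<subseteq> F \<longrightarrow> F \<subseteq> A \<longrightarrow> hnorm H (y \<ominus> finsum H x F) < \<epsilon>)" if e: "\<epsilon> > 0" for \<epsilon>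
  proof -
    have e2: "\<epsilon> / 2 > 0" using e by simp
    from small[OF e2] obtain k0 where k0: "\<forall>k\<ge>k0. \<forall>F. finite F \<longrightarrow> F \<subseteq> A \<longrightarrow> G k \<subseteq> F \<longrightarrow>
        hnorm H (finsum H x F \<ominus> finsum H x (G k)) < \<epsilon> / 2" ..
    obtain N where N: "\<And>k. k \<ge> N \<Longrightarrow> hdist H (finsum H x (G k)) y < \<epsilon> / 2"
      using yl[OF e2] by blast
    define k where "k = max k0 N"
    have "hnorm H (y \<ominus> finsum H x F) < \<epsilon>" if F: "finite F" "G k \<subseteq> F" "F \<subseteq> A" for F
    proof -
      have "hdist H (finsum H x F) (finsum H x (G k)) < \<epsilon> / 2"
        using k0[rule_format, of k F] F fs G by (simp add: hdist_eq k_def)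
      moreover have "hdist H (finsum H x (G k)) y < \<epsilon> / 2"
        using N[of k] by (simp add: k_def)
      ultimately have "hdist H (finsum H x F) y < \<epsilon>"
        using metric.triangle[of "finsum H x F" "finsum H x (G k)" y] fs[OF F(3)] fs[OF G(2)] yc
        by fastforce
      then show ?thesis
        using fs[OF F(3)] yc hnorm_minus_commute by (simp add: hdist_eq)
    qed
    then show ?thesis using G[of k] by (intro exI[of _ "G k"] conjI allI impI)
  qed
  then have "norm_sums A x y" unfolding norm_sums_def by (intro allI impI)
  then show ?thesis using yc that by simp
qed

text \<open>
  Testing a vector sum against all vectors \<open>w\<close> determines it and turns vector-valued sums
  into sums of complex numbers.
\<close>

lemma weak_sum_exists:
  fixes x :: "'i \<Rightarrow> 'a" and s :: "'i \<Rightarrow> real"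
  assumes x: "x \<in> A \<rightarrow> carrier H" and s: "s summable_on A" "\<And>i. i \<in> A \<Longrightarrow> 0 \<le> s i" and C: "0 \<le> C"
    and dom: "\<And>F. finite F \<Longrightarrow> F \<subseteq> A \<Longrightarrow> (hnorm H (finsum H x F))\<^sup>2 \<le> C * sum s F"
  obtains y where "y \<in> carrier H"
    "\<And>w. w \<in> carrier H \<Longrightarrow> ((\<lambda>i. hinner H (x i) w) has_sum hinner H y w) A"
proof -
  obtain y where y: "y \<in> carrier H" and lim: "norm_sums A x y"
    by (rule norm_limit_if_dominated[OF assms])
  have "((\<lambda>i. hinner H (x i) w) has_sum hinner H y w) A" if w: "w \<in> carrier H" for w
    unfolding has_sum_def tendsto_iff eventually_finite_subsets_at_top
  proof (intro allI impI)
    fix e :: real assume e: "e > 0"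
    \<comment> \<open>The summand \<open>1\<close> only prevents a division by zero.\<close>
    define d where "d = e / (hnorm H w + 1)"
    have d: "d > 0" using e w by (simp add: d_def add_nonneg_pos)
    obtain G where G: "finite G" "G \<subseteq> A"
      "\<forall>F. finite F \<longrightarrow> G \<subseteq> F \<longrightarrow> F \<subseteq> A \<longrightarrow> hnorm H (y \<ominus> finsum H x F) < d"
      by (rule norm_sumsE[OF lim d])
    have "dist (\<Sum>i\<in>F. hinner H (x i) w) (hinner H y w) < e"
      if F: "finite F" "G \<subseteq> F" "F \<subseteq> A" for F
    proof -
      have xF: "x \<in> F \<rightarrow> carrier H" using x F by auto
      have "hinner H y w - (\<Sum>i\<in>F. hinner H (x i) w) = hinner H (y \<ominus> finsum H x F) w"
        unfolding hinner_minus_left[OF y finsum_closed[OF xF] w]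
          hinner_finsum_left[OF xF w F(1)] ..
      moreover have "cmod (hinner H (y \<ominus> finsum H x F) w) \<le> hnorm H (y \<ominus> finsum H x F) * hnorm H w"
        by (intro Cauchy_Schwarz minus_closed y finsum_closed xF w)
      moreover have "hnorm H (y \<ominus> finsum H x F) * hnorm H w \<le> d * hnorm H w"
        using G(3)[rule_format, OF F] w by (intro mult_right_mono) auto
      moreover have "d * hnorm H w < e"
      proof -
        have pos: "hnorm H w + 1 > 0" using hnorm_nonneg[OF w] by linarith
        have "d * hnorm H w = (e * hnorm H w) / (hnorm H w + 1)" by (simp add: d_def)
        also have "\<dots> < e"
          using e by (subst pos_divide_less_eq[OF pos]) (simp add: algebra_simps)
        finally show ?thesis .
      qed
      ultimately show ?thesis
        by (simp add: dist_norm norm_minus_commute)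
    qed
    then show "\<exists>X. finite X \<and> X \<subseteq> A \<and> (\<forall>Y. finite Y \<and> X \<subseteq> Y \<and> Y \<subseteq> A \<longrightarrow>
        dist (\<Sum>i\<in>Y. hinner H (x i) w) (hinner H y w) < e)"
      using G(1,2) by (intro exI[of _ G]) simp
  qed
  then show ?thesis using that y by simp
qed

end

section \<open>Finite Parseval identities and orthonormal bases\<close>

context inner_space
begin

lemma orthonormal_on_insert:
  assumes L: "orthonormal_on L (\<lambda>b. b)" and e: "e \<in> carrier H" "hinner H e e = 1"
    and ort: "\<And>b. b \<in> L \<Longrightarrow> hinner H e b = 0"
  shows "orthonormal_on (insert e L) (\<lambda>b. b)" and "e \<notin> L"
proof -
  have Lc: "b \<in> carrier H" if "b \<in> L" for b
    using L that by (auto simp: orthonormal_on_def)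
  show "e \<notin> L" using e(2) ort by fastforce
  moreover have "hinner H b e = 0" if "b \<in> L" for b
    using hinner_cnj[OF e(1) Lc[OF that]] ort[OF that] by simp
  ultimately show "orthonormal_on (insert e L) (\<lambda>b. b)"
    using L e ort unfolding orthonormal_on_def by auto
qed

text \<open>
  The Gram-Schmidt process. A vector that satisfies Parseval's identity for \<open>L\<close> also satisfies
  it for every larger orthonormal set, by Bessel's inequality, so that the earlier vectors are
  not spoilt when a normalized residual is added.
\<close>

lemma finite_orthonormal_Parseval:
  assumes "finite Y" "Y \<subseteq> carrier H"
  shows "\<exists>L. finite L \<and> orthonormal_on L (\<lambda>g. g) \<and>
    (\<forall>y\<in>Y. (hnorm H y)\<^sup>2 = (\<Sum>g\<in>L. (cmod (hinner H y g))\<^sup>2))"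
  using assms
proof (induction Y)
  case empty
  then show ?case by (intro exI[of _ "{}"]) (auto simp: orthonormal_on_def)
next
  case (insert y Y)
  then obtain L where L: "finite L" "orthonormal_on L (\<lambda>g. g)"
    and P: "\<And>z. z \<in> Y \<Longrightarrow> (hnorm H z)\<^sup>2 = (\<Sum>g\<in>L. (cmod (hinner H z g))\<^sup>2)"
    by auto
  have y: "y \<in> carrier H" and Y: "\<And>z. z \<in> Y \<Longrightarrow> z \<in> carrier H" using insert.prems by auto
  have Lc: "\<And>g. g \<in> L \<Longrightarrow> g \<in> carrier H" using L by (auto simp: orthonormal_on_def)
  define v where "v = (\<Oplus>g\<in>L. hinner H y g \<odot> g)"
  have vc: "(\<lambda>g. hinner H y g \<odot> g) \<in> L \<rightarrow> carrier H"
    using Lc y by (intro Pi_I smult_closed hinner_K) auto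
  then have v: "v \<in> carrier H" unfolding v_def by (rule finsum_closed)
  define r where "r = y \<ominus> v"
  have r: "r \<in> carrier H" unfolding r_def using y v by (rule minus_closed)
  have rsq: "(hnorm H r)\<^sup>2 = (hnorm H y)\<^sup>2 - (\<Sum>g\<in>L. (cmod (hinner H y g))\<^sup>2)"
    and rort: "\<And>g. g \<in> L \<Longrightarrow> hinner H r g = 0"
    unfolding r_def v_def using hnorm_residual[OF L(2,1) y] by auto
  show ?case
  proof (cases "r = \<zero>")
    case True
    then show ?thesis using L P rsq by (intro exI[of _ L]) auto
  next
    case False
    define e where "e = complex_of_real (1 / hnorm H r) \<odot> r"
    note en = orthonormal_on_normalize[OF r False, folded e_def]
    have ort: "hinner H e g = 0" if "g \<in> L" for g
      using en(3)[OF Lc[OF that] rort[OF that]] .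
    note L' = orthonormal_on_insert[OF L(2) en(1,2) ort]
    have fin: "finite (insert e L)" using L by simp
    have old: "(hnorm H z)\<^sup>2 = (\<Sum>g\<in>insert e L. (cmod (hinner H z g))\<^sup>2)" if "z \<in> Y" for z
    proof (rule antisym)
      show "(hnorm H z)\<^sup>2 \<le> (\<Sum>g\<in>insert e L. (cmod (hinner H z g))\<^sup>2)"
        unfolding P[OF that] using fin by (intro sum_mono2) auto
      show "(\<Sum>g\<in>insert e L. (cmod (hinner H z g))\<^sup>2) \<le> (hnorm H z)\<^sup>2"
        by (rule Bessel[OF L'(1) fin Y[OF that]])
    qed
    have "hinner H v e = (\<Sum>g\<in>L. hinner H (hinner H y g \<odot> g) e)"
      unfolding v_def by (rule hinner_finsum_left[OF vc en(1) L(1)])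
    also have "\<dots> = 0"
    proof (intro sum.neutral ballI)
      fix g assume g: "g \<in> L"
      have "hinner H g e = 0" using hinner_cnj[OF en(1) Lc[OF g]] ort[OF g] by simp
      then show "hinner H (hinner H y g \<odot> g) e = 0"
        by (subst hinner_smult_left[OF hinner_K[OF y Lc[OF g]] Lc[OF g] en(1)]) simp
    qed
    finally have "hinner H y e = hinner H r e"
      unfolding r_def hinner_minus_left[OF y v en(1)] by simp
    also have "\<dots> = complex_of_real (1 / hnorm H r) * complex_of_real ((hnorm H r)\<^sup>2)"
      unfolding e_def by (subst hinner_smult_right[OF _ r r]) (simp_all add: hinner_self[OF r])
    also have "\<dots> = complex_of_real (hnorm H r)"
      by (simp add: power2_eq_square)
    finally have "(cmod (hinner H y e))\<^sup>2 = (hnorm H r)\<^sup>2"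
      by simp
    then have "(hnorm H y)\<^sup>2 = (\<Sum>g\<in>insert e L. (cmod (hinner H y g))\<^sup>2)"
      using L(1) L'(2) rsq by simp
    then show ?thesis using L' fin old by (intro exI[of _ "insert e L"]) auto
  qed
qed

lemma hspanI: "finite F \<Longrightarrow> F \<subseteq> S \<Longrightarrow> a \<in> F \<rightarrow> K \<Longrightarrow> (\<Oplus>b\<in>F. a b \<odot> b) \<in> hspan K H S"
  unfolding hspan_def by blast

end

context complete_inner_space
begin

text \<open>
  A maximal orthonormal set exists by Zorn's lemma. The Fourier series of \<open>x\<close> converges, and
  the difference between \<open>x\<close> and its sum is orthogonal to the set, hence zero by maximality.
  So \<open>x\<close> is a limit of finite linear combinations.
\<close>

lemma ex_orthonormal_basis: "\<exists>B. orthonormal_basis K H B"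
proof -
  define \<O> where "\<O> = {B. orthonormal_on B (\<lambda>b. b)}"
  have "\<Union>C \<in> \<O>" if C: "subset.chain \<O> C" for C
  proof -
    have sub: "B \<in> C \<Longrightarrow> orthonormal_on B (\<lambda>b. b)" for B
      using C by (auto simp: subset.chain_def \<O>_def)
    have lin: "B \<subseteq> B' \<or> B' \<subseteq> B" if "B \<in> C" "B' \<in> C" for B B'
      using C that by (auto simp: subset.chain_def)
    have "hinner H b b' = (if b = b' then 1 else 0)" if b: "b \<in> \<Union>C" "b' \<in> \<Union>C" for b b'
    proof -
      obtain B B' where B: "B \<in> C" "b \<in> B" "B' \<in> C" "b' \<in> B'" using b by blast
      then obtain D where "D \<in> C" "b \<in> D" "b' \<in> D" using lin by blast
      then show ?thesis using sub[of D] by (simp add: orthonormal_on_def)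
    qed
    moreover have "b \<in> carrier H" if "b \<in> \<Union>C" for b
      using sub that by (auto simp: orthonormal_on_def)
    ultimately show ?thesis by (auto simp: \<O>_def orthonormal_on_def)
  qed
  from subset_Zorn'[of \<O>, OF this] obtain B where B: "orthonormal_on B (\<lambda>b. b)"
    and maximal: "\<And>B'. orthonormal_on B' (\<lambda>b. b) \<Longrightarrow> B \<subseteq> B' \<Longrightarrow> B' = B"
    unfolding \<O>_def by blast
  have Bc: "\<And>b. b \<in> B \<Longrightarrow> b \<in> carrier H" using B by (auto simp: orthonormal_on_def)
  have "x \<in> htop H closure_of hspan K H B" if x: "x \<in> carrier H" for x
  proof -
    define c where "c b = hinner H x b" for b
    define s where "s b = (cmod (c b))\<^sup>2" for b
    have cK: "c b \<in> K" if "b \<in> B" for b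
      unfolding c_def by (rule hinner_K[OF x Bc[OF that]])
    have cb: "(\<lambda>b. c b \<odot> b) \<in> B \<rightarrow> carrier H"
      using cK Bc by (intro Pi_I smult_closed) auto
    have "s summable_on B"
    proof (rule nonneg_bdd_above_summable_on)
      show "bdd_above (sum s ` {F. F \<subseteq> B \<and> finite F})"
        by (intro bdd_aboveI2[where M = "(hnorm H x)\<^sup>2"])
           (use Bessel[OF orthonormal_on_subset[OF B] _ x] in \<open>auto simp: s_def c_def\<close>)
    qed (simp add: s_def)
    moreover have "(hnorm H (\<Oplus>b\<in>F. c b \<odot> b))\<^sup>2 \<le> 1 * sum s F" if F: "finite F" "F \<subseteq> B" for F
    proof -
      have "c \<in> F \<rightarrow> K" using cK F by auto
      then show ?thesis
        using hnorm_lincomb[OF orthonormal_on_subset[OF B F(2)] F(1)] by (simp add: s_def)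
    qed
    ultimately obtain y where y: "y \<in> carrier H"
      and lim: "norm_sums B (\<lambda>b. c b \<odot> b) y"
      using norm_limit_if_dominated[OF cb, of s 1] by (auto simp: s_def)
    have ort: "hinner H (x \<ominus> y) b = 0" if b: "b \<in> B" for b
    proof (rule ccontr)
      assume nz: "hinner H (x \<ominus> y) b \<noteq> 0"
      then have "cmod (hinner H (x \<ominus> y) b) > 0" by simp
      obtain G where G: "finite G" "G \<subseteq> B"
        "\<forall>F. finite F \<longrightarrow> G \<subseteq> F \<longrightarrow> F \<subseteq> B \<longrightarrow>
           hnorm H (y \<ominus> (\<Oplus>b\<in>F. c b \<odot> b)) < cmod (hinner H (x \<ominus> y) b)"
        by (rule norm_sumsE[OF lim \<open>cmod (hinner H (x \<ominus> y) b) > 0\<close>])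
      \<comment> \<open>A partial sum that contains the index \<open>b\<close> already has the correct coefficient there.\<close>
      define F where "F = insert b G"
      have F: "finite F" "G \<subseteq> F" "F \<subseteq> B" "b \<in> F" unfolding F_def using G b by auto
      define v where "v = (\<Oplus>b\<in>F. c b \<odot> b)"
      have v: "v \<in> carrier H" unfolding v_def using cb F by (intro finsum_closed) auto
      have "hinner H (x \<ominus> v) b = 0"
        unfolding v_def c_def by (rule hnorm_residual(2)[OF orthonormal_on_subset[OF B F(3)] F(1) x F(4)])
      then have "hinner H (x \<ominus> y) b = - hinner H (y \<ominus> v) b"
        unfolding hinner_minus_left[OF x v Bc[OF b]] hinner_minus_left[OF y v Bc[OF b]]
          hinner_minus_left[OF x y Bc[OF b]] by simp
      then have "cmod (hinner H (x \<ominus> y) b) \<le> hnorm H (y \<ominus> v) * hnorm H b"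
        using Cauchy_Schwarz[OF minus_closed[OF y v] Bc[OF b]] by simp
      moreover have "hnorm H b = 1"
        using B b by (simp add: hnorm_def orthonormal_on_def)
      ultimately show False using G(3)[rule_format, OF F(1-3)] by (simp add: v_def)
    qed
    have xy: "x \<ominus> y \<in> carrier H" by (rule minus_closed[OF x y])
    have "x \<ominus> y = \<zero>"
    proof (rule ccontr)
      assume nz: "x \<ominus> y \<noteq> \<zero>"
      define e where "e = complex_of_real (1 / hnorm H (x \<ominus> y)) \<odot> (x \<ominus> y)"
      note en = orthonormal_on_normalize[OF xy nz, folded e_def]
      note ins = orthonormal_on_insert[OF B en(1,2) en(3)[OF Bc ort]]
      show False using maximal[OF ins(1)] ins(2) by blast
    qed
    then have "x = y" by (rule minus_zero_imp_eq[OF x y])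
    show ?thesis
      unfolding in_closure_iff
    proof (intro conjI x allI impI)
      fix \<epsilon> :: real assume "\<epsilon> > 0"
      then obtain G where G: "finite G" "G \<subseteq> B" "\<forall>F. finite F \<longrightarrow> G \<subseteq> F \<longrightarrow> F \<subseteq> B \<longrightarrow>
          hnorm H (x \<ominus> (\<Oplus>b\<in>F. c b \<odot> b)) < \<epsilon>"
        by (rule norm_sumsE[OF lim[folded \<open>x = y\<close>]])
      have "hnorm H (x \<ominus> (\<Oplus>b\<in>G. c b \<odot> b)) < \<epsilon>"
        using G(3)[rule_format, of G] G(1,2) by simp
      moreover have "(\<Oplus>b\<in>G. c b \<odot> b) \<in> hspan K H B"
        using G cK by (intro hspanI) auto
      moreover have "(\<Oplus>b\<in>G. c b \<odot> b) \<in> carrier H"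
        using cb G by (intro finsum_closed) auto
      ultimately show "\<exists>z\<in>hspan K H B. z \<in> carrier H \<and> hnorm H (x \<ominus> z) < \<epsilon>" by blast
    qed
  qed
  then have "htop H closure_of hspan K H B = carrier H"
    unfolding in_closure_iff by (auto simp: in_closure_iff)
  then show ?thesis
    using B Bc unfolding orthonormal_basis_def orthonormal_on_def by blast
qed

end

section \<open>Continuous linear operators\<close>

lemma scalar_space_simps [simp]:
  "carrier (scalar_space K) = K" "zero (scalar_space K) = 0"
  "add (scalar_space K) a b = a + b" "smult (scalar_space K) a b = a * b"
  "hinner (scalar_space K) a b = a * cnj b"
  by (simp_all add: scalar_space_def)

lemma hnorm_scalar_space [simp]: "hnorm (scalar_space K) a = cmod a"
  unfolding hnorm_def by (simp add: cmod_def power2_eq_square)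

lemma inner_space_scalar_space:
  assumes K: "K = \<real> \<or> K = (UNIV :: complex set)"
  shows "inner_space K (scalar_space K)"
proof (rule inner_space.intro)
  note K' = K_closed[OF K]
  show "module (scalar_field K) (scalar_space K)"
  proof (rule moduleI)
    show "cring (scalar_field K)"
    proof (rule cringI)
      show "abelian_group (scalar_field K)"
      proof (rule abelian_groupI)
        show "\<exists>y\<in>carrier (scalar_field K). y \<oplus>\<^bsub>scalar_field K\<^esub> x = \<zero>\<^bsub>scalar_field K\<^esub>"
          if "x \<in> carrier (scalar_field K)" for x
          using that K'(5) by (intro bexI[of _ "- x"]) (auto simp: scalar_field_def)
      qed (auto simp: scalar_field_def K')
      show "Group.comm_monoid (scalar_field K)"
        by (rule comm_monoidI) (auto simp: scalar_field_def K')
    qed (auto simp: scalar_field_def algebra_simps)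
    show "abelian_group (scalar_space K)"
    proof (rule abelian_groupI)
      show "\<exists>y\<in>carrier (scalar_space K). y \<oplus>\<^bsub>scalar_space K\<^esub> x = \<zero>\<^bsub>scalar_space K\<^esub>"
        if "x \<in> carrier (scalar_space K)" for x
        using that K'(5) by (intro bexI[of _ "- x"]) auto
    qed (auto simp: K')
  qed (auto simp: scalar_field_def K' algebra_simps)
qed (use K_closed[OF K] assms in \<open>auto simp: algebra_simps\<close>)

lemma scalar_space_minus [simp]:
  assumes K: "K = \<real> \<or> K = (UNIV :: complex set)" and "a \<in> K" "b \<in> K"
  shows "a \<ominus>\<^bsub>scalar_space K\<^esub> b = a - b"
proof -
  interpret S: inner_space K "scalar_space K" by (rule inner_space_scalar_space[OF K])
  show ?thesis using assms by (subst S.minus_eq) auto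
qed

locale linear_operator = E: inner_space K E + G: inner_space K G
  for K and E :: "'e hspace" and G :: "'g hspace" +
  fixes f
  assumes linear: "linear_map K E G f"
begin

lemma closed [simp]: "x \<in> carrier E \<Longrightarrow> f x \<in> carrier G"
  using linear by (auto simp: linear_map_def)

lemma lin: "a \<in> K \<Longrightarrow> x \<in> carrier E \<Longrightarrow> y \<in> carrier E \<Longrightarrow>
    f (a \<odot>\<^bsub>E\<^esub> x \<oplus>\<^bsub>E\<^esub> y) = a \<odot>\<^bsub>G\<^esub> f x \<oplus>\<^bsub>G\<^esub> f y"
  using linear by (simp add: linear_map_def)

lemma minus:
  assumes "x \<in> carrier E" "y \<in> carrier E"
  shows "f (x \<ominus>\<^bsub>E\<^esub> y) = f x \<ominus>\<^bsub>G\<^esub> f y"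
  using assms by (simp add: E.minus_eq G.minus_eq lin)

lemma zero [simp]: "f \<zero>\<^bsub>E\<^esub> = \<zero>\<^bsub>G\<^esub>"
  using minus[of "\<zero>\<^bsub>E\<^esub>" "\<zero>\<^bsub>E\<^esub>"] by simp

lemma smult: "a \<in> K \<Longrightarrow> x \<in> carrier E \<Longrightarrow> f (a \<odot>\<^bsub>E\<^esub> x) = a \<odot>\<^bsub>G\<^esub> f x"
  using lin[of a x "\<zero>\<^bsub>E\<^esub>"] by simp

lemma finsum:
  assumes "finite F" "a \<in> F \<rightarrow> K" "x \<in> F \<rightarrow> carrier E"
  shows "f (\<Oplus>\<^bsub>E\<^esub>i\<in>F. a i \<odot>\<^bsub>E\<^esub> x i) = (\<Oplus>\<^bsub>G\<^esub>i\<in>F. a i \<odot>\<^bsub>G\<^esub> f (x i))"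
  using assms
proof (induction F)
  case empty then show ?case by simp
next
  case (insert i F)
  have c: "(\<lambda>i. a i \<odot>\<^bsub>E\<^esub> x i) \<in> F \<rightarrow> carrier E" "(\<lambda>i. a i \<odot>\<^bsub>G\<^esub> f (x i)) \<in> F \<rightarrow> carrier G"
    using insert.prems by (auto intro!: E.smult_closed G.smult_closed closed)
  show ?case
    using insert c by (simp add: lin E.smult_closed G.smult_closed E.finsum_closed)
qed

lemma continuous_iff:
  "continuous_map (htop E) (htop G) f \<longleftrightarrow>
    (\<forall>a\<in>carrier E. \<forall>\<epsilon>>0. \<exists>\<delta>>0. \<forall>x. x \<in> carrier E \<and> hnorm E (a \<ominus>\<^bsub>E\<^esub> x) < \<delta> \<longrightarrow>
        hnorm G (f (a \<ominus>\<^bsub>E\<^esub> x)) < \<epsilon>)"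
proof -
  have "f ` carrier E \<subseteq> carrier G" by auto
  moreover have "(x \<in> carrier E \<and> hdist E a x < \<delta> \<longrightarrow> hdist G (f a) (f x) < \<epsilon>) \<longleftrightarrow>
      (x \<in> carrier E \<and> hnorm E (a \<ominus>\<^bsub>E\<^esub> x) < \<delta> \<longrightarrow> hnorm G (f (a \<ominus>\<^bsub>E\<^esub> x)) < \<epsilon>)"
    if "a \<in> carrier E" for a x \<delta> \<epsilon>
    using that by (auto simp: E.hdist_eq G.hdist_eq minus)
  ultimately show ?thesis
    unfolding htop_def E.metric.metric_continuous_map[OF G.metric.Metric_space_axioms]
    by (simp cong: ball_cong)
qed

lemma continuous_if_bounded:
  assumes "\<And>z. z \<in> carrier E \<Longrightarrow> hnorm G (f z) \<le> C * hnorm E z"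
  shows "continuous_map (htop E) (htop G) f"
  unfolding continuous_iff
proof (intro ballI allI impI)
  fix a \<epsilon> assume a: "a \<in> carrier E" and e: "\<epsilon> > (0::real)"
  have "hnorm G (f (a \<ominus>\<^bsub>E\<^esub> x)) < \<epsilon>"
    if x: "x \<in> carrier E" "hnorm E (a \<ominus>\<^bsub>E\<^esub> x) < \<epsilon> / (\<bar>C\<bar> + 1)" for x
  proof -
    have ax: "a \<ominus>\<^bsub>E\<^esub> x \<in> carrier E" by (rule E.minus_closed[OF a x(1)])
    have "hnorm G (f (a \<ominus>\<^bsub>E\<^esub> x)) \<le> C * hnorm E (a \<ominus>\<^bsub>E\<^esub> x)" by (rule assms[OF ax])
    also have "\<dots> \<le> (\<bar>C\<bar> + 1) * hnorm E (a \<ominus>\<^bsub>E\<^esub> x)"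
      using ax by (intro mult_right_mono) auto
    also have "\<dots> < \<epsilon>" using x(2) by (simp add: field_simps)
    finally show ?thesis .
  qed
  then show "\<exists>\<delta>>0. \<forall>x. x \<in> carrier E \<and> hnorm E (a \<ominus>\<^bsub>E\<^esub> x) < \<delta> \<longrightarrow> hnorm G (f (a \<ominus>\<^bsub>E\<^esub> x)) < \<epsilon>"
    using e by (intro exI[of _ "\<epsilon> / (\<bar>C\<bar> + 1)"]) auto
qed

lemma bounded_if_small:
  assumes d: "\<delta> > 0" and small: "\<And>z. z \<in> carrier E \<Longrightarrow> hnorm E z \<le> \<delta> \<Longrightarrow> hnorm G (f z) \<le> C"
    and z: "z \<in> carrier E"
  shows "hnorm G (f z) \<le> C / \<delta> * hnorm E z"
proof (cases "z = \<zero>\<^bsub>E\<^esub>")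
  case True then show ?thesis by simp
next
  case False
  define r where "r = \<delta> / hnorm E z"
  have n: "hnorm E z > 0" using z False by (metis E.hnorm_eq_0 E.hnorm_nonneg less_eq_real_def)
  then have r: "r > 0" using d by (simp add: r_def)
  have c: "complex_of_real r \<odot>\<^bsub>E\<^esub> z \<in> carrier E" using z by (intro E.smult_closed) auto
  have "hnorm E (complex_of_real r \<odot>\<^bsub>E\<^esub> z) = \<delta>"
    using z n d by (subst E.hnorm_smult) (auto simp: r_def norm_mult norm_divide)
  then have "hnorm G (f (complex_of_real r \<odot>\<^bsub>E\<^esub> z)) \<le> C"
    using small c by simp
  also have "hnorm G (f (complex_of_real r \<odot>\<^bsub>E\<^esub> z)) = r * hnorm G (f z)"
    using z r by (subst smult) (auto simp: G.hnorm_smult)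
  finally show ?thesis using n d by (simp add: r_def field_simps)
qed

lemma bounded_if_continuous:
  assumes "continuous_map (htop E) (htop G) f"
  obtains C where "0 \<le> C" "\<forall>z\<in>carrier E. hnorm G (f z) \<le> C * hnorm E z"
proof -
  obtain \<delta> where d: "\<delta> > 0"
    "\<And>x. x \<in> carrier E \<Longrightarrow> hnorm E (\<zero>\<^bsub>E\<^esub> \<ominus>\<^bsub>E\<^esub> x) < \<delta> \<Longrightarrow> hnorm G (f (\<zero>\<^bsub>E\<^esub> \<ominus>\<^bsub>E\<^esub> x)) < 1"
    using assms unfolding continuous_iff by (meson E.zero_closed zero_less_one)
  have "hnorm G (f z) \<le> 1 / (\<delta> / 2) * hnorm E z" if "z \<in> carrier E" for z
  proof (rule bounded_if_small[OF _ _ that])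
    show "\<delta> / 2 > 0" using d by simp
    fix x assume x: "x \<in> carrier E" "hnorm E x \<le> \<delta> / 2"
    have "hnorm E (\<zero>\<^bsub>E\<^esub> \<ominus>\<^bsub>E\<^esub> x) = hnorm E x"
      using x E.hnorm_minus_commute[of "\<zero>\<^bsub>E\<^esub>" x] by simp
    moreover have "hnorm G (f (\<zero>\<^bsub>E\<^esub> \<ominus>\<^bsub>E\<^esub> x)) = hnorm G (f x)"
      using x G.hnorm_minus_commute[of "\<zero>\<^bsub>G\<^esub>" "f x"] by (simp add: minus)
    ultimately show "hnorm G (f x) \<le> 1" using d(2)[of x] x d(1) by force
  qed
  then show ?thesis using that[of "1 / (\<delta> / 2)"] d(1) by simp
qed

end

text \<open>
  Used twice: a linearization is determined by its values on elementary tensors, and a bounded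
  multilinear operator is determined, one coordinate at a time, by its values on bases.
\<close>

lemma linear_map_eq_on_dense:
  assumes f: "linear_operator K E G f" "continuous_map (htop E) (htop G) f"
    and g: "linear_operator K E G g" "continuous_map (htop E) (htop G) g"
    and S: "S \<subseteq> carrier E" "htop E closure_of hspan K E S = carrier E"
    and eq: "\<And>x. x \<in> S \<Longrightarrow> f x = g x" and z: "z \<in> carrier E"
  shows "f z = g z"
proof -
  interpret f: linear_operator K E G f by (rule f)
  interpret g: linear_operator K E G g by (rule g)
  obtain C where C: "0 \<le> C" "\<forall>z\<in>carrier E. hnorm G (f z) \<le> C * hnorm E z"
    by (rule linear_operator.bounded_if_continuous[OF f])
  obtain D where D: "0 \<le> D" "\<forall>z\<in>carrier E. hnorm G (g z) \<le> D * hnorm E z"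
    by (rule linear_operator.bounded_if_continuous[OF g])
  have span: "f x = g x" if xS: "x \<in> hspan K E S" for x
  proof -
    obtain F a where F: "finite F" "F \<subseteq> S" "a \<in> F \<rightarrow> K" and x: "x = (\<Oplus>\<^bsub>E\<^esub>b\<in>F. a b \<odot>\<^bsub>E\<^esub> b)"
      by (rule f.E.hspanE[OF xS])
    have Fc: "(\<lambda>b. b) \<in> F \<rightarrow> carrier E" using F S by auto
    show ?thesis unfolding x f.finsum[OF F(1,3) Fc] g.finsum[OF F(1,3) Fc]
    proof (intro f.G.finsum_cong Pi_I f.G.smult_closed)
      fix b assume b: "b \<in> F"
      show "a b \<odot>\<^bsub>G\<^esub> f b = a b \<odot>\<^bsub>G\<^esub> g b" using b F eq by auto
      show "a b \<in> K" using b F by auto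
      show "g b \<in> carrier G" by (rule g.closed) (use b F S in blast)
    qed
  qed
  have "hdist G (f z) (g z) \<le> \<epsilon>" if e: "\<epsilon> > 0" for \<epsilon>
  proof -
    have "z \<in> htop E closure_of hspan K E S" using S z by simp
    moreover have "\<epsilon> / (C + D + 1) > 0" using e C(1) D(1) by simp
    ultimately obtain y where y: "y \<in> hspan K E S" "y \<in> carrier E" "hnorm E (z \<ominus>\<^bsub>E\<^esub> y) < \<epsilon> / (C + D + 1)"
      unfolding f.E.in_closure_iff by blast
    have zy: "z \<ominus>\<^bsub>E\<^esub> y \<in> carrier E" by (rule f.E.minus_closed[OF z y(2)])
    have "hdist G (f z) (g z) \<le> hdist G (f z) (f y) + hdist G (g y) (g z)"
      using f.G.metric.triangle[of "f z" "f y" "g z"] span[OF y(1)] y z by auto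
    also have "\<dots> = hnorm G (f (z \<ominus>\<^bsub>E\<^esub> y)) + hnorm G (g (z \<ominus>\<^bsub>E\<^esub> y))"
      using y z f.G.metric.commute[of "g y" "g z"] by (simp add: f.minus g.minus f.G.hdist_eq)
    also have "\<dots> \<le> C * hnorm E (z \<ominus>\<^bsub>E\<^esub> y) + D * hnorm E (z \<ominus>\<^bsub>E\<^esub> y)"
      by (intro add_mono C(2)[rule_format] D(2)[rule_format] zy)
    also have "\<dots> \<le> (C + D + 1) * hnorm E (z \<ominus>\<^bsub>E\<^esub> y)"
      using zy by (simp add: algebra_simps)
    also have "\<dots> \<le> \<epsilon>"
      using y(3) C(1) D(1) by (simp add: field_simps add_nonneg_pos)
    finally show ?thesis .
  qed
  then have "hdist G (f z) (g z) \<le> 0" by (rule field_le_epsilon) simp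
  then have "hdist G (f z) (g z) = 0"
    using f.G.metric.nonneg[of "f z" "g z"] by linarith
  then show ?thesis using z by simp
qed

text \<open>
  Continuity makes the supremum that defines the operator norm one of a bounded set; without it,
  an inequality for the supremum would carry no information.
\<close>

lemma op_norm_le_1_iff:
  assumes f: "linear_operator K E G f" "continuous_map (htop E) (htop G) f"
  shows "op_norm E G f \<le> 1 \<longleftrightarrow> (\<forall>z\<in>carrier E. hnorm G (f z) \<le> hnorm E z)"
proof -
  interpret f: linear_operator K E G f by (rule f)
  obtain C where C: "0 \<le> C" "\<forall>z\<in>carrier E. hnorm G (f z) \<le> C * hnorm E z"
    by (rule linear_operator.bounded_if_continuous[OF f])
  have "hnorm G (f z) \<le> C" if "z \<in> carrier E" "hnorm E z \<le> 1" for z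
    using C(2)[rule_format, OF that(1)] mult_left_mono[OF that(2) C(1)] by simp
  then have bdd: "bdd_above ((\<lambda>z. hnorm G (f z)) ` {z \<in> carrier E. hnorm E z \<le> 1})"
    by (intro bdd_aboveI2) auto
  have ne: "{z \<in> carrier E. hnorm E z \<le> 1} \<noteq> {}"
    using f.E.zero_closed f.E.hnorm_zero by fastforce
  have "op_norm E G f \<le> 1 \<longleftrightarrow> (\<forall>z\<in>{z \<in> carrier E. hnorm E z \<le> 1}. hnorm G (f z) \<le> 1)"
    unfolding op_norm_def by (rule cSUP_le_iff[OF ne bdd])
  also have "\<dots> \<longleftrightarrow> (\<forall>z\<in>carrier E. hnorm G (f z) \<le> hnorm E z)"
  proof (intro iffI ballI)
    fix z assume *: "\<forall>z\<in>{z \<in> carrier E. hnorm E z \<le> 1}. hnorm G (f z) \<le> 1" and z: "z \<in> carrier E"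
    show "hnorm G (f z) \<le> hnorm E z"
      using f.bounded_if_small[of 1 1, OF _ _ z] * by simp
  next
    fix z assume *: "\<forall>z\<in>carrier E. hnorm G (f z) \<le> hnorm E z"
      and z: "z \<in> {z \<in> carrier E. hnorm E z \<le> 1}"
    then show "hnorm G (f z) \<le> 1" by fastforce
  qed
  finally show ?thesis .
qed

section \<open>Averages over signs\<close>

definition sign_avg :: "'b set \<Rightarrow> (('b \<Rightarrow> real) \<Rightarrow> real) \<Rightarrow> real" where
  "sign_avg F g = (\<Sum>\<epsilon>\<in>PiE F (\<lambda>_. {-1, 1}). g \<epsilon>) / 2 ^ card F"

lemma sign_avg_empty [simp]: "sign_avg {} g = g (\<lambda>_. undefined)"
  by (simp add: sign_avg_def)

lemma sign_avg_insert:
  assumes "finite F" "b \<notin> F"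
  shows "sign_avg (insert b F) g = sign_avg F (\<lambda>\<epsilon>. (g (\<epsilon>(b := 1)) + g (\<epsilon>(b := -1))) / 2)"
proof -
  let ?P = "PiE F (\<lambda>_. {-1, 1 :: real})"
  have "(\<Sum>\<epsilon>\<in>PiE (insert b F) (\<lambda>_. {-1, 1}). g \<epsilon>) = (\<Sum>(y, \<epsilon>)\<in>{-1, 1} \<times> ?P. g (\<epsilon>(b := y)))"
    unfolding PiE_insert_eq
    by (subst sum.reindex[OF inj_combinator[OF assms(2)]]) (simp add: case_prod_beta' comp_def)
  also have "\<dots> = (\<Sum>\<epsilon>\<in>?P. g (\<epsilon>(b := 1)) + g (\<epsilon>(b := -1)))"
    by (simp add: sum.cartesian_product[symmetric] sum.distrib)
  finally show ?thesis
    using assms by (simp add: sign_avg_def sum_divide_distrib[symmetric])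
qed

lemma sign_avg_mono: "(\<And>\<epsilon>. \<epsilon> \<in> PiE F (\<lambda>_. {-1, 1}) \<Longrightarrow> g \<epsilon> \<le> h \<epsilon>) \<Longrightarrow> sign_avg F g \<le> sign_avg F h"
  unfolding sign_avg_def by (intro divide_right_mono sum_mono) auto

lemma sign_avg_cmult: "sign_avg F (\<lambda>\<epsilon>. c * g \<epsilon>) = c * sign_avg F g"
  by (simp add: sign_avg_def sum_distrib_left)

lemma sign_avg_add: "sign_avg F (\<lambda>\<epsilon>. g \<epsilon> + h \<epsilon>) = sign_avg F g + sign_avg F h"
  by (simp add: sign_avg_def sum.distrib add_divide_distrib)

lemma sign_avg_diff: "sign_avg F (\<lambda>\<epsilon>. g \<epsilon> - h \<epsilon>) = sign_avg F g - sign_avg F h"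
  by (simp add: sign_avg_def sum_subtractf diff_divide_distrib)

lemma sign_avg_sum: "sign_avg F (\<lambda>\<epsilon>. \<Sum>i\<in>I. g i \<epsilon>) = (\<Sum>i\<in>I. sign_avg F (g i))"
  unfolding sign_avg_def by (subst sum.swap) (simp add: sum_divide_distrib)

lemma sign_avg_const: "finite F \<Longrightarrow> sign_avg F (\<lambda>_. c) = c"
  by (induction F rule: finite_induct) (simp_all add: sign_avg_insert)

lemma sign_avg_nonneg: "(\<And>\<epsilon>. 0 \<le> g \<epsilon>) \<Longrightarrow> 0 \<le> sign_avg F g"
  unfolding sign_avg_def by (intro divide_nonneg_nonneg sum_nonneg) auto

text \<open>
  Vectors are functions of \<open>j\<close>, so that the sum over \<open>b\<close> is a random signed sum of vectors
  \<open>x b\<close>. The sum of its squared moduli over a finite set \<open>J\<close> is the squared norm in \<open>\<ell>\<^sub>2(J)\<close>.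
\<close>

definition rad_sum :: "'b set \<Rightarrow> ('b \<Rightarrow> 'j \<Rightarrow> complex) \<Rightarrow> ('b \<Rightarrow> real) \<Rightarrow> 'j \<Rightarrow> complex" where
  "rad_sum F x \<epsilon> j = (\<Sum>b\<in>F. complex_of_real (\<epsilon> b) * x b j)"

abbreviation rad_sq :: "'j set \<Rightarrow> 'b set \<Rightarrow> ('b \<Rightarrow> 'j \<Rightarrow> complex) \<Rightarrow> ('b \<Rightarrow> real) \<Rightarrow> real" where
  "rad_sq J F x \<epsilon> \<equiv> \<Sum>j\<in>J. (cmod (rad_sum F x \<epsilon> j))\<^sup>2"

lemma rad_sum_insert:
  assumes "finite F" "b \<notin> F"
  shows "rad_sum (insert b F) x (\<epsilon>(b := c)) j = rad_sum F x \<epsilon> j + complex_of_real c * x b j"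
proof -
  have "(\<Sum>i\<in>F. complex_of_real ((\<epsilon>(b := c)) i) * x i j) = (\<Sum>i\<in>F. complex_of_real (\<epsilon> i) * x i j)"
    using assms by (intro sum.cong) auto
  then show ?thesis using assms by (simp add: rad_sum_def)
qed

lemma cmod_add_sq: "(cmod (z + w))\<^sup>2 = (cmod z)\<^sup>2 + (cmod w)\<^sup>2 + 2 * Re (z * cnj w)"
  unfolding cmod_power2 by (simp add: power2_eq_square algebra_simps)

text \<open>
  The parallelogram law, applied to one sign at a time.
\<close>

lemma rad_sum_second_moment:
  assumes "finite F"
  shows "sign_avg F (\<lambda>\<epsilon>. \<Sum>j\<in>J. (cmod (rad_sum F x \<epsilon> j))\<^sup>2) = (\<Sum>b\<in>F. \<Sum>j\<in>J. (cmod (x b j))\<^sup>2)"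
  using assms
proof (induction F rule: finite_induct)
  case empty
  then show ?case by (simp add: rad_sum_def)
next
  case (insert b F)
  have step: "(rad_sq J (insert b F) x (\<epsilon>(b := 1))
      + rad_sq J (insert b F) x (\<epsilon>(b := -1))) / 2
    = rad_sq J F x \<epsilon> + (\<Sum>j\<in>J. (cmod (x b j))\<^sup>2)" for \<epsilon>
    using insert cmod_add_sq[of "rad_sum F x \<epsilon> _" "- x b _"]
    by (simp add: rad_sum_insert cmod_add_sq sum.distrib[symmetric] sum_divide_distrib sum_subtractf
        add_divide_distrib)
  show ?case
    unfolding sign_avg_insert[OF insert.hyps] step
    using insert by (simp add: sign_avg_add sign_avg_const)
qed

section \<open>Khintchine's inequality for vectors\<close>

lemma cosh_sqrt_sums:
  assumes "0 \<le> y" shows "(\<lambda>k. y ^ k / fact (2 * k)) sums cosh (sqrt y)"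
proof -
  define f where "f n = (if even n then sqrt y ^ n /\<^sub>R fact n else 0)" for n
  have "f sums cosh (sqrt y)"
    unfolding f_def by (rule cosh_converges)
  moreover have "f n = 0" if "n \<notin> range ((*) 2)" for n
    using that by (auto simp: f_def elim!: evenE)
  ultimately have "(\<lambda>k. f (2 * k)) sums cosh (sqrt y)"
    by (subst sums_mono_reindex) (auto simp: strict_mono_def)
  then show ?thesis
    using assms by (simp add: f_def power_mult divide_inverse) (simp add: mult.commute)
qed

lemma convex_on_power_nonneg: "convex_on {0::real..} (\<lambda>x. x ^ k)"
proof (cases "even k")
  case True
  then show ?thesis using convex_power_even convex_on_subset by blast
next
  case False
  then show ?thesis by (rule convex_power_odd)
qed

text \<open>
  The power series of \<open>cosh (sqrt y)\<close> in \<open>y\<close> has nonnegative coefficients, and powers are convex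
  on the positive axis.
\<close>

lemma convex_on_cosh_sqrt: "convex_on {0..} (\<lambda>y. cosh (sqrt y))"
proof (rule convex_onI)
  fix t x y :: real
  assume t: "0 < t" "t < 1" and x: "x \<in> {0..}" and y: "y \<in> {0..}"
  let ?z = "(1 - t) *\<^sub>R x + t *\<^sub>R y"
  have "?z \<ge> 0" using t x y by simp
  moreover have "?z ^ k \<le> (1 - t) * x ^ k + t * y ^ k" for k
    using convex_onD[OF convex_on_power_nonneg[of k], of t x y] t x y by simp
  ultimately show "cosh (sqrt ?z) \<le> (1 - t) * cosh (sqrt x) + t * cosh (sqrt y)"
    using t x y
    by (intro sums_le[OF _ cosh_sqrt_sums sums_add[OF sums_mult[OF cosh_sqrt_sums] sums_mult[OF cosh_sqrt_sums]]])
       (auto simp: divide_right_mono add_divide_distrib[symmetric])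
qed simp

text \<open>
  The inductive step of the exponential moment bound. If \<open>a\<close> and \<open>b\<close> are the norms of two vectors,
  then \<open>a\<^sup>2 + b\<^sup>2 \<plusminus> t\<close> are the squared norms of their sum and their difference. By convexity the
  average is largest for \<open>\<bar>t\<bar> = 2 a b\<close>, that is, for parallel vectors, where the addition formulas
  of \<open>cosh\<close> give equality.
\<close>

lemma cosh_two_point:
  assumes a: "0 \<le> a" and b: "0 \<le> b" and t: "\<bar>t\<bar> \<le> 2 * a * b"
  shows "(cosh (sqrt (a\<^sup>2 + b\<^sup>2 + t)) + cosh (sqrt (a\<^sup>2 + b\<^sup>2 - t))) / 2 \<le> cosh a * cosh (b::real)"
proof (cases "a * b = 0")
  case True
  then have "t = 0" using t by auto
  then show ?thesis using True a b by auto
next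
  case False
  then have ab: "a * b > 0" using a b by (simp add: less_le)
  \<comment> \<open>The two squared norms are convex combinations of \<open>(a - b)\<^sup>2\<close> and \<open>(a + b)\<^sup>2\<close> with weights \<open>l\<close> and \<open>1 - l\<close>.\<close>
  define l where "l = (1 + t / (2 * a * b)) / 2"
  have "\<bar>t / (2 * a * b)\<bar> \<le> 1" 
    using t ab a b pos_divide_le_eq[of "2 * a * b" "\<bar>t\<bar>" 1] by (simp add: abs_mult mult.assoc)
  then have l: "0 \<le> l" "l \<le> 1" unfolding l_def abs_le_iff by auto
  have conv: "cosh (sqrt ((1 - m) * (a - b)\<^sup>2 + m * (a + b)\<^sup>2)) \<le> (1 - m) * cosh (a - b) + m * cosh (a + b)"
    if "0 \<le> m" "m \<le> 1" for m
    using convex_onD[OF convex_on_cosh_sqrt, of m "(a - b)\<^sup>2" "(a + b)\<^sup>2"] that a b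
    by (simp add: cosh_real_abs)
  have tl: "t = 2 * a * b * (2 * l - 1)" 
    unfolding l_def using ab by (cases "a = 0"; cases "b = 0") (simp_all add: field_simps)
  have e1: "a\<^sup>2 + b\<^sup>2 + t = (1 - l) * (a - b)\<^sup>2 + l * (a + b)\<^sup>2"
    and e2: "a\<^sup>2 + b\<^sup>2 - t = (1 - (1 - l)) * (a - b)\<^sup>2 + (1 - l) * (a + b)\<^sup>2"
    unfolding tl by (simp_all add: power2_eq_square algebra_simps)
  have "cosh (sqrt (a\<^sup>2 + b\<^sup>2 + t)) + cosh (sqrt (a\<^sup>2 + b\<^sup>2 - t)) \<le> cosh (a - b) + cosh (a + b)"
    unfolding e1 e2 using conv[OF l] conv[of "1 - l"] l by (simp add: algebra_simps)
  also have "\<dots> = 2 * (cosh a * cosh b)" by (simp add: cosh_add cosh_diff)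
  finally show ?thesis by simp
qed

text \<open>
  Comparison of the power series, since \<open>2\<^sup>k k!\<close> is at most \<open>(2 k)!\<close>.
\<close>

lemma cosh_le_exp_half_square: "cosh b \<le> exp (b\<^sup>2 / 2)" for b :: real
proof -
  have fact_le: "2 ^ k * fact k \<le> (fact (2 * k) :: real)" for k :: nat
  proof (induction k)
    case (Suc k)
    have "2 ^ Suc k * fact (Suc k) = 2 * real (Suc k) * (2 ^ k * fact k)" by simp
    also have "\<dots> \<le> (real (2 * k + 2) * real (2 * k + 1)) * fact (2 * k)"
      by (intro mult_mono Suc) auto
    also have "\<dots> = fact (2 * Suc k)" by (simp add: algebra_simps)
    finally show ?case .
  qed simp
  have c: "(\<lambda>k. (b\<^sup>2) ^ k / fact (2 * k)) sums cosh (sqrt (b\<^sup>2))" by (rule cosh_sqrt_sums) simp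
  have e: "(\<lambda>k. (b\<^sup>2 / 2) ^ k /\<^sub>R fact k) sums exp (b\<^sup>2 / 2)" by (rule exp_converges)
  have le: "(b\<^sup>2) ^ k / fact (2 * k) \<le> (b\<^sup>2 / 2) ^ k /\<^sub>R fact k" for k
  proof -
    have "(b\<^sup>2) ^ k / fact (2 * k) \<le> (b\<^sup>2) ^ k / (2 ^ k * fact k)"
      using fact_le[of k] by (intro divide_left_mono) auto
    then show ?thesis by (simp add: power_divide field_simps)
  qed
  have "cosh (sqrt (b\<^sup>2)) \<le> exp (b\<^sup>2 / 2)" by (rule sums_le[OF le c e])
  then show ?thesis by (simp add: cosh_real_abs)
qed

text \<open>
  Signed sums of vectors in a Hilbert space are subgaussian, with the same bound in every
  dimension. Working with \<open>cosh\<close> of the norm treats all moments at once.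
\<close>

lemma cosh_rad_sum:
  assumes "finite F"
  shows "sign_avg F (\<lambda>\<epsilon>. cosh (sqrt (rad_sq J F x \<epsilon>)))
    \<le> exp ((\<Sum>b\<in>F. \<Sum>j\<in>J. (cmod (x b j))\<^sup>2) / 2)"
  using assms
proof (induction F rule: finite_induct)
  case empty
  then show ?case by (simp add: rad_sum_def)
next
  case (insert b F)
  define \<beta> where "\<beta> = sqrt (\<Sum>j\<in>J. (cmod (x b j))\<^sup>2)"
  have \<beta>: "0 \<le> \<beta>" "\<beta>\<^sup>2 = (\<Sum>j\<in>J. (cmod (x b j))\<^sup>2)" unfolding \<beta>_def by (auto simp: sum_nonneg)
  have "(cosh (sqrt (rad_sq J (insert b F) x (\<epsilon>(b := 1))))
      + cosh (sqrt (rad_sq J (insert b F) x (\<epsilon>(b := -1))))) / 2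
    \<le> cosh \<beta> * cosh (sqrt (rad_sq J F x \<epsilon>))" for \<epsilon>
  proof -
    define s where "s j = rad_sum F x \<epsilon> j" for j
    define \<alpha> where "\<alpha> = sqrt (\<Sum>j\<in>J. (cmod (s j))\<^sup>2)"
    have \<alpha>: "0 \<le> \<alpha>" "\<alpha>\<^sup>2 = (\<Sum>j\<in>J. (cmod (s j))\<^sup>2)" unfolding \<alpha>_def by (auto simp: sum_nonneg)
    define t where "t = 2 * (\<Sum>j\<in>J. Re (s j * cnj (x b j)))"
    have "\<bar>\<Sum>j\<in>J. Re (s j * cnj (x b j))\<bar> \<le> (\<Sum>j\<in>J. cmod (s j) * cmod (x b j))"
      by (rule order_trans[OF sum_abs sum_mono]) (metis abs_Re_le_cmod norm_mult complex_mod_cnj)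
    also have "\<dots> \<le> \<alpha> * \<beta>"
      unfolding \<alpha>_def \<beta>_def real_sqrt_mult[symmetric]
      by (intro real_le_rsqrt Cauchy_Schwarz_ineq_sum)
    finally have t: "\<bar>t\<bar> \<le> 2 * \<alpha> * \<beta>" by (simp add: t_def)
    have "rad_sq J (insert b F) x (\<epsilon>(b := 1)) = \<alpha>\<^sup>2 + \<beta>\<^sup>2 + t"
      using insert unfolding \<alpha> \<beta> t_def
      by (simp add: rad_sum_insert cmod_add_sq s_def sum.distrib sum_distrib_left)
    moreover have "rad_sq J (insert b F) x (\<epsilon>(b := -1)) = \<alpha>\<^sup>2 + \<beta>\<^sup>2 - t"
    proof -
      have "(cmod (rad_sum (insert b F) x (\<epsilon>(b := -1)) j))\<^sup>2
          = (cmod (s j))\<^sup>2 + (cmod (x b j))\<^sup>2 - 2 * Re (s j * cnj (x b j))" for j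
        using insert cmod_add_sq[of "s j" "- x b j"] by (simp add: rad_sum_insert s_def)
      then show ?thesis
        unfolding \<alpha> \<beta> t_def by (simp add: sum.distrib sum_subtractf sum_distrib_left)
    qed
    ultimately show ?thesis
      using cosh_two_point[OF \<alpha>(1) \<beta>(1) t] by (simp add: \<alpha>_def s_def mult.commute)
  qed
  then have "sign_avg (insert b F) (\<lambda>\<epsilon>. cosh (sqrt (rad_sq J (insert b F) x \<epsilon>)))
      \<le> sign_avg F (\<lambda>\<epsilon>. cosh \<beta> * cosh (sqrt (rad_sq J F x \<epsilon>)))"
    unfolding sign_avg_insert[OF insert.hyps(1,2)] by (intro sign_avg_mono)
  also have "\<dots> \<le> exp (\<beta>\<^sup>2 / 2) * exp ((\<Sum>b\<in>F. \<Sum>j\<in>J. (cmod (x b j))\<^sup>2) / 2)"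
    unfolding sign_avg_cmult
    by (intro mult_mono cosh_le_exp_half_square insert.IH sign_avg_nonneg cosh_real_nonneg) simp
  also have "\<dots> = exp ((\<Sum>b\<in>insert b F. \<Sum>j\<in>J. (cmod (x b j))\<^sup>2) / 2)"
    using insert by (simp add: exp_add[symmetric] \<beta>(2) add_divide_distrib)
  finally show ?case .
qed

text \<open>
  Not the best constant: a bound for the moment of order \<open>q\<close>, raised to the power \<open>q\<close>, that depends
  on \<open>q\<close> alone.
\<close>

definition khin_upper :: "real \<Rightarrow> real" where
  "khin_upper q = (1 + fact (2 * nat \<lceil>q\<rceil>)) * exp (1 / 2)"

lemma khin_upper_pos: "khin_upper q > 0"
  unfolding khin_upper_def by (intro mult_pos_pos add_pos_pos) auto

lemma sqrt_powr: "0 \<le> y \<Longrightarrow> sqrt y powr q = y powr (q / 2)"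
  by (simp add: powr_half_sqrt[symmetric] powr_powr)

text \<open>
  With \<open>m = \<lceil>q\<rceil>\<close>, a single term \<open>y\<^sup>m / (2 m)!\<close> of the power series of \<open>cosh (sqrt y)\<close> bounds the
  power from above when \<open>y\<close> is at least \<open>1\<close>.
\<close>

lemma powr_le_fact_cosh:
  assumes "0 \<le> y" "0 < q"
  shows "y powr (q / 2) \<le> (1 + fact (2 * nat \<lceil>q\<rceil>)) * cosh (sqrt y)"
proof -
  define m where "m = nat \<lceil>q\<rceil>"
  have m: "q / 2 \<le> real m" "q \<le> real m" using assms(2) unfolding m_def by linarith+
  have "y powr (q / 2) \<le> 1 + y ^ m"
  proof (cases "y \<le> 1")
    case True
    then have "y powr (q / 2) \<le> 1" using assms by (intro powr_le1) auto
    then show ?thesis using assms(1) by (meson add_increasing2 zero_le_power)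
  next
    case False
    then have "y powr (q / 2) \<le> y powr real m" using m by (intro powr_mono) auto
    then show ?thesis using False by (simp add: powr_realpow)
  qed
  also have "1 + y ^ m \<le> 1 + fact (2 * m) * cosh (sqrt y)"
  proof -
    have "y ^ m / fact (2 * m) \<le> cosh (sqrt y)"
    using sum_le_suminf[of "\<lambda>k. y ^ k / fact (2 * k)" "{m}"] cosh_sqrt_sums[OF assms(1)] assms(1)
    by (simp add: sums_iff)
    then show ?thesis by (simp add: field_simps)
  qed
  also have "1 + fact (2 * m) * cosh (sqrt y) \<le> (1 + fact (2 * m)) * cosh (sqrt y)"
    using cosh_real_ge_1[of "sqrt y"] by (simp add: algebra_simps)
  finally show ?thesis by (simp add: m_def)
qed


text \<open>
  After scaling to total variance \<open>1\<close>, powers are dominated by \<open>cosh\<close>. The vector-valued form is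
  the one that can be iterated over the coordinates of a multilinear form.
\<close>

lemma vector_Khintchine:
  assumes F: "finite F" and q: "0 < q"
  shows "sign_avg F (\<lambda>\<epsilon>. rad_sq J F x \<epsilon> powr (q / 2))
    \<le> khin_upper q * (\<Sum>b\<in>F. \<Sum>j\<in>J. (cmod (x b j))\<^sup>2) powr (q / 2)"
proof -
  define \<sigma> where "\<sigma> = (\<Sum>b\<in>F. \<Sum>j\<in>J. (cmod (x b j))\<^sup>2)"
  have \<sigma>0: "\<sigma> \<ge> 0" unfolding \<sigma>_def by (intro sum_nonneg) auto
  show ?thesis
  proof (cases "\<sigma> = 0")
    case True
    then have x0: "(\<Sum>j\<in>J. (cmod (x b j))\<^sup>2) = 0" if "b \<in> F" for b
      using that F unfolding \<sigma>_def by (subst (asm) sum_nonneg_eq_0_iff) (auto intro: sum_nonneg)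
    have "rad_sq J F x \<epsilon> = 0" for \<epsilon>
    proof (cases "finite J")
      case True
      then have "x b j = 0" if "b \<in> F" "j \<in> J" for b j
        using x0[OF that(1)] that(2) by (simp add: sum_nonneg_eq_0_iff)
      then show ?thesis by (simp add: rad_sum_def)
    qed simp
    then show ?thesis using F True by (simp add: sign_avg_const \<sigma>_def)
  next
    case False
    then have \<sigma>: "\<sigma> > 0" using \<sigma>0 by simp
    define y where "y b j = x b j / complex_of_real (sqrt \<sigma>)" for b j
    have ynorm: "(\<Sum>b\<in>F. \<Sum>j\<in>J. (cmod (y b j))\<^sup>2) = 1"
      using \<sigma> by (simp add: y_def norm_divide power_divide sum_divide_distrib[symmetric] flip: \<sigma>_def)
    have N: "rad_sq J F x \<epsilon> = \<sigma> * rad_sq J F y \<epsilon>" for \<epsilon>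
    proof -
      have "rad_sum F x \<epsilon> j = complex_of_real (sqrt \<sigma>) * rad_sum F y \<epsilon> j" for j
        using \<sigma> by (simp add: rad_sum_def y_def sum_distrib_left)
      then show ?thesis using \<sigma> by (simp add: norm_mult power_mult_distrib sum_distrib_left)
    qed
    have "sign_avg F (\<lambda>\<epsilon>. rad_sq J F x \<epsilon> powr (q / 2))
        = \<sigma> powr (q / 2) * sign_avg F (\<lambda>\<epsilon>. rad_sq J F y \<epsilon> powr (q / 2))"
      unfolding N sign_avg_cmult[symmetric] using \<sigma> by (simp add: powr_mult sum_nonneg)
    also have "\<dots> \<le> \<sigma> powr (q / 2) * sign_avg F (\<lambda>\<epsilon>. (1 + fact (2 * nat \<lceil>q\<rceil>)) *
        cosh (sqrt (rad_sq J F y \<epsilon>)))"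
      by (intro mult_left_mono sign_avg_mono powr_le_fact_cosh q sum_nonneg) auto
    also have "\<dots> \<le> \<sigma> powr (q / 2) * ((1 + fact (2 * nat \<lceil>q\<rceil>)) * exp (1 / 2))"
      unfolding sign_avg_cmult using cosh_rad_sum[OF F, where J = J and x = y] unfolding ynorm
      by (intro mult_left_mono) auto
    finally show ?thesis by (simp add: khin_upper_def \<sigma>_def mult.commute)
  qed
qed

lemma Khintchine_upper:
  assumes F: "finite F" and q: "0 < q"
  shows "sign_avg F (\<lambda>\<epsilon>. cmod (\<Sum>b\<in>F. complex_of_real (\<epsilon> b) * a b) powr q)
    \<le> khin_upper q * (\<Sum>b\<in>F. (cmod (a b))\<^sup>2) powr (q / 2)"
  using vector_Khintchine[OF assms, where J = "{()}" and x = "\<lambda>b _. a b"]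
  by (simp add: rad_sum_def sqrt_powr[symmetric])

lemma Khintchine_second_moment:
  assumes F: "finite F"
  shows "sign_avg F (\<lambda>\<epsilon>. (cmod (\<Sum>b\<in>F. complex_of_real (\<epsilon> b) * a b))\<^sup>2) = (\<Sum>b\<in>F. (cmod (a b))\<^sup>2)"
  using rad_sum_second_moment[OF assms, where J = "{()}" and x = "\<lambda>b _. a b"]
  by (simp add: rad_sum_def)

definition khin_lower :: real where "khin_lower = sqrt (2 * khin_upper 4) / (4 * khin_upper 4)"

lemma khin_lower_pos: "khin_lower > 0"
  unfolding khin_lower_def using khin_upper_pos[of 4] by simp

text \<open>
  The first moment cannot be small, because the fourth moment is at most a multiple of the square
  of the second: average the pointwise inequality \<open>u\<^sup>2 - u\<^sup>4 \<le> u\<close> for \<open>u = X / s\<close>, with \<open>s\<close> so large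
  that the fourth moment consumes only half of the second.
\<close>

lemma Khintchine_lower:
  assumes F: "finite F"
  shows "khin_lower * sqrt (\<Sum>b\<in>F. (cmod (a b))\<^sup>2)
    \<le> sign_avg F (\<lambda>\<epsilon>. cmod (\<Sum>b\<in>F. complex_of_real (\<epsilon> b) * a b))"
proof -
  define \<sigma> where "\<sigma> = (\<Sum>b\<in>F. (cmod (a b))\<^sup>2)"
  define X where "X \<epsilon> = cmod (\<Sum>b\<in>F. complex_of_real (\<epsilon> b) * a b)" for \<epsilon>
  define M where "M = khin_upper 4"
  have M: "M > 0" unfolding M_def by (rule khin_upper_pos)
  have \<sigma>0: "\<sigma> \<ge> 0" unfolding \<sigma>_def by (intro sum_nonneg) auto
  have X0: "X \<epsilon> \<ge> 0" for \<epsilon> by (simp add: X_def)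
  have X2: "sign_avg F (\<lambda>\<epsilon>. (X \<epsilon>)\<^sup>2) = \<sigma>"
    unfolding X_def \<sigma>_def by (rule Khintchine_second_moment[OF F])
  have "sign_avg F (\<lambda>\<epsilon>. X \<epsilon> powr 4) \<le> M * \<sigma> powr (4 / 2)"
    unfolding X_def \<sigma>_def M_def by (rule Khintchine_upper[OF F]) simp
  moreover have "X \<epsilon> powr 4 = (X \<epsilon>) ^ 4" for \<epsilon> using X0[of \<epsilon>] by (cases "X \<epsilon> = 0") (auto simp: powr_numeral)
  ultimately have X4: "sign_avg F (\<lambda>\<epsilon>. (X \<epsilon>) ^ 4) \<le> M * \<sigma>\<^sup>2"
    using \<sigma>0 by (cases "\<sigma> = 0") (auto simp: powr_numeral)
  show ?thesis
  proof (cases "\<sigma> = 0")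
    case True
    then show ?thesis unfolding \<sigma>_def by (simp add: sign_avg_nonneg)
  next
    case False
    then have \<sigma>: "\<sigma> > 0" using \<sigma>0 by simp
    \<comment> \<open>The choice makes \<open>\<sigma> / s\<^sup>2\<close> twice as large as \<open>M \<sigma>\<^sup>2 / s\<^sup>4\<close>.\<close>
    define s where "s = sqrt (2 * M * \<sigma>)"
    have s: "s > 0" "s\<^sup>2 = 2 * M * \<sigma>" unfolding s_def using M \<sigma> by auto
    have s4: "s ^ 4 = (2 * M * \<sigma>)\<^sup>2" using s(2) by (metis numeral_Bit0 power2_eq_square power_add)
    have pt: "(1 / s) * (X \<epsilon>)\<^sup>2 - (1 / s ^ 3) * (X \<epsilon>) ^ 4 \<le> X \<epsilon>" for \<epsilon>
    proof -
      define u where "u = X \<epsilon> / s"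
      have u: "u \<ge> 0" unfolding u_def using X0 s by simp
      have "u\<^sup>2 - u ^ 4 \<le> u"
      proof (cases "u \<le> 1")
        case True
        then have "u\<^sup>2 \<le> u" using u by (simp add: power2_eq_square mult_left_le)
        moreover have "0 \<le> u ^ 4" by simp
        ultimately show ?thesis by linarith
      next
        case False
        then have "u\<^sup>2 \<le> u ^ 4" by (intro power_increasing) auto
        then show ?thesis using u by linarith
      qed
      then have "s * (u\<^sup>2 - u ^ 4) \<le> s * u" using s by simp
      moreover have "s * u = X \<epsilon>" "s * u\<^sup>2 = (1 / s) * (X \<epsilon>)\<^sup>2" "s * u ^ 4 = (1 / s ^ 3) * (X \<epsilon>) ^ 4"
        unfolding u_def using s(1) by (auto simp: power_divide field_simps eval_nat_numeral)
      ultimately show ?thesis by (simp add: right_diff_distrib)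
    qed
    have "khin_lower * sqrt \<sigma> = s / (4 * M)"
      unfolding khin_lower_def s_def M_def[symmetric] by (simp add: real_sqrt_mult)
    also have "\<dots> = (1 / s) * \<sigma> - (1 / s ^ 3) * (M * \<sigma>\<^sup>2)"
    proof -
      have "(1 / s) * \<sigma> = s * \<sigma> / s\<^sup>2" using s(1) by (simp add: power2_eq_square)
      moreover have "(1 / s ^ 3) * (M * \<sigma>\<^sup>2) = s * (M * \<sigma>\<^sup>2) / s ^ 4" using s(1) by (simp add: eval_nat_numeral)
      ultimately show ?thesis unfolding s4 s(2) using M \<sigma> by (simp add: field_simps power2_eq_square)
    qed
    also have "\<dots> \<le> (1 / s) * sign_avg F (\<lambda>\<epsilon>. (X \<epsilon>)\<^sup>2) - (1 / s ^ 3) * sign_avg F (\<lambda>\<epsilon>. (X \<epsilon>) ^ 4)"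
      unfolding X2 using X4 s(1) by (intro diff_left_mono mult_left_mono) auto
    also have "\<dots> = sign_avg F (\<lambda>\<epsilon>. (1 / s) * (X \<epsilon>)\<^sup>2 - (1 / s ^ 3) * (X \<epsilon>) ^ 4)"
      by (simp only: sign_avg_diff sign_avg_cmult)
    also have "\<dots> \<le> sign_avg F X"
      by (intro sign_avg_mono pt)
    finally show ?thesis unfolding X_def[abs_def] \<sigma>_def .
  qed
qed

section \<open>Rademacher functions\<close>

lemma rademacher_Suc_shift:
  "rademacher (Suc (Suc m)) t = rademacher (Suc m) (2 * t)"
  "rademacher (Suc (Suc m)) t = rademacher (Suc m) (2 * t - 1)"
proof -
  show 1: "rademacher (Suc (Suc m)) t = rademacher (Suc m) (2 * t)"
    by (simp add: rademacher_def mult_ac)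
  have "sin (2 ^ Suc m * pi * (2 * t - 1)) = sin (2 ^ Suc m * pi * (2 * t) - (2 ^ m) * (2 * pi))"
    by (simp add: algebra_simps)
  also have "\<dots> = sin (2 ^ Suc m * pi * (2 * t))"
  proof -
    have *: "2 ^ m * (2 * pi) = real (2 * 2 ^ m) * pi" by simp
    show ?thesis unfolding * sin_diff sin_npi cos_npi by simp
  qed
  finally show "rademacher (Suc (Suc m)) t = rademacher (Suc m) (2 * t - 1)"
    unfolding 1 by (simp add: rademacher_def)
qed

lemma rademacher_1:
  "0 < t \<Longrightarrow> t < 1 / 2 \<Longrightarrow> rademacher 1 t = 1"
  "1 / 2 < t \<Longrightarrow> t < 1 \<Longrightarrow> rademacher 1 t = -1"
proof -
  assume "0 < t" "t < 1 / 2"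
  then have "sin (2 * pi * t) > 0" by (intro sin_gt_zero) auto
  then show "rademacher 1 t = 1" by (simp add: rademacher_def)
next
  assume "1 / 2 < t" "t < 1"
  then have "sin (2 * pi * t) < 0" by (intro sin_lt_zero) auto
  then show "rademacher 1 t = -1" by (simp add: rademacher_def)
qed

text \<open>
  The first \<open>N\<close> Rademacher functions on \<open>[0, 1]\<close> are distributed like \<open>N\<close> independent signs. Inside
  each half of the interval the first function is constant and the others are, after rescaling the half
  to \<open>[0, 1]\<close>, the Rademacher functions with index lowered by one. The offset \<open>k\<close> lets the first sign
  be split off without renumbering the remaining ones.
\<close>

lemma has_integral_rademacher:
  "((\<lambda>t. g (\<lambda>m\<in>{k..<k + N}. rademacher (Suc (m - k)) t)) has_integral sign_avg {k..<k + N} g) {0..1}"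
proof (induction N arbitrary: k g)
  case 0
  then show ?case
    using has_integral_const_real[of "g (\<lambda>_. undefined)" 0 1] by (simp add: restrict_def)
next
  case (Suc N)
  let ?avg = "\<lambda>c. sign_avg {Suc k..<Suc k + N} (\<lambda>\<epsilon>. g (\<epsilon>(k := c)))"
  let ?R = "\<lambda>k t. \<lambda>m\<in>{k..<k + N}. rademacher (Suc (m - k)) t"
  define G where "G t = g (\<lambda>m\<in>{k..<k + Suc N}. rademacher (Suc (m - k)) t)" for t
  define h where "h c t = g ((?R (Suc k) t)(k := c))" for c t
  have set: "{k..<k + Suc N} = insert k {Suc k..<Suc k + N}" by auto
  have int: "(h c has_integral sign_avg {Suc k..<Suc k + N} (\<lambda>\<epsilon>. g (\<epsilon>(k := c)))) (cbox 0 1)" for c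
    unfolding h_def cbox_interval by (rule Suc.IH)
  have eq: "(\<lambda>m\<in>{k..<k + Suc N}. rademacher (Suc (m - k)) t) = (?R (Suc k) s)(k := rademacher 1 t)"
    if "\<And>m. rademacher (Suc (Suc m)) t = rademacher (Suc m) s" for t s
    unfolding set
  proof (rule ext)
    fix m
    show "(\<lambda>m\<in>insert k {Suc k..<Suc k + N}. rademacher (Suc (m - k)) t) m = ((?R (Suc k) s)(k := rademacher 1 t)) m"
    proof (cases "m \<in> {Suc k..<Suc k + N}")
      case True
      then have "m - k = Suc (m - Suc k)" by auto
      then show ?thesis using True that[of "m - Suc k"] by simp
    qed auto
  qed
  have left: "(G has_integral (1 / 2) * ?avg 1) {0..1 / 2}"
  proof (rule has_integral_spike_finite[of "{0, 1 / 2}"])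
    have "((\<lambda>t. h 1 (2 *\<^sub>R t + 0)) has_integral (1 / \<bar>2\<bar> ^ DIM(real)) *\<^sub>R
        ?avg 1) ((\<lambda>x. (1 / 2) *\<^sub>R x + - ((1 / 2) *\<^sub>R 0)) ` cbox 0 1)"
      by (rule has_integral_affinity[OF int]) simp
    moreover have "(\<lambda>x. (1 / 2) *\<^sub>R x + - ((1 / 2) *\<^sub>R 0)) ` cbox 0 1 = {0..1 / 2 :: real}"
      using image_affinity_atLeastAtMost[of "1 / 2" 0 0 "1 :: real"] by simp
    ultimately show "((\<lambda>t. h 1 (2 * t)) has_integral (1 / 2) *
        ?avg 1) {0..1 / 2}" by simp
    show "G t = h 1 (2 * t)" if "t \<in> {0..1 / 2} - {0, 1 / 2}" for t
      unfolding G_def h_def eq[of t "2 * t", OF rademacher_Suc_shift(1)]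
      using that rademacher_1(1)[of t] by simp
  qed simp
  have right: "(G has_integral (1 / 2) * ?avg (-1)) {1 / 2..1}"
  proof (rule has_integral_spike_finite[of "{1 / 2, 1}"])
    have "((\<lambda>t. h (-1) (2 *\<^sub>R t + (-1))) has_integral (1 / \<bar>2\<bar> ^ DIM(real)) *\<^sub>R
        ?avg (-1)) ((\<lambda>x. (1 / 2) *\<^sub>R x + - ((1 / 2) *\<^sub>R (-1))) ` cbox 0 1)"
      by (rule has_integral_affinity[OF int]) simp
    moreover have "(\<lambda>x. (1 / 2) *\<^sub>R x + - ((1 / 2) *\<^sub>R (-1))) ` cbox 0 1 = {1 / 2..1 :: real}"
      using image_affinity_atLeastAtMost[of "1 / 2" "1 / 2" 0 "1 :: real"] by simp
    ultimately show "((\<lambda>t. h (-1) (2 * t - 1)) has_integral (1 / 2) *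
        ?avg (-1)) {1 / 2..1}" by simp
    show "G t = h (-1) (2 * t - 1)" if "t \<in> {1 / 2..1} - {1 / 2, 1}" for t
      unfolding G_def h_def eq[of t "2 * t - 1", OF rademacher_Suc_shift(2)]
      using that rademacher_1(2)[of t] by simp
  qed simp
  have "(G has_integral (1 / 2) * ?avg 1
      + (1 / 2) * ?avg (-1)) {0..1}"
    by (rule has_integral_combine[OF _ _ left right]) auto
  moreover have "(1 / 2) * ?avg 1
      + (1 / 2) * ?avg (-1) = sign_avg {k..<k + Suc N} g"
    unfolding set by (subst sign_avg_insert)
      (auto simp: sign_avg_add[symmetric] sign_avg_cmult[symmetric] add_divide_distrib)
  ultimately have "(G has_integral sign_avg {k..<k + Suc N} g) {0..1}" by (simp only:)
  then show ?case unfolding G_def .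
qed

lemma integral_rademacher_sum:
  "integral {0..1} (\<lambda>t. cmod (\<Sum>m<N. a m * complex_of_real (rademacher (Suc m) t)) powr p)
    = sign_avg {..<N} (\<lambda>\<epsilon>. cmod (\<Sum>m<N. complex_of_real (\<epsilon> m) * a m) powr p)"
  using integral_unique[OF has_integral_rademacher[of
      "\<lambda>\<epsilon>. cmod (\<Sum>m<N. complex_of_real (\<epsilon> m) * a m) powr p" 0 N]]
  by (simp add: atLeast0LessThan mult.commute)

text \<open>
  A single coefficient \<open>1\<close> forces every admissible constant to be at least \<open>1\<close>. Khintchine's
  inequality is needed as well: it says that admissible constants exist, and so that the infimum
  is meaningful.
\<close>

lemma khintchine_const_ge_1:
  assumes K: "1 \<in> K" and p: "1 \<le> p"
  shows "1 \<le> khintchine_const K p"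
  unfolding khintchine_const_def integral_rademacher_sum
proof (rule cInf_greatest)
  let ?B = "khin_upper p powr (1 / p)"
  let ?C = "{B. \<forall>(N::nat) a. a \<in> {..<N} \<rightarrow> K \<longrightarrow>
      sign_avg {..<N} (\<lambda>\<epsilon>. cmod (\<Sum>m<N. complex_of_real (\<epsilon> m) * a m) powr p) powr (1 / p)
      \<le> B * sqrt (\<Sum>m<N. (cmod (a m))\<^sup>2)}"
  have bound: "sign_avg {..<N} (\<lambda>\<epsilon>. cmod (\<Sum>m<N. complex_of_real (\<epsilon> m) * a m) powr p) powr (1 / p)
      \<le> ?B * sqrt (\<Sum>m<N. (cmod (a m))\<^sup>2)" for N and a :: "nat \<Rightarrow> complex"
  proof -
    have "sign_avg {..<N} (\<lambda>\<epsilon>. cmod (\<Sum>m<N. complex_of_real (\<epsilon> m) * a m) powr p) powr (1 / p)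
        \<le> (khin_upper p * (\<Sum>m<N. (cmod (a m))\<^sup>2) powr (p / 2)) powr (1 / p)"
      using Khintchine_upper[of "{..<N}" p a] p
      by (intro powr_mono2 sign_avg_nonneg) auto
    also have "\<dots> = ?B * sqrt (\<Sum>m<N. (cmod (a m))\<^sup>2)"
      using p khin_upper_pos[of p] by (simp add: powr_mult powr_powr powr_half_sqrt sum_nonneg)
    finally show ?thesis .
  qed
  show "?C \<noteq> {}"
    by (intro ex_in_conv[THEN iffD1] exI[of _ ?B] CollectI allI impI bound)
  fix B assume "B \<in> ?C"
  from this[unfolded mem_Collect_eq, THEN spec[of _ "1 :: nat"], THEN spec[of _ "\<lambda>_. 1"]]
  have "sign_avg {..<1::nat} (\<lambda>\<epsilon>. cmod (\<Sum>m<1. complex_of_real (\<epsilon> m) * 1) powr p) powr (1 / p)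
      \<le> B * sqrt (\<Sum>m<1::nat. (cmod 1)\<^sup>2)"
    using K by simp
  moreover have "{..<1::nat} = insert 0 {}" by auto
  ultimately show "1 \<le> B" by (simp add: sign_avg_insert)
qed

section \<open>Linear operators with square summable values on an orthonormal family\<close>

lemma has_sum_finite_sum:
  fixes g :: "'l \<Rightarrow> 'i \<Rightarrow> real"
  assumes "finite L" "\<And>l. l \<in> L \<Longrightarrow> (g l has_sum s l) A"
  shows "((\<lambda>e. \<Sum>l\<in>L. g l e) has_sum (\<Sum>l\<in>L. s l)) A"
  using assms by (induction L rule: finite_induct) (auto intro!: has_sum_add)

text \<open>
  The Cauchy-Schwarz inequality for a convergent sum, from bounds for all finite partial sums.
\<close>

lemma cmod_has_sum_le:
  assumes S: "((\<lambda>e. a e * b e) has_sum S) A" and M: "0 \<le> M"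
    and a: "\<And>F. finite F \<Longrightarrow> F \<subseteq> A \<Longrightarrow> (\<Sum>e\<in>F. (cmod (a e))\<^sup>2) \<le> M\<^sup>2"
    and b: "\<And>F. finite F \<Longrightarrow> F \<subseteq> A \<Longrightarrow> (\<Sum>e\<in>F. (cmod (b e))\<^sup>2) \<le> N"
  shows "cmod S \<le> M * sqrt N"
proof (rule tendsto_upperbound)
  show "((\<lambda>F. cmod (\<Sum>e\<in>F. a e * b e)) \<longlongrightarrow> cmod S) (finite_subsets_at_top A)"
    using S unfolding has_sum_def by (rule tendsto_norm)
  show "\<forall>\<^sub>F F in finite_subsets_at_top A. cmod (\<Sum>e\<in>F. a e * b e) \<le> M * sqrt N"
  proof (rule eventually_finite_subsets_at_top_weakI)
    fix F assume F: "finite F" "F \<subseteq> A"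
    have "cmod (\<Sum>e\<in>F. a e * b e) \<le> (\<Sum>e\<in>F. cmod (a e) * cmod (b e))"
      by (rule order_trans[OF norm_sum]) (simp add: norm_mult)
    also have "\<dots> \<le> sqrt ((\<Sum>e\<in>F. (cmod (a e))\<^sup>2) * (\<Sum>e\<in>F. (cmod (b e))\<^sup>2))"
      by (intro real_le_rsqrt Cauchy_Schwarz_ineq_sum)
    also have "\<dots> \<le> sqrt (M\<^sup>2 * N)"
      by (intro real_sqrt_le_mono mult_mono a b F) (auto simp: sum_nonneg)
    also have "\<dots> = M * sqrt N" using M by (simp add: real_sqrt_mult)
    finally show "cmod (\<Sum>e\<in>F. a e * b e) \<le> M * sqrt N" .
  qed
qed simp

context inner_space
begin

lemma hnorm_finsum_le:
  assumes "finite F" "x \<in> F \<rightarrow> carrier H"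
  shows "hnorm H (finsum H x F) \<le> (\<Sum>i\<in>F. hnorm H (x i))"
  using assms
proof (induction F rule: finite_induct)
  case (insert i F)
  then have c: "x i \<in> carrier H" "x \<in> F \<rightarrow> carrier H" by auto
  show ?case
    using insert hnorm_triangle[OF c(1) finsum_closed[OF c(2)]] c by simp
qed simp

end

text \<open>
  The bound \<open>w\<close> dominates the weak \<open>\<ell>\<^sub>p\<close> norm of the vectors \<open>x 0, \<dots>, x (k - 1)\<close>.
\<close>

definition weak_bound ::
    "complex set \<Rightarrow> 'e hspace \<Rightarrow> real \<Rightarrow> nat \<Rightarrow> (nat \<Rightarrow> 'e) \<Rightarrow> real \<Rightarrow> bool" where
  "weak_bound K E p k x w \<longleftrightarrow> 0 \<le> w \<and>
     (\<forall>h. linear_operator K E (scalar_space K) h \<longrightarrow> (\<forall>z\<in>carrier E. cmod (h z) \<le> hnorm E z) \<longrightarrow>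
       (\<Sum>i<k. cmod (h (x i)) powr p) \<le> w powr p)"

lemma weak_bound_scaled:
  assumes wb: "weak_bound K E p k x w" and x: "x \<in> {..<k} \<rightarrow> carrier E" and p: "1 \<le> p"
    and h: "linear_operator K E (scalar_space K) h" and M: "0 \<le> M"
    and bd: "\<And>z. z \<in> carrier E \<Longrightarrow> cmod (h z) \<le> M * hnorm E z"
  shows "(\<Sum>i<k. cmod (h (x i)) powr p) \<le> (M * w) powr p"
proof (cases "M = 0")
  case True
  then have "h (x i) = 0" if "i < k" for i
    using bd[of "x i"] x that by (auto simp: Pi_iff)
  then show ?thesis using p by simp
next
  case False
  then have M0: "M > 0" using M by simp
  interpret h: linear_operator K E "scalar_space K" h by (rule h)
  define g where "g z = complex_of_real (1 / M) * h z" for z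
  have g: "linear_operator K E (scalar_space K) g"
  proof
    have "g z \<in> K" if "z \<in> carrier E" for z
    proof -
      have "h z \<in> K" using h.closed[OF that] by simp
      then show ?thesis unfolding g_def by (intro h.E.K_simps)
    qed
    moreover have "g (a \<odot>\<^bsub>E\<^esub> y \<oplus>\<^bsub>E\<^esub> z) = a * g y + g z"
      if "a \<in> K" "y \<in> carrier E" "z \<in> carrier E" for a y z
      using h.lin[OF that] by (simp add: g_def algebra_simps)
    ultimately show "linear_map K E (scalar_space K) g"
      by (auto simp: linear_map_def)
  qed
  have gc: "cmod (g z) = cmod (h z) / M" for z
    using M0 by (simp add: g_def norm_mult norm_divide)
  have "cmod (g z) \<le> hnorm E z" if "z \<in> carrier E" for z
    using bd[OF that] M0 by (simp add: gc field_simps)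
  then have "(\<Sum>i<k. cmod (g (x i)) powr p) \<le> w powr p"
    using wb g by (auto simp: weak_bound_def)
  moreover have "cmod (g z) powr p = cmod (h z) powr p / M powr p" for z
    unfolding gc using M0 by (simp add: powr_divide)
  ultimately have "(\<Sum>i<k. cmod (h (x i)) powr p) / M powr p \<le> w powr p"
    by (simp add: sum_divide_distrib)
  moreover have "0 \<le> w" using wb by (simp add: weak_bound_def)
  ultimately show ?thesis
    using M0 by (simp add: powr_mult field_simps)
qed

text \<open>
  The values \<open>S\<close> are prescribed on an orthonormal family \<open>t\<close>, which need not be a basis. They
  extend to the linear operator \<open>z \<mapsto> \<Sum> \<langle>z, t\<^sub>e\<rangle> S\<^sub>e\<close>, which vanishes on the orthogonal complement
  of the family and is a Hilbert-Schmidt operator.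
\<close>

locale square_summable_images = E: inner_space K E + G: complete_inner_space K G
  for K and E :: "'e hspace" and G :: "'g hspace" +
  fixes A :: "'i set" and t :: "'i \<Rightarrow> 'e" and S :: "'i \<Rightarrow> 'g"
  assumes t: "E.orthonormal_on A t" and S: "S \<in> A \<rightarrow> carrier G"
    and summable: "(\<lambda>e. (hnorm G (S e))\<^sup>2) summable_on A"
begin

lemma tc: "e \<in> A \<Longrightarrow> t e \<in> carrier E" using t by (auto simp: E.orthonormal_on_def)
lemma Sc: "e \<in> A \<Longrightarrow> S e \<in> carrier G" using S by auto

definition extension :: "'e \<Rightarrow> 'g" where
  "extension z = (SOME y. y \<in> carrier G \<and>
     (\<forall>w\<in>carrier G. ((\<lambda>e. hinner E z (t e) * hinner G (S e) w) has_sum hinner G y w) A))"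

lemma extension_exists:
  assumes z: "z \<in> carrier E"
  shows "\<exists>y. y \<in> carrier G \<and>
     (\<forall>w\<in>carrier G. ((\<lambda>e. hinner E z (t e) * hinner G (S e) w) has_sum hinner G y w) A)"
proof -
  define x where "x e = hinner E z (t e) \<odot>\<^bsub>G\<^esub> S e" for e
  have zK: "hinner E z (t e) \<in> K" if "e \<in> A" for e by (rule E.hinner_K[OF z tc[OF that]])
  have x: "x \<in> A \<rightarrow> carrier G" unfolding x_def by (intro Pi_I G.smult_closed zK Sc)
  have dom: "(hnorm G (finsum G x F))\<^sup>2 \<le> (hnorm E z)\<^sup>2 * (\<Sum>e\<in>F. (hnorm G (S e))\<^sup>2)"
    if F: "finite F" "F \<subseteq> A" for F
  proof -
    have xF: "x \<in> F \<rightarrow> carrier G" using x F by auto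
    have "hnorm G (finsum G x F) \<le> (\<Sum>e\<in>F. cmod (hinner E z (t e)) * hnorm G (S e))"
    proof (rule order_trans[OF G.hnorm_finsum_le[OF F(1) xF] sum_mono])
      fix e assume "e \<in> F"
      then have e: "e \<in> A" using F by auto
      show "hnorm G (x e) \<le> cmod (hinner E z (t e)) * hnorm G (S e)"
        unfolding x_def G.hnorm_smult[OF zK[OF e] Sc[OF e]] ..
    qed
    then have "(hnorm G (finsum G x F))\<^sup>2 \<le> (\<Sum>e\<in>F. cmod (hinner E z (t e)) * hnorm G (S e))\<^sup>2"
      by (rule power_mono[OF _ G.hnorm_nonneg[OF G.finsum_closed[OF xF]]])
    also have "\<dots> \<le> (\<Sum>e\<in>F. (cmod (hinner E z (t e)))\<^sup>2) * (\<Sum>e\<in>F. (hnorm G (S e))\<^sup>2)"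
      by (rule Cauchy_Schwarz_ineq_sum)
    also have "\<dots> \<le> (hnorm E z)\<^sup>2 * (\<Sum>e\<in>F. (hnorm G (S e))\<^sup>2)"
      by (intro mult_right_mono E.Bessel[OF E.orthonormal_on_subset[OF t F(2)] F(1) z]) (simp add: sum_nonneg)
    finally show ?thesis .
  qed
  obtain y where y: "y \<in> carrier G"
    and sums: "\<And>w. w \<in> carrier G \<Longrightarrow> ((\<lambda>e. hinner G (x e) w) has_sum hinner G y w) A"
    using G.weak_sum_exists[OF x summable _ _ dom] by auto
  have "((\<lambda>e. hinner E z (t e) * hinner G (S e) w) has_sum hinner G y w) A" if w: "w \<in> carrier G" for w
  proof -
    have "hinner G (x e) w = hinner E z (t e) * hinner G (S e) w" if "e \<in> A" for e
      unfolding x_def by (rule G.hinner_smult_left[OF zK[OF that] Sc[OF that] w])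
    then show ?thesis using sums[OF w] by (simp cong: has_sum_cong)
  qed
  then show ?thesis using y by (intro exI[of _ y] conjI ballI)
qed

lemma extension:
  assumes z: "z \<in> carrier E"
  shows extension_closed: "extension z \<in> carrier G"
    and has_sum_extension: "w \<in> carrier G \<Longrightarrow>
      ((\<lambda>e. hinner E z (t e) * hinner G (S e) w) has_sum hinner G (extension z) w) A"
  using someI_ex[OF extension_exists[OF z]] unfolding extension_def by (auto simp: Ball_def)

lemma linear_extension: "linear_operator K E G extension"
proof
  have "extension (a \<odot>\<^bsub>E\<^esub> x \<oplus>\<^bsub>E\<^esub> y) = a \<odot>\<^bsub>G\<^esub> extension x \<oplus>\<^bsub>G\<^esub> extension y"
    if a: "a \<in> K" and x: "x \<in> carrier E" and y: "y \<in> carrier E" for a x y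
  proof (rule G.eq_if_hinner_eq)
    have axy: "a \<odot>\<^bsub>E\<^esub> x \<oplus>\<^bsub>E\<^esub> y \<in> carrier E" by (intro E.add_closed E.smult_closed a x y)
    show "extension (a \<odot>\<^bsub>E\<^esub> x \<oplus>\<^bsub>E\<^esub> y) \<in> carrier G" by (rule extension_closed[OF axy])
    show "a \<odot>\<^bsub>G\<^esub> extension x \<oplus>\<^bsub>G\<^esub> extension y \<in> carrier G"
      by (intro G.add_closed G.smult_closed a extension_closed x y)
    fix w assume w: "w \<in> carrier G"
    have "((\<lambda>e. a * (hinner E x (t e) * hinner G (S e) w) + hinner E y (t e) * hinner G (S e) w) has_sum
        a * hinner G (extension x) w + hinner G (extension y) w) A"
      by (intro has_sum_add has_sum_cmult_right has_sum_extension x y w)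
    moreover have "a * (hinner E x (t e) * hinner G (S e) w) + hinner E y (t e) * hinner G (S e) w
        = hinner E (a \<odot>\<^bsub>E\<^esub> x \<oplus>\<^bsub>E\<^esub> y) (t e) * hinner G (S e) w" if "e \<in> A" for e
      unfolding E.hinner_lin[OF a x y tc[OF that]] by (simp add: algebra_simps)
    ultimately have "((\<lambda>e. hinner E (a \<odot>\<^bsub>E\<^esub> x \<oplus>\<^bsub>E\<^esub> y) (t e) * hinner G (S e) w) has_sum
        a * hinner G (extension x) w + hinner G (extension y) w) A"
      by (simp cong: has_sum_cong)
    then show "hinner G (extension (a \<odot>\<^bsub>E\<^esub> x \<oplus>\<^bsub>E\<^esub> y)) w = hinner G (a \<odot>\<^bsub>G\<^esub> extension x \<oplus>\<^bsub>G\<^esub> extension y) w"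
      unfolding G.hinner_lin[OF a extension_closed[OF x] extension_closed[OF y] w]
      using has_sum_unique[OF has_sum_extension[OF axy w]] by blast
  qed
  then show "linear_map K E G extension"
    unfolding linear_map_def using extension_closed by auto
qed

definition HS_sq :: real where "HS_sq = (\<Sum>\<^sub>\<infinity>e\<in>A. (hnorm G (S e))\<^sup>2)"

text \<open>
  This bounds the squared norm of the functional \<open>z \<mapsto> \<langle>f z, w\<rangle>\<close>, where \<open>f\<close> is the extension.
\<close>

definition fun_sq :: "'g \<Rightarrow> real" where "fun_sq w = (\<Sum>\<^sub>\<infinity>e\<in>A. (cmod (hinner G (S e) w))\<^sup>2)"

lemma HS_sq_nonneg: "0 \<le> HS_sq" unfolding HS_sq_def by (intro infsum_nonneg) auto
lemma fun_sq_nonneg: "0 \<le> fun_sq w" unfolding fun_sq_def by (intro infsum_nonneg) auto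

lemma fun_sq_has_sum:
  assumes w: "w \<in> carrier G"
  shows "((\<lambda>e. (cmod (hinner G (S e) w))\<^sup>2) has_sum fun_sq w) A"
proof -
  have "(\<lambda>e. (hnorm G w)\<^sup>2 * (hnorm G (S e))\<^sup>2) summable_on A"
    by (rule summable_on_cmult_right[OF summable])
  then have "(\<lambda>e. (cmod (hinner G (S e) w))\<^sup>2) summable_on A"
  proof (rule summable_on_comparison_test)
    fix e assume e: "e \<in> A"
    have "(cmod (hinner G (S e) w))\<^sup>2 \<le> (hnorm G (S e) * hnorm G w)\<^sup>2"
      by (intro power_mono G.Cauchy_Schwarz Sc e w) simp
    then show "(cmod (hinner G (S e) w))\<^sup>2 \<le> (hnorm G w)\<^sup>2 * (hnorm G (S e))\<^sup>2"
      by (simp add: power_mult_distrib mult.commute)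
  qed simp
  then show ?thesis unfolding fun_sq_def by (rule has_sum_infsum)
qed

lemma cmod_hinner_extension_le:
  assumes z: "z \<in> carrier E" and w: "w \<in> carrier G"
  shows "cmod (hinner G (extension z) w) \<le> sqrt (fun_sq w) * hnorm E z"
proof -
  have "cmod (hinner G (extension z) w) \<le> hnorm E z * sqrt (fun_sq w)"
  proof (rule cmod_has_sum_le[OF has_sum_extension[OF z w] E.hnorm_nonneg[OF z]])
    fix F assume F: "finite F" "F \<subseteq> A"
    show "(\<Sum>e\<in>F. (cmod (hinner E z (t e)))\<^sup>2) \<le> (hnorm E z)\<^sup>2"
      by (rule E.Bessel[OF E.orthonormal_on_subset[OF t F(2)] F(1) z])
    show "(\<Sum>e\<in>F. (cmod (hinner G (S e) w))\<^sup>2) \<le> fun_sq w"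
      unfolding fun_sq_def by (rule finite_sum_le_infsum[OF has_sum_imp_summable[OF fun_sq_has_sum[OF w]] F]) simp
  qed
  then show ?thesis by (simp add: mult.commute)
qed

lemma sum_fun_sq_le:
  assumes L: "finite L" "G.orthonormal_on L (\<lambda>g. g)"
  shows "(\<Sum>g\<in>L. fun_sq g) \<le> HS_sq"
proof (rule has_sum_mono)
  have Lc: "g \<in> L \<Longrightarrow> g \<in> carrier G" for g using L by (auto simp: G.orthonormal_on_def)
  show "((\<lambda>e. \<Sum>g\<in>L. (cmod (hinner G (S e) g))\<^sup>2) has_sum (\<Sum>g\<in>L. fun_sq g)) A"
    by (intro has_sum_finite_sum L fun_sq_has_sum Lc)
  show "((\<lambda>e. (hnorm G (S e))\<^sup>2) has_sum HS_sq) A"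
    unfolding HS_sq_def by (rule has_sum_infsum[OF summable])
  show "(\<Sum>g\<in>L. (cmod (hinner G (S e) g))\<^sup>2) \<le> (hnorm G (S e))\<^sup>2" if "e \<in> A" for e
    by (rule G.Bessel[OF L(2,1) Sc[OF that]])
qed

lemma hnorm_extension_le:
  assumes z: "z \<in> carrier E"
  shows "hnorm G (extension z) \<le> sqrt HS_sq * hnorm E z"
proof (cases "extension z = \<zero>\<^bsub>G\<^esub>")
  case True
  then show ?thesis using E.hnorm_nonneg[OF z] HS_sq_nonneg by simp
next
  case False
  have f: "extension z \<in> carrier G" by (rule extension_closed[OF z])
  have n: "hnorm G (extension z) > 0"
    using G.hnorm_nonneg[OF f] G.hnorm_eq_0[OF f] False by linarith
  define g where "g = complex_of_real (1 / hnorm G (extension z)) \<odot>\<^bsub>G\<^esub> extension z"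
  note gn = G.orthonormal_on_normalize(1,2)[OF f False, folded g_def]
  have "fun_sq g \<le> HS_sq"
    using sum_fun_sq_le[of "{g}"] gn by (simp add: G.orthonormal_on_def)
  then have "sqrt (fun_sq g) * hnorm E z \<le> sqrt HS_sq * hnorm E z"
    by (intro mult_right_mono E.hnorm_nonneg[OF z]) simp
  moreover have "hinner G (extension z) g = complex_of_real (1 / hnorm G (extension z)) * complex_of_real ((hnorm G (extension z))\<^sup>2)"
    unfolding g_def by (subst G.hinner_smult_right[OF _ f f]) (simp_all add: G.hinner_self[OF f])
  then have "hinner G (extension z) g = complex_of_real (hnorm G (extension z))"
    by (simp add: power2_eq_square)
  ultimately show ?thesis
    using cmod_hinner_extension_le[OF z gn(1)] n by simp
qed

lemma linear_hinner_extension: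
  assumes w: "w \<in> carrier G"
  shows "linear_operator K E (scalar_space K) (\<lambda>z. hinner G (extension z) w)"
proof -
  interpret sc: inner_space K "scalar_space K" by (rule inner_space_scalar_space[OF E.K_cases])
  interpret f: linear_operator K E G extension by (rule linear_extension)
  show ?thesis
  proof
    show "linear_map K E (scalar_space K) (\<lambda>z. hinner G (extension z) w)"
      unfolding linear_map_def
      by (auto simp: f.lin G.hinner_lin[OF _ f.closed f.closed w] intro!: G.hinner_K f.closed w)
  qed
qed

lemma weak_bound_extension:
  assumes "weak_bound K E p k x w" "x \<in> {..<k} \<rightarrow> carrier E" "1 \<le> p" "y \<in> carrier G"
  shows "(\<Sum>i<k. cmod (hinner G (extension (x i)) y) powr p) \<le> (sqrt (fun_sq y) * w) powr p"
  by (rule weak_bound_scaled[OF assms(1-3) linear_hinner_extension[OF assms(4)]])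
     (auto simp: fun_sq_nonneg cmod_hinner_extension_le[OF _ assms(4)])

lemma finite_Parseval_extension:
  assumes x: "x \<in> {..<k::nat} \<rightarrow> carrier E"
  obtains L where "finite L" "G.orthonormal_on L (\<lambda>g. g)"
    "\<forall>i<k. (hnorm G (extension (x i)))\<^sup>2 = (\<Sum>g\<in>L. (cmod (hinner G (extension (x i)) g))\<^sup>2)"
proof -
  have "(\<lambda>i. extension (x i)) ` {..<k} \<subseteq> carrier G"
    using x extension_closed by auto
  from G.finite_orthonormal_Parseval[OF _ this] show ?thesis
    using that by auto
qed

text \<open>
  Expand the values in a finite orthonormal set \<open>L\<close> of the target and exchange the sums. Each
  \<open>g\<close> in \<open>L\<close> contributes a functional, to which the weak bound applies; the squared norms of these
  functionals add up to at most the squared Hilbert-Schmidt norm. No constant is lost.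
\<close>

lemma two_summing_extension:
  assumes wb: "weak_bound K E 2 k x w" and x: "x \<in> {..<k} \<rightarrow> carrier E"
  shows "(\<Sum>i<k. (hnorm G (extension (x i)))\<^sup>2) \<le> HS_sq * w\<^sup>2"
proof -
  obtain L where L: "finite L" "G.orthonormal_on L (\<lambda>g. g)"
    and P: "\<forall>i<k. (hnorm G (extension (x i)))\<^sup>2 = (\<Sum>g\<in>L. (cmod (hinner G (extension (x i)) g))\<^sup>2)"
    by (rule finite_Parseval_extension[OF x])
  have Lc: "g \<in> L \<Longrightarrow> g \<in> carrier G" for g using L by (auto simp: G.orthonormal_on_def)
  have w: "0 \<le> w" using wb by (simp add: weak_bound_def)
  have "(\<Sum>i<k. (hnorm G (extension (x i)))\<^sup>2) = (\<Sum>i<k. \<Sum>g\<in>L. (cmod (hinner G (extension (x i)) g))\<^sup>2)"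
    using P by (intro sum.cong) auto
  also have "\<dots> = (\<Sum>g\<in>L. \<Sum>i<k. cmod (hinner G (extension (x i)) g) powr 2)"
    by (subst sum.swap) simp
  also have "\<dots> \<le> (\<Sum>g\<in>L. (sqrt (fun_sq g) * w) powr 2)"
    by (intro sum_mono weak_bound_extension[OF wb x] Lc) simp_all
  also have "\<dots> = (\<Sum>g\<in>L. fun_sq g) * w\<^sup>2"
    using w fun_sq_nonneg by (simp add: power_mult_distrib sum_distrib_right)
  also have "\<dots> \<le> HS_sq * w\<^sup>2"
    by (intro mult_right_mono sum_fun_sq_le L) simp
  finally show ?thesis .
qed

text \<open>
  The square root of \<open>\<Sum> \<bar>\<langle>f x\<^sub>i, g\<rangle>\<bar>\<^sup>2\<close> over \<open>L\<close> is replaced by an average over signs of the modulus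
  of the single functional \<open>\<langle>f x\<^sub>i, y\<^sub>\<epsilon>\<rangle>\<close>, by the lower Khintchine inequality. The average of the squared
  norms of these functionals is bounded by the squared Hilbert-Schmidt norm. The constant is not sharp:
  \<open>sqrt N \<le> 1 + N\<close> takes the place of Jensen's inequality.
\<close>

lemma one_summing_extension:
  assumes wb: "weak_bound K E 1 k x w" and x: "x \<in> {..<k} \<rightarrow> carrier E"
  shows "(\<Sum>i<k. hnorm G (extension (x i))) \<le> (1 + HS_sq) / khin_lower * w"
proof -
  obtain L where L: "finite L" "G.orthonormal_on L (\<lambda>g. g)"
    and P: "\<forall>i<k. (hnorm G (extension (x i)))\<^sup>2 = (\<Sum>g\<in>L. (cmod (hinner G (extension (x i)) g))\<^sup>2)"
    by (rule finite_Parseval_extension[OF x])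
  have Lc: "g \<in> L \<Longrightarrow> g \<in> carrier G" for g using L by (auto simp: G.orthonormal_on_def)
  have w: "0 \<le> w" using wb by (simp add: weak_bound_def)
  define y where "y \<epsilon> = (\<Oplus>\<^bsub>G\<^esub>g\<in>L. complex_of_real (\<epsilon> g) \<odot>\<^bsub>G\<^esub> g)" for \<epsilon> :: "'g \<Rightarrow> real"
  have yt: "(\<lambda>g. complex_of_real (\<epsilon> g) \<odot>\<^bsub>G\<^esub> g) \<in> L \<rightarrow> carrier G" for \<epsilon> :: "'g \<Rightarrow> real"
    by (intro Pi_I G.smult_closed G.K_simps Lc)
  have y: "y \<epsilon> \<in> carrier G" for \<epsilon> unfolding y_def by (intro G.finsum_closed yt)
  have inner_y: "hinner G v (y \<epsilon>) = (\<Sum>g\<in>L. complex_of_real (\<epsilon> g) * hinner G v g)"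
    if v: "v \<in> carrier G" for v \<epsilon>
    unfolding y_def G.hinner_finsum_right[OF yt v L(1)]
    by (intro sum.cong refl) (simp add: G.hinner_smult_right[OF _ Lc v])
  have avg: "sign_avg L (\<lambda>\<epsilon>. fun_sq (y \<epsilon>)) \<le> HS_sq"
  proof (rule has_sum_mono)
    show "((\<lambda>e. sign_avg L (\<lambda>\<epsilon>. (cmod (hinner G (S e) (y \<epsilon>)))\<^sup>2)) has_sum sign_avg L (\<lambda>\<epsilon>. fun_sq (y \<epsilon>))) A"
      unfolding sign_avg_def
      by (intro has_sum_divide_const has_sum_finite_sum fun_sq_has_sum y finite_PiE L) simp
    show "((\<lambda>e. (hnorm G (S e))\<^sup>2) has_sum HS_sq) A"
      unfolding HS_sq_def by (rule has_sum_infsum[OF summable])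
    show "sign_avg L (\<lambda>\<epsilon>. (cmod (hinner G (S e) (y \<epsilon>)))\<^sup>2) \<le> (hnorm G (S e))\<^sup>2" if e: "e \<in> A" for e
      unfolding inner_y[OF Sc[OF e]] Khintchine_second_moment[OF L(1)]
      by (rule G.Bessel[OF L(2,1) Sc[OF e]])
  qed
  have "khin_lower * (\<Sum>i<k. hnorm G (extension (x i)))
      \<le> (\<Sum>i<k. sign_avg L (\<lambda>\<epsilon>. cmod (hinner G (extension (x i)) (y \<epsilon>))))"
    unfolding sum_distrib_left
  proof (rule sum_mono)
    fix i assume i: "i \<in> {..<k}"
    then have f: "extension (x i) \<in> carrier G" using x extension_closed by auto
    have "hnorm G (extension (x i)) = sqrt (\<Sum>g\<in>L. (cmod (hinner G (extension (x i)) g))\<^sup>2)"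
      using P i G.hnorm_nonneg[OF f] by (metis lessThan_iff real_sqrt_unique)
    then show "khin_lower * hnorm G (extension (x i)) \<le> sign_avg L (\<lambda>\<epsilon>. cmod (hinner G (extension (x i)) (y \<epsilon>)))"
      unfolding inner_y[OF f] using Khintchine_lower[OF L(1)] by simp
  qed
  also have "\<dots> = sign_avg L (\<lambda>\<epsilon>. \<Sum>i<k. cmod (hinner G (extension (x i)) (y \<epsilon>)) powr 1)"
    by (simp add: sign_avg_sum)
  also have "\<dots> \<le> sign_avg L (\<lambda>\<epsilon>. w * (1 + fun_sq (y \<epsilon>)))"
  proof (rule sign_avg_mono)
    fix \<epsilon>
    have "(\<Sum>i<k. cmod (hinner G (extension (x i)) (y \<epsilon>)) powr 1) \<le> (sqrt (fun_sq (y \<epsilon>)) * w) powr 1"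
      by (rule weak_bound_extension[OF wb x _ y]) simp
    also have "\<dots> = w * sqrt (fun_sq (y \<epsilon>))" using w fun_sq_nonneg by simp
    also have "\<dots> \<le> w * (1 + fun_sq (y \<epsilon>))"
    proof (intro mult_left_mono w)
      have "0 \<le> (sqrt (fun_sq (y \<epsilon>)) - 1)\<^sup>2" "(sqrt (fun_sq (y \<epsilon>)))\<^sup>2 = fun_sq (y \<epsilon>)" "0 \<le> fun_sq (y \<epsilon>)"
        using fun_sq_nonneg by auto
      then show "sqrt (fun_sq (y \<epsilon>)) \<le> 1 + fun_sq (y \<epsilon>)"
        by (simp add: power2_diff)
    qed
    finally show "(\<Sum>i<k. cmod (hinner G (extension (x i)) (y \<epsilon>)) powr 1) \<le> w * (1 + fun_sq (y \<epsilon>))" .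
  qed
  also have "\<dots> \<le> w * (1 + HS_sq)"
    unfolding sign_avg_cmult sign_avg_add sign_avg_const[OF L(1)]
    by (intro mult_left_mono add_left_mono avg w)
  finally show ?thesis using khin_lower_pos by (simp add: field_simps)
qed

end

section \<open>Multilinear operators and their linearizations\<close>

lemma tuplesD: "u \<in> tuples n H \<Longrightarrow> i < n \<Longrightarrow> u i \<in> carrier (H i)"
  by (auto simp: tuples_def)

lemma tuples_upd: "u \<in> tuples n H \<Longrightarrow> i < n \<Longrightarrow> x \<in> carrier (H i) \<Longrightarrow> u(i := x) \<in> tuples n H"
  unfolding tuples_def by (auto simp: PiE_iff extensional_def)

lemma finsum_scalar_space:
  assumes K: "K = \<real> \<or> K = (UNIV :: complex set)" and "finite F" "x \<in> F \<rightarrow> K"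
  shows "finsum (scalar_space K) x F = sum x F"
proof -
  interpret S: inner_space K "scalar_space K" by (rule inner_space_scalar_space[OF K])
  show ?thesis using assms(2,3) by (induction F rule: finite_induct) auto
qed

locale multilinear_op =
  fixes K :: "complex set" and n :: nat and H :: "nat \<Rightarrow> 'a hspace" and G :: "'g hspace" and T
  assumes spaces: "\<And>i. i < n \<Longrightarrow> inner_space K (H i)" and target: "inner_space K G"
    and multilinear: "multilinear K n H G T"
begin

lemma closed: "u \<in> tuples n H \<Longrightarrow> T u \<in> carrier G"
  using multilinear by (auto simp: multilinear_def)

lemma coord:
  assumes u: "u \<in> tuples n H" and i: "i < n"
  shows "linear_operator K (H i) G (\<lambda>x. T (u(i := x)))"
proof -
  interpret Hi: inner_space K "H i" by (rule spaces[OF i])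
  interpret G: inner_space K G by (rule target)
  show ?thesis
  proof
    have "(\<lambda>x. T (u(i := x))) \<in> carrier (H i) \<rightarrow> carrier G"
      by (intro Pi_I closed tuples_upd u i)
    moreover have "T (u(i := a \<odot>\<^bsub>H i\<^esub> x \<oplus>\<^bsub>H i\<^esub> y)) = a \<odot>\<^bsub>G\<^esub> T (u(i := x)) \<oplus>\<^bsub>G\<^esub> T (u(i := y))"
      if "a \<in> K" "x \<in> carrier (H i)" "y \<in> carrier (H i)" for a x y
      using multilinear u i that unfolding multilinear_def by simp
    ultimately show "linear_map K (H i) G (\<lambda>x. T (u(i := x)))"
      unfolding linear_map_def by simp
  qed
qed

lemma zero:
  assumes u: "u \<in> tuples n H" and i: "i < n" and z: "u i = \<zero>\<^bsub>H i\<^esub>"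
  shows "T u = \<zero>\<^bsub>G\<^esub>"
  using linear_operator.zero[OF coord[OF u i]] z by (metis fun_upd_triv)

lemma smult:
  assumes u: "u \<in> tuples n H" and i: "i < n" and a: "a \<in> K"
  shows "T (u(i := a \<odot>\<^bsub>H i\<^esub> u i)) = a \<odot>\<^bsub>G\<^esub> T u"
  using linear_operator.smult[OF coord[OF u i] a tuplesD[OF u i]] by simp

lemma compose:
  assumes f: "linear_operator K G X f"
  shows "multilinear_op K n H X (\<lambda>u. f (T u))"
proof -
  interpret f: linear_operator K G X f by (rule f)
  show ?thesis
  proof (rule multilinear_op.intro)
    show "inner_space K (H i)" if "i < n" for i by (rule spaces[OF that])
    show "inner_space K X" by (rule f.G.inner_space_axioms)
    show "multilinear K n H X (\<lambda>u. f (T u))"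
      unfolding multilinear_def
    proof (intro conjI ballI allI impI Pi_I)
      show "f (T u) \<in> carrier X" if "u \<in> tuples n H" for u
        by (rule f.closed[OF closed[OF that]])
      fix u i a x y
      assume u: "u \<in> tuples n H" and i: "i < n" and a: "a \<in> K" and x: "x \<in> carrier (H i)"
        and y: "y \<in> carrier (H i)"
      have "f (T (u(i := a \<odot>\<^bsub>H i\<^esub> x \<oplus>\<^bsub>H i\<^esub> y))) = f (a \<odot>\<^bsub>G\<^esub> T (u(i := x)) \<oplus>\<^bsub>G\<^esub> T (u(i := y)))"
        using linear_operator.lin[OF coord[OF u i] a x y] by simp
      also have "\<dots> = a \<odot>\<^bsub>X\<^esub> f (T (u(i := x))) \<oplus>\<^bsub>X\<^esub> f (T (u(i := y)))"
        by (intro f.lin a closed tuples_upd u i x y)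
      finally show "f (T (u(i := a \<odot>\<^bsub>H i\<^esub> x \<oplus>\<^bsub>H i\<^esub> y))) = a \<odot>\<^bsub>X\<^esub> f (T (u(i := x))) \<oplus>\<^bsub>X\<^esub> f (T (u(i := y)))" .
    qed
  qed
qed

end

locale tensor_space =
  fixes K :: "complex set" and n :: nat and H :: "nat \<Rightarrow> 'a hspace" and E :: "'e hspace"
    and tens :: "(nat \<Rightarrow> 'a) \<Rightarrow> 'e"
  assumes K_cases: "K = \<real> \<or> K = UNIV" and n_pos: "1 \<le> n"
    and Hs: "\<And>i. i < n \<Longrightarrow> hilbert_space K (H i)" and tensor: "hilbert_tensor K n H E tens"
begin

abbreviation "unit_ball \<equiv> LH_ball K n H E tens"
abbreviation "lip_const \<equiv> lip_summing_const K n H E tens"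

lemma Hi: "i < n \<Longrightarrow> complete_inner_space K (H i)"
  using Hs K_cases by (simp add: complete_inner_space_iff)

lemma Hi': "i < n \<Longrightarrow> inner_space K (H i)"
  using Hi complete_inner_space_def by blast

sublocale E: complete_inner_space K E
  using tensor K_cases by (simp add: complete_inner_space_iff hilbert_tensor_def)

sublocale scalars: inner_space K "scalar_space K"
  by (rule inner_space_scalar_space[OF K_cases])

sublocale tens: multilinear_op K n H E tens
proof (rule multilinear_op.intro)
  show "inner_space K (H i)" if "i < n" for i by (rule Hi'[OF that])
  show "inner_space K E" by (rule E.inner_space_axioms)
  show "multilinear K n H E tens" using tensor by (simp add: hilbert_tensor_def)
qed

lemma hinner_tens: "u \<in> tuples n H \<Longrightarrow> v \<in> tuples n H \<Longrightarrow>
    hinner E (tens u) (tens v) = (\<Prod>i<n. hinner (H i) (u i) (v i))"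
  using tensor by (simp add: hilbert_tensor_def)

lemma hnorm_tens:
  assumes u: "u \<in> tuples n H"
  shows "hnorm E (tens u) = (\<Prod>i<n. hnorm (H i) (u i))"
proof -
  have "hinner (H i) (u i) (u i) = complex_of_real ((hnorm (H i) (u i))\<^sup>2)" if "i < n" for i
    by (rule inner_space.hinner_self[OF Hi'[OF that] tuplesD[OF u that]])
  then have "hinner E (tens u) (tens u) = (\<Prod>i<n. complex_of_real ((hnorm (H i) (u i))\<^sup>2))"
    unfolding hinner_tens[OF u u] by (intro prod.cong) auto
  also have "\<dots> = complex_of_real ((\<Prod>i<n. hnorm (H i) (u i))\<^sup>2)"
    by (simp add: prod_power_distrib)
  finally have "hnorm E (tens u) = sqrt ((\<Prod>i<n. hnorm (H i) (u i))\<^sup>2)"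
    by (simp only: hnorm_def Re_complex_of_real)
  also have "\<dots> = (\<Prod>i<n. hnorm (H i) (u i))"
    by (intro real_sqrt_unique refl prod_nonneg) (auto intro: inner_space.hnorm_nonneg[OF Hi' tuplesD[OF u]])
  finally show ?thesis .
qed

lemma tens_dense: "tens ` tuples n H \<subseteq> carrier E"
    "htop E closure_of hspan K E (tens ` tuples n H) = carrier E"
  using tensor tens.closed by (auto simp: hilbert_tensor_def)

lemma is_linearizationD:
  assumes "is_linearization K n H E tens G T f" and "inner_space K G"
  shows "linear_operator K E G f" "continuous_map (htop E) (htop G) f"
    "u \<in> tuples n H \<Longrightarrow> f (tens u) = T u"
  using assms E.inner_space_axioms
  by (auto simp: is_linearization_def linear_operator_def linear_operator_axioms_def)

text \<open>
  Together with the next lemma: the unit ball consists of the functionals of norm at most \<open>1\<close> on the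
  tensor product, restricted to elementary tensors.
\<close>

lemma LH_ballD:
  assumes "\<phi> \<in> unit_ball"
  obtains f where "linear_operator K E (scalar_space K) f"
    "\<forall>z\<in>carrier E. cmod (f z) \<le> hnorm E z" "\<forall>u\<in>tuples n H. \<phi> u = f (tens u)"
proof -
  define f where "f = (SOME f. is_linearization K n H E tens (scalar_space K) \<phi> f)"
  have "\<exists>f. is_linearization K n H E tens (scalar_space K) \<phi> f"
    using assms unfolding LH_ball_def LH_def by simp
  then have "is_linearization K n H E tens (scalar_space K) \<phi> f"
    unfolding f_def by (rule someI_ex)
  note f = is_linearizationD[OF this scalars.inner_space_axioms]
  have "op_norm E (scalar_space K) f \<le> 1"
    using assms by (simp add: LH_ball_def LH_norm_def f_def)
  then have "\<forall>z\<in>carrier E. cmod (f z) \<le> hnorm E z"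
    unfolding op_norm_le_1_iff[OF f(1,2)] by simp
  then show ?thesis by (rule that[OF f(1)]) (simp add: f(3))
qed

text \<open>
  The linearization that is chosen in the definition of the norm agrees with \<open>f\<close>, because elementary
  tensors span a dense subspace.
\<close>

lemma LH_ballI:
  assumes f: "linear_operator K E (scalar_space K) f"
    and bd: "\<forall>z\<in>carrier E. cmod (f z) \<le> hnorm E z"
  shows "(\<lambda>u. f (tens u)) \<in> unit_ball"
proof -
  interpret f: linear_operator K E "scalar_space K" f by (rule f)
  have cf: "continuous_map (htop E) (htop (scalar_space K)) f"
    by (rule f.continuous_if_bounded[of 1]) (use bd in simp)
  have ml: "multilinear K n H (scalar_space K) (\<lambda>u. f (tens u))"
    using multilinear_op.multilinear[OF tens.compose[OF f]] .
  have lin: "is_linearization K n H E tens (scalar_space K) (\<lambda>u. f (tens u)) f"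
    unfolding is_linearization_def using f.linear cf by simp
  define g where "g = (SOME f'. is_linearization K n H E tens (scalar_space K) (\<lambda>u. f (tens u)) f')"
  have "is_linearization K n H E tens (scalar_space K) (\<lambda>u. f (tens u)) g"
    unfolding g_def by (rule someI[of _ f]) (rule lin)
  note g = is_linearizationD[OF this scalars.inner_space_axioms]
  have "g z = f z" if "z \<in> carrier E" for z
    by (rule linear_map_eq_on_dense[OF g(1,2) f cf tens_dense _ that]) (use g(3) in auto)
  then have "op_norm E (scalar_space K) g \<le> 1"
    unfolding op_norm_le_1_iff[OF g(1,2)] using bd by simp
  then show ?thesis
    using ml lin by (auto simp: LH_ball_def LH_def LH_norm_def g_def)
qed

lemma zero_functional: "linear_operator K E (scalar_space K) (\<lambda>_. 0)"
proof
  show "linear_map K E (scalar_space K) (\<lambda>_. 0)"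
    by (simp add: linear_map_def scalars.K_simps)
qed

lemma LH_ball_nonempty: "unit_ball \<noteq> {}"
  using LH_ballI[OF zero_functional] by auto

lemma LH_ball_multilinear: "\<phi> \<in> unit_ball \<Longrightarrow> multilinear_op K n H (scalar_space K) \<phi>"
  using Hi' scalars.inner_space_axioms by (auto simp: LH_ball_def LH_def multilinear_op_def)

lemma LH_ball_diff:
  assumes f: "linear_operator K E (scalar_space K) f" and phi: "\<forall>u\<in>tuples n H. \<phi> u = f (tens u)"
    and u: "u \<in> tuples n H" and v: "v \<in> tuples n H"
  shows "\<phi> u - \<phi> v = f (tens u \<ominus>\<^bsub>E\<^esub> tens v)"
proof -
  interpret f: linear_operator K E "scalar_space K" f by (rule f)
  have "f (tens u \<ominus>\<^bsub>E\<^esub> tens v) = f (tens u) \<ominus>\<^bsub>scalar_space K\<^esub> f (tens v)"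
    by (rule f.minus[OF tens.closed[OF u] tens.closed[OF v]])
  also have "\<dots> = f (tens u) - f (tens v)"
    using f.closed[OF tens.closed[OF u]] f.closed[OF tens.closed[OF v]]
    by (intro scalar_space_minus K_cases) simp_all
  finally show ?thesis using phi u v by simp
qed

text \<open>
  The supremum in the definition of summing operators. It is the weak \<open>\<ell>\<^sub>p\<close> norm of the differences
  of elementary tensors \<open>tens (u i) - tens (v i)\<close>.
\<close>

definition weak_norm :: "real \<Rightarrow> nat \<Rightarrow> (nat \<Rightarrow> nat \<Rightarrow> 'a) \<Rightarrow> (nat \<Rightarrow> nat \<Rightarrow> 'a) \<Rightarrow> real" where
  "weak_norm p k u v = (SUP \<phi>\<in>unit_ball.
      (\<Sum>i<k. cmod (\<phi> (u i) - \<phi> (v i)) powr p) powr (1 / p))"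

context
  fixes p :: real and k :: nat and u v :: "nat \<Rightarrow> nat \<Rightarrow> 'a"
  assumes p: "1 \<le> p" and u: "u \<in> {..<k} \<rightarrow> tuples n H" and v: "v \<in> {..<k} \<rightarrow> tuples n H"
begin

lemma weak_norm_bdd:
  "bdd_above ((\<lambda>\<phi>. (\<Sum>i<k. cmod (\<phi> (u i) - \<phi> (v i)) powr p) powr (1 / p)) ` unit_ball)"
proof (rule bdd_aboveI2)
  fix \<phi> assume "\<phi> \<in> unit_ball"
  then obtain f where f: "linear_operator K E (scalar_space K) f"
    "\<forall>z\<in>carrier E. cmod (f z) \<le> hnorm E z" "\<forall>u\<in>tuples n H. \<phi> u = f (tens u)"
    by (rule LH_ballD)
  have le: "cmod (\<phi> (u i) - \<phi> (v i)) \<le> hnorm E (tens (u i) \<ominus>\<^bsub>E\<^esub> tens (v i))" if "i < k" for i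
  proof -
    have ui: "u i \<in> tuples n H" "v i \<in> tuples n H" using u v that by auto
    show ?thesis unfolding LH_ball_diff[OF f(1,3) ui]
      by (rule f(2)[rule_format]) (intro E.minus_closed tens.closed ui)
  qed
  have "(\<Sum>i<k. cmod (\<phi> (u i) - \<phi> (v i)) powr p)
      \<le> (\<Sum>i<k. hnorm E (tens (u i) \<ominus>\<^bsub>E\<^esub> tens (v i)) powr p)"
    using p le by (intro sum_mono powr_mono2) simp_all
  then show "(\<Sum>i<k. cmod (\<phi> (u i) - \<phi> (v i)) powr p) powr (1 / p)
      \<le> (\<Sum>i<k. hnorm E (tens (u i) \<ominus>\<^bsub>E\<^esub> tens (v i)) powr p) powr (1 / p)"
    using p by (intro powr_mono2) (simp_all add: sum_nonneg)
qed

lemma weak_norm_upper: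
  "\<phi> \<in> unit_ball \<Longrightarrow>
    (\<Sum>i<k. cmod (\<phi> (u i) - \<phi> (v i)) powr p) powr (1 / p) \<le> weak_norm p k u v"
  unfolding weak_norm_def by (rule cSUP_upper[OF _ weak_norm_bdd])

lemma weak_norm_nonneg: "0 \<le> weak_norm p k u v"
  using weak_norm_upper[OF LH_ballI[OF zero_functional]] p by simp

lemma weak_bound_weak_norm:
  "weak_bound K E p k (\<lambda>i. tens (u i) \<ominus>\<^bsub>E\<^esub> tens (v i)) (weak_norm p k u v)"
  unfolding weak_bound_def
proof (intro conjI weak_norm_nonneg allI impI)
  fix h assume h: "linear_operator K E (scalar_space K) h" "\<forall>z\<in>carrier E. cmod (h z) \<le> hnorm E z"
  have "(\<Sum>i<k. cmod (h (tens (u i) \<ominus>\<^bsub>E\<^esub> tens (v i))) powr p)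
      = (\<Sum>i<k. cmod (h (tens (u i)) - h (tens (v i))) powr p)"
  proof (intro sum.cong refl)
    fix i assume "i \<in> {..<k}"
    then have ui: "u i \<in> tuples n H" "v i \<in> tuples n H" using u v by auto
    show "cmod (h (tens (u i) \<ominus>\<^bsub>E\<^esub> tens (v i))) powr p = cmod (h (tens (u i)) - h (tens (v i))) powr p"
      using LH_ball_diff[OF h(1) _ ui, of "\<lambda>u. h (tens u)"] by simp
  qed
  also have "\<dots> = ((\<Sum>i<k. cmod (h (tens (u i)) - h (tens (v i))) powr p) powr (1 / p)) powr p"
    using p by (simp add: powr_powr sum_nonneg)
  also have "\<dots> \<le> weak_norm p k u v powr p"
    using weak_norm_upper[OF LH_ballI[OF h]] p by (intro powr_mono2) auto
  finally show "(\<Sum>i<k. cmod (h (tens (u i) \<ominus>\<^bsub>E\<^esub> tens (v i))) powr p) \<le> weak_norm p k u v powr p" .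
qed

end

lemma weak_norm_least:
  assumes "\<And>\<phi>. \<phi> \<in> unit_ball \<Longrightarrow>
      (\<Sum>i<k. cmod (\<phi> (u i) - \<phi> (v i)) powr p) powr (1 / p) \<le> c"
  shows "weak_norm p k u v \<le> c"
  unfolding weak_norm_def using LH_ball_nonempty assms by (rule cSUP_least)

lemma lip_summing_const_iff:
  "lip_const G p T c \<longleftrightarrow>
    (\<forall>k u v. u \<in> {..<k} \<rightarrow> tuples n H \<longrightarrow> v \<in> {..<k} \<rightarrow> tuples n H \<longrightarrow>
       (\<Sum>i<k. hnorm G (T (u i) \<ominus>\<^bsub>G\<^esub> T (v i)) powr p) powr (1 / p) \<le> c * weak_norm p k u v)"
  unfolding lip_summing_const_def weak_norm_def by simp

text \<open>
  Two different tuples of basis vectors differ in some coordinate, which contributes a factor \<open>0\<close>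
  to the product of the inner products.
\<close>

lemma orthonormal_tens:
  assumes B: "\<And>i. i < n \<Longrightarrow> orthonormal_basis K (H i) (B i)"
  shows "E.orthonormal_on (PiE {..<n} B) tens" "PiE {..<n} B \<subseteq> tuples n H"
proof -
  show sub: "PiE {..<n} B \<subseteq> tuples n H"
    unfolding tuples_def by (rule PiE_mono) (use B in \<open>auto simp: orthonormal_basis_def\<close>)
  have "hinner E (tens e) (tens e') = (if e = e' then 1 else 0)"
    if e: "e \<in> PiE {..<n} B" and e': "e' \<in> PiE {..<n} B" for e e'
  proof -
    have "hinner E (tens e) (tens e') = (\<Prod>i<n. if e i = e' i then 1 else 0)"
      unfolding hinner_tens[OF subsetD[OF sub e] subsetD[OF sub e']]
      using B e e' by (intro prod.cong refl) (auto simp: orthonormal_basis_def PiE_iff)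
    also have "\<dots> = (if e = e' then 1 else 0)"
    proof (cases "e = e'")
      case False
      then obtain i where "i < n" "e i \<noteq> e' i"
        using PiE_ext[OF e e'] by auto
      then show ?thesis using False by (auto intro!: prod_zero)
    qed simp
    finally show ?thesis .
  qed
  moreover have "tens \<in> PiE {..<n} B \<rightarrow> carrier E"
    using sub tens.closed by (intro Pi_I) auto
  ultimately show "E.orthonormal_on (PiE {..<n} B) tens"
    by (simp add: E.orthonormal_on_def)
qed

end

section \<open>Hilbert-Schmidt operators are summing\<close>

locale HS_op = tensor_space K n H E tens + G: complete_inner_space K G
  for K :: "complex set" and n :: nat and H :: "nat \<Rightarrow> 'a hspace" and E :: "'e hspace"
    and tens :: "(nat \<Rightarrow> 'a) \<Rightarrow> 'e" and G :: "'g hspace" +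
  fixes T :: "(nat \<Rightarrow> 'a) \<Rightarrow> 'g" and B :: "nat \<Rightarrow> 'a set"
  assumes bounded: "bounded_multilinear K n H G T" and bases: "HS_bases K n H G T B"
begin

sublocale T: multilinear_op K n H G T
  using bounded Hi' G.inner_space_axioms by (auto simp: bounded_multilinear_def multilinear_op_def)

abbreviation (input) I where "I \<equiv> \<Pi>\<^sub>E i\<in>{..<n}. B i"

lemma B: "i < n \<Longrightarrow> orthonormal_basis K (H i) (B i)"
  using bases by (simp add: HS_bases_def)

lemma I_tuples: "I \<subseteq> tuples n H"
  by (rule orthonormal_tens(2)) (rule B)

sublocale ext: square_summable_images K E G I tens T
proof
  show "E.orthonormal_on I tens" by (rule orthonormal_tens(1)) (rule B)
  show "T \<in> I \<rightarrow> carrier G" using I_tuples T.closed by (intro Pi_I) auto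
  show "(\<lambda>e. (hnorm G (T e))\<^sup>2) summable_on I" using bases by (simp add: HS_bases_def)
qed

lemma prod_upd:
  assumes "k < n"
  shows "(\<Prod>i<n. hnorm (H i) ((u(k := x)) i)) = (\<Prod>i\<in>{..<n} - {k}. hnorm (H i) (u i)) * hnorm (H k) x"
proof -
  have "(\<Prod>i<n. hnorm (H i) ((u(k := x)) i))
      = hnorm (H k) ((u(k := x)) k) * (\<Prod>i\<in>{..<n} - {k}. hnorm (H i) ((u(k := x)) i))"
    by (rule prod.remove) (use assms in auto)
  also have "(\<Prod>i\<in>{..<n} - {k}. hnorm (H i) ((u(k := x)) i)) = (\<Prod>i\<in>{..<n} - {k}. hnorm (H i) (u i))"
    by (intro prod.cong) auto
  finally show ?thesis by (simp add: mult.commute)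
qed

lemma extension_basis:
  assumes e: "e \<in> I" shows "ext.extension (tens e) = T e"
proof (rule G.eq_if_hinner_eq)
  have et: "e \<in> tuples n H" using e I_tuples by auto
  show "ext.extension (tens e) \<in> carrier G" by (rule ext.extension_closed[OF tens.closed[OF et]])
  show "T e \<in> carrier G" by (rule T.closed[OF et])
  fix w assume w: "w \<in> carrier G"
  have "((\<lambda>e'. hinner E (tens e) (tens e') * hinner G (T e') w) has_sum hinner G (ext.extension (tens e)) w) I"
    by (rule ext.has_sum_extension[OF tens.closed[OF et] w])
  moreover have "((\<lambda>e'. hinner E (tens e) (tens e') * hinner G (T e') w) has_sum hinner G (T e) w) I"
    by (rule has_sum_finite_neutralI[of "{e}"])
       (use e ext.t in \<open>auto simp: E.orthonormal_on_def\<close>)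
  ultimately show "hinner G (ext.extension (tens e)) w = hinner G (T e) w"
    by (rule has_sum_unique)
qed

text \<open>
  Basis vectors are replaced by arbitrary ones in the coordinates below \<open>k\<close>, one at a time. Both sides
  are bounded and linear in coordinate \<open>k\<close> and agree on a basis of \<open>H k\<close> by the induction hypothesis.
\<close>

lemma extension_tens_aux:
  assumes "k \<le> n" "u \<in> tuples n H" "\<And>i. k \<le> i \<Longrightarrow> i < n \<Longrightarrow> u i \<in> B i"
  shows "ext.extension (tens u) = T u"
  using assms
proof (induction k arbitrary: u)
  case 0
  then have "u \<in> I" by (auto simp: tuples_def PiE_iff)
  then show ?case by (rule extension_basis)
next
  case (Suc k)
  then have k: "k < n" and u: "u \<in> tuples n H" by auto
  interpret Hk: complete_inner_space K "H k" by (rule Hi[OF k])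
  interpret et: multilinear_op K n H G "\<lambda>u. ext.extension (tens u)"
    by (rule tens.compose[OF ext.linear_extension])
  obtain C where C: "\<forall>u\<in>tuples n H. hnorm G (T u) \<le> C * (\<Prod>i<n. hnorm (H i) (u i))"
    using bounded by (auto simp: bounded_multilinear_def)
  define P where "P = (\<Prod>i\<in>{..<n} - {k}. hnorm (H i) (u i))"
  have f: "linear_operator K (H k) G (\<lambda>x. ext.extension (tens (u(k := x))))"
    by (rule et.coord[OF u k])
  have g: "linear_operator K (H k) G (\<lambda>x. T (u(k := x)))"
    by (rule T.coord[OF u k])
  have cf: "continuous_map (htop (H k)) (htop G) (\<lambda>x. ext.extension (tens (u(k := x))))"
  proof (rule linear_operator.continuous_if_bounded[OF f])
    fix x assume x: "x \<in> carrier (H k)"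
    show "hnorm G (ext.extension (tens (u(k := x)))) \<le> (sqrt ext.HS_sq * P) * hnorm (H k) x"
      using ext.hnorm_extension_le[OF tens.closed[OF tuples_upd[OF u k x]]]
      unfolding hnorm_tens[OF tuples_upd[OF u k x]] prod_upd[OF k] P_def by (simp only: mult.assoc)
  qed
  have cg: "continuous_map (htop (H k)) (htop G) (\<lambda>x. T (u(k := x)))"
  proof (rule linear_operator.continuous_if_bounded[OF g])
    fix x assume x: "x \<in> carrier (H k)"
    show "hnorm G (T (u(k := x))) \<le> (C * P) * hnorm (H k) x"
      using C[rule_format, OF tuples_upd[OF u k x]]
      unfolding prod_upd[OF k] P_def by (simp only: mult.assoc)
  qed
  have Bk: "B k \<subseteq> carrier (H k)" "htop (H k) closure_of hspan K (H k) (B k) = carrier (H k)"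
    using B[OF k] by (auto simp: orthonormal_basis_def)
  have "ext.extension (tens (u(k := u k))) = T (u(k := u k))"
  proof (rule linear_map_eq_on_dense[OF f cf g cg Bk])
    fix x assume x: "x \<in> B k"
    show "ext.extension (tens (u(k := x))) = T (u(k := x))"
    proof (rule Suc.IH)
      show "u(k := x) \<in> tuples n H" using x Bk by (intro tuples_upd u k) auto
      show "(u(k := x)) i \<in> B i" if "k \<le> i" "i < n" for i
        using that x Suc.prems(3)[of i] by (cases "i = k") auto
    qed (use k in simp)
  qed (rule tuplesD[OF u k])
  then show ?case by simp
qed

lemma extension_tens: "u \<in> tuples n H \<Longrightarrow> ext.extension (tens u) = T u"
  by (rule extension_tens_aux[of n]) auto

lemma T_in_LH: "T \<in> LH K n H E tens G"
proof -
  interpret f: linear_operator K E G ext.extension by (rule ext.linear_extension)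
  have "is_linearization K n H E tens G T ext.extension"
    unfolding is_linearization_def
    using f.linear f.continuous_if_bounded[OF ext.hnorm_extension_le] extension_tens by simp
  then show ?thesis using T.multilinear by (auto simp: LH_def)
qed

lemma extension_diff:
  assumes "u \<in> tuples n H" "v \<in> tuples n H"
  shows "ext.extension (tens u \<ominus>\<^bsub>E\<^esub> tens v) = T u \<ominus>\<^bsub>G\<^esub> T v"
  using linear_operator.minus[OF ext.linear_extension tens.closed[OF assms(1)] tens.closed[OF assms(2)]]
  unfolding extension_tens[OF assms(1)] extension_tens[OF assms(2)] .

lemma
  assumes u: "u \<in> {..<k} \<rightarrow> tuples n H" and v: "v \<in> {..<k} \<rightarrow> tuples n H"
  defines "x \<equiv> \<lambda>i. tens (u i) \<ominus>\<^bsub>E\<^esub> tens (v i)"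
  shows diff_closed: "x \<in> {..<k} \<rightarrow> carrier E"
    and diff_T: "i < k \<Longrightarrow> ext.extension (x i) = T (u i) \<ominus>\<^bsub>G\<^esub> T (v i)"
proof -
  show "x \<in> {..<k} \<rightarrow> carrier E"
    unfolding x_def using u v by (intro Pi_I E.minus_closed tens.closed) auto
  show "i < k \<Longrightarrow> ext.extension (x i) = T (u i) \<ominus>\<^bsub>G\<^esub> T (v i)"
    unfolding x_def using u v by (intro extension_diff) auto
qed

lemma lip_summing_2: "lip_const G 2 T (sqrt ext.HS_sq)"
  unfolding lip_summing_const_iff
proof (intro allI impI)
  fix k :: nat and u v assume u: "u \<in> {..<k} \<rightarrow> tuples n H" and v: "v \<in> {..<k} \<rightarrow> tuples n H"
  note wb = weak_bound_weak_norm[OF _ u v, of 2, simplified]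
  have w: "0 \<le> weak_norm 2 k u v" by (rule weak_norm_nonneg[OF _ u v]) simp
  have "(\<Sum>i<k. (hnorm G (T (u i) \<ominus>\<^bsub>G\<^esub> T (v i)))\<^sup>2) \<le> ext.HS_sq * (weak_norm 2 k u v)\<^sup>2"
    using ext.two_summing_extension[OF wb diff_closed[OF u v]] diff_T[OF u v] by simp
  then have "sqrt (\<Sum>i<k. (hnorm G (T (u i) \<ominus>\<^bsub>G\<^esub> T (v i)))\<^sup>2) \<le> sqrt (ext.HS_sq * (weak_norm 2 k u v)\<^sup>2)"
    by (rule real_sqrt_le_mono)
  also have "\<dots> = sqrt ext.HS_sq * weak_norm 2 k u v"
    using w by (simp add: real_sqrt_mult)
  also have "(\<Sum>i<k. (hnorm G (T (u i) \<ominus>\<^bsub>G\<^esub> T (v i)))\<^sup>2) = (\<Sum>i<k. hnorm G (T (u i) \<ominus>\<^bsub>G\<^esub> T (v i)) powr 2)"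
    using u v by (intro sum.cong refl powr_numeral[symmetric] G.hnorm_nonneg G.minus_closed T.closed) auto
  finally show "(\<Sum>i<k. hnorm G (T (u i) \<ominus>\<^bsub>G\<^esub> T (v i)) powr 2) powr (1 / 2) \<le> sqrt ext.HS_sq * weak_norm 2 k u v"
    by (simp add: powr_half_sqrt sum_nonneg)
qed

lemma lip_summing_1: "lip_const G 1 T ((1 + ext.HS_sq) / khin_lower)"
  unfolding lip_summing_const_iff
proof (intro allI impI)
  fix k :: nat and u v assume u: "u \<in> {..<k} \<rightarrow> tuples n H" and v: "v \<in> {..<k} \<rightarrow> tuples n H"
  note wb = weak_bound_weak_norm[OF _ u v, of 1, simplified]
  have "(\<Sum>i<k. hnorm G (T (u i) \<ominus>\<^bsub>G\<^esub> T (v i))) \<le> (1 + ext.HS_sq) / khin_lower * weak_norm 1 k u v"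
    using ext.one_summing_extension[OF wb diff_closed[OF u v]] diff_T[OF u v] by simp
  moreover have "(\<Sum>i<k. hnorm G (T (u i) \<ominus>\<^bsub>G\<^esub> T (v i))) = (\<Sum>i<k. hnorm G (T (u i) \<ominus>\<^bsub>G\<^esub> T (v i)) powr 1)"
    using u v by (intro sum.cong refl powr_one[symmetric] G.hnorm_nonneg G.minus_closed T.closed) auto
  ultimately show "(\<Sum>i<k. hnorm G (T (u i) \<ominus>\<^bsub>G\<^esub> T (v i)) powr 1) powr (1 / 1) \<le> (1 + ext.HS_sq) / khin_lower * weak_norm 1 k u v"
    by (simp add: sum_nonneg)
qed

end

section \<open>Monotonicity in the exponent\<close>

text \<open>
  Hoelder's inequality with exponents \<open>1 / (1 - \<theta>)\<close> and \<open>1 / \<theta>\<close>, in a form without roots.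
\<close>

lemma sum_powr_interpolation:
  fixes a b :: "'i \<Rightarrow> real"
  assumes a: "\<And>i. i \<in> I \<Longrightarrow> 0 \<le> a i" and b: "\<And>i. i \<in> I \<Longrightarrow> 0 \<le> b i" and I: "finite I"
    and \<theta>: "0 < \<theta>" "\<theta> < 1"
  shows "(\<Sum>i\<in>I. a i powr (1 - \<theta>) * b i powr \<theta>) \<le> sum a I powr (1 - \<theta>) * sum b I powr \<theta>"
proof (cases "sum a I = 0 \<or> sum b I = 0")
  case True
  then have "a i powr (1 - \<theta>) * b i powr \<theta> = 0" if "i \<in> I" for i
    using that I a b sum_nonneg_eq_0_iff[of I a] sum_nonneg_eq_0_iff[of I b] by auto
  then show ?thesis by (simp add: sum.neutral)
next
  case False
  then have A: "sum a I > 0" and B: "sum b I > 0"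
    using sum_nonneg[of I a] sum_nonneg[of I b] a b by fastforce+
  let ?A = "sum a I" and ?B = "sum b I"
  have "a i powr (1 - \<theta>) * b i powr \<theta>
      \<le> ?A powr (1 - \<theta>) * ?B powr \<theta> * ((1 - \<theta>) * (a i / ?A) + \<theta> * (b i / ?B))" if i: "i \<in> I" for i
  proof -
    have "(a i / ?A) powr (1 - \<theta>) * (b i / ?B) powr \<theta> \<le> (1 - \<theta>) * (a i / ?A) + \<theta> * (b i / ?B)"
    proof (cases "a i = 0 \<or> b i = 0")
      case True
      then show ?thesis using a[OF i] b[OF i] A B \<theta> by auto
    next
      case False
      then have "a i / ?A > 0" "b i / ?B > 0" using a[OF i] b[OF i] A B by auto
      then show ?thesis using \<theta> by (intro Youngs_inequality_0) auto
    qed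
    moreover have "(a i / ?A) powr (1 - \<theta>) * (b i / ?B) powr \<theta>
        = a i powr (1 - \<theta>) * b i powr \<theta> / (?A powr (1 - \<theta>) * ?B powr \<theta>)"
      using a[OF i] b[OF i] A B by (simp add: powr_divide)
    ultimately show ?thesis
      using A B by (simp add: divide_le_eq mult.commute)
  qed
  then have "(\<Sum>i\<in>I. a i powr (1 - \<theta>) * b i powr \<theta>)
      \<le> (\<Sum>i\<in>I. ?A powr (1 - \<theta>) * ?B powr \<theta> * ((1 - \<theta>) * (a i / ?A) + \<theta> * (b i / ?B)))"
    by (rule sum_mono)
  also have "\<dots> = ?A powr (1 - \<theta>) * ?B powr \<theta> * ((1 - \<theta>) * (?A / ?A) + \<theta> * (?B / ?B))"
    by (simp add: sum_distrib_left[symmetric] sum.distrib sum_divide_distrib[symmetric])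
  also have "\<dots> = ?A powr (1 - \<theta>) * ?B powr \<theta>" using A B by simp
  finally show ?thesis .
qed

context inner_space
begin

lemma smult_minus:
  assumes "a \<in> K" "x \<in> carrier H" "y \<in> carrier H"
  shows "a \<odot> x \<ominus> a \<odot> y = a \<odot> (x \<ominus> y)"
  by (rule eq_if_hinner_eq)
     (simp_all add: assms hinner_minus_left hinner_smult_left right_diff_distrib)

end

context tensor_space
begin

text \<open>
  The argument for linear operators multiplies the vectors by weights. It carries over to differences
  of elementary tensors, because a weight can be moved into the first coordinate of both tuples.
\<close>

lemma lip_summing_const_mono:
  assumes T: "multilinear_op K n H G T" and p: "1 \<le> p" "p \<le> q" and c: "0 \<le> c"
    and lip: "lip_const G p T c"
  shows "lip_const G q T c"
proof (cases "p = q")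
  case True
  then show ?thesis using lip by simp
next
  case False
  then have pq: "p < q" "0 < p" "0 < q" "1 \<le> q" using p by auto
  interpret T: multilinear_op K n H G T by (rule T)
  interpret G: inner_space K G by (rule T.target)
  have n0: "0 < n" using n_pos by simp
  show ?thesis
    unfolding lip_summing_const_iff
  proof (intro allI impI)
    fix k :: nat and u v assume u: "u \<in> {..<k} \<rightarrow> tuples n H" and v: "v \<in> {..<k} \<rightarrow> tuples n H"
    define t where "t i = hnorm G (T (u i) \<ominus>\<^bsub>G\<^esub> T (v i))" for i
    \<comment> \<open>These weights make \<open>(l i * t i) powr p = t i powr q\<close>.\<close>
    define l where "l i = t i powr ((q - p) / p)" for i
    define u' where "u' i = (u i)(0 := complex_of_real (l i) \<odot>\<^bsub>H 0\<^esub> u i 0)" for i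
    define v' where "v' i = (v i)(0 := complex_of_real (l i) \<odot>\<^bsub>H 0\<^esub> v i 0)" for i
    define S where "S = (\<Sum>i<k. t i powr q)"
    define W where "W = weak_norm q k u v"
    have ui: "u i \<in> tuples n H" and vi: "v i \<in> tuples n H" if "i < k" for i
      using u v that by auto
    have l0: "0 \<le> l i" for i by (simp add: l_def)
    have t0: "0 \<le> t i" if "i < k" for i
      unfolding t_def by (intro G.hnorm_nonneg G.minus_closed T.closed ui vi that)
    have upd: "w(0 := complex_of_real r \<odot>\<^bsub>H 0\<^esub> w 0) \<in> tuples n H" if "w \<in> tuples n H" for w r
      by (rule tuples_upd[OF that n0 inner_space.smult_closed[OF Hi'[OF n0] E.K_simps(3) tuplesD[OF that n0]]])
    have u': "u' \<in> {..<k} \<rightarrow> tuples n H" and v': "v' \<in> {..<k} \<rightarrow> tuples n H"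
      unfolding u'_def v'_def using upd ui vi by simp_all
    have W0: "0 \<le> W" unfolding W_def by (rule weak_norm_nonneg[OF pq(4) u v])
    have S0: "0 \<le> S" unfolding S_def by (intro sum_nonneg) simp
    have Tl: "hnorm G (T (u' i) \<ominus>\<^bsub>G\<^esub> T (v' i)) powr p = t i powr q" if i: "i < k" for i
    proof -
      have "T (u' i) \<ominus>\<^bsub>G\<^esub> T (v' i) = complex_of_real (l i) \<odot>\<^bsub>G\<^esub> (T (u i) \<ominus>\<^bsub>G\<^esub> T (v i))"
        unfolding u'_def v'_def T.smult[OF ui[OF i] n0 G.K_simps(3)] T.smult[OF vi[OF i] n0 G.K_simps(3)]
        by (intro G.smult_minus G.K_simps T.closed ui vi i)
      then have "hnorm G (T (u' i) \<ominus>\<^bsub>G\<^esub> T (v' i)) = l i * t i"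
        unfolding t_def using l0
        by (simp add: G.hnorm_smult[OF G.K_simps(3) G.minus_closed[OF T.closed[OF ui[OF i]] T.closed[OF vi[OF i]]]])
      moreover have "(l i * t i) powr p = t i powr q"
      proof (cases "t i = 0")
        case False
        have "(l i * t i) powr p = t i powr (q - p) * t i powr p"
          using t0[OF i] l0[of i] pq by (simp add: powr_mult l_def powr_powr)
        also have "\<dots> = t i powr q" by (simp add: powr_add[symmetric])
        finally show ?thesis .
      qed (use pq in simp)
      ultimately show ?thesis by simp
    qed
    have weak: "weak_norm p k u' v' \<le> S powr (1 / p - 1 / q) * W"
    proof (rule weak_norm_least)
      fix \<phi> assume phi: "\<phi> \<in> unit_ball"
      interpret phi: multilinear_op K n H "scalar_space K" \<phi> by (rule LH_ball_multilinear[OF phi])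
      define d where "d i = cmod (\<phi> (u i) - \<phi> (v i))" for i
      have "cmod (\<phi> (u' i) - \<phi> (v' i)) powr p = (t i powr q) powr (1 - p / q) * (d i powr q) powr (p / q)"
        if i: "i < k" for i
      proof -
        have "\<phi> (u' i) - \<phi> (v' i) = complex_of_real (l i) * (\<phi> (u i) - \<phi> (v i))"
          unfolding u'_def v'_def
            phi.smult[OF ui[OF i] n0 E.K_simps(3)] phi.smult[OF vi[OF i] n0 E.K_simps(3)]
          by (simp add: algebra_simps)
        then have "cmod (\<phi> (u' i) - \<phi> (v' i)) = l i * d i"
          using l0[of i] by (simp add: norm_mult d_def)
        moreover have "q * (1 - p / q) = q - p" using pq by (simp add: field_simps)
        ultimately show ?thesis
          using pq l0[of i] by (simp add: powr_mult l_def powr_powr d_def)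
      qed
      then have "(\<Sum>i<k. cmod (\<phi> (u' i) - \<phi> (v' i)) powr p)
          = (\<Sum>i<k. (t i powr q) powr (1 - p / q) * (d i powr q) powr (p / q))"
        by (intro sum.cong) auto
      also have "\<dots> \<le> S powr (1 - p / q) * (\<Sum>i<k. d i powr q) powr (p / q)"
        unfolding S_def using pq by (intro sum_powr_interpolation) auto
      finally have "(\<Sum>i<k. cmod (\<phi> (u' i) - \<phi> (v' i)) powr p) powr (1 / p)
          \<le> (S powr (1 - p / q) * (\<Sum>i<k. d i powr q) powr (p / q)) powr (1 / p)"
        using pq by (intro powr_mono2) (auto intro: sum_nonneg)
      also have "\<dots> = S powr (1 / p - 1 / q) * (\<Sum>i<k. d i powr q) powr (1 / q)"
      proof -
        have "(1 - p / q) * (1 / p) = 1 / p - 1 / q" "p / q * (1 / p) = 1 / q"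
          using pq by (simp_all add: field_simps)
        then show ?thesis by (simp add: powr_mult powr_powr)
      qed
      also have "\<dots> \<le> S powr (1 / p - 1 / q) * W"
        unfolding W_def d_def by (intro mult_left_mono weak_norm_upper[OF pq(4) u v phi]) simp
      finally show "(\<Sum>i<k. cmod (\<phi> (u' i) - \<phi> (v' i)) powr p) powr (1 / p) \<le> S powr (1 / p - 1 / q) * W" .
    qed
    have "(\<Sum>i<k. hnorm G (T (u' i) \<ominus>\<^bsub>G\<^esub> T (v' i)) powr p) = S"
      unfolding S_def using Tl by (intro sum.cong) auto
    then have "S powr (1 / p) \<le> c * weak_norm p k u' v'"
      using lip[unfolded lip_summing_const_iff, rule_format, OF u' v'] by simp
    also have "\<dots> \<le> c * (S powr (1 / p - 1 / q) * W)"
      by (rule mult_left_mono[OF weak c])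
    finally have main: "S powr (1 / p) \<le> c * (S powr (1 / p - 1 / q) * W)" .
    show "(\<Sum>i<k. hnorm G (T (u i) \<ominus>\<^bsub>G\<^esub> T (v i)) powr q) powr (1 / q) \<le> c * weak_norm q k u v"
    proof (cases "S = 0")
      case True
      then show ?thesis using c W0 pq by (simp add: S_def t_def W_def)
    next
      case False
      then have Sp: "S powr (1 / p - 1 / q) > 0" using S0 by simp
      have "S powr (1 / p) = S powr (1 / p - 1 / q) * S powr (1 / q)"
        by (simp add: powr_add[symmetric])
      then have "S powr (1 / p - 1 / q) * S powr (1 / q) \<le> S powr (1 / p - 1 / q) * (c * W)"
        using main by (simp add: mult_ac)
      then have "S powr (1 / q) \<le> c * W" using Sp by simp
      then show ?thesis by (simp add: S_def t_def W_def)
    qed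
  qed
qed

text \<open>
  Bessel's inequality for a functional \<open>f\<close>, without representing it by a vector: evaluate \<open>f\<close> at the
  combination \<open>z\<close> of the orthonormal tensors with coefficients \<open>cnj (f (tens e))\<close>.
\<close>

lemma LH_ball_orthonormal:
  assumes phi: "\<phi> \<in> unit_ball" and I: "finite I" "I \<subseteq> tuples n H" "E.orthonormal_on I tens"
  shows "(\<Sum>e\<in>I. (cmod (\<phi> e))\<^sup>2) \<le> 1"
proof -
  obtain f where f: "linear_operator K E (scalar_space K) f"
    "\<forall>z\<in>carrier E. cmod (f z) \<le> hnorm E z" "\<forall>u\<in>tuples n H. \<phi> u = f (tens u)"
    by (rule LH_ballD[OF phi])
  interpret f: linear_operator K E "scalar_space K" f by (rule f)
  define S where "S = (\<Sum>e\<in>I. (cmod (\<phi> e))\<^sup>2)"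
  have S0: "0 \<le> S" unfolding S_def by (intro sum_nonneg) simp
  have tc: "tens \<in> I \<rightarrow> carrier E" using I tens.closed by auto
  have fK: "f (tens e) \<in> K" if "e \<in> I" for e
    using f.closed[of "tens e"] tc that by auto
  then have a: "(\<lambda>e. cnj (f (tens e))) \<in> I \<rightarrow> K" by (intro Pi_I E.K_simps)
  define z where "z = (\<Oplus>\<^bsub>E\<^esub>e\<in>I. cnj (f (tens e)) \<odot>\<^bsub>E\<^esub> tens e)"
  have z: "z \<in> carrier E"
    unfolding z_def using a tc by (intro E.finsum_closed Pi_I E.smult_closed) auto
  have phi_f: "\<phi> e = f (tens e)" if "e \<in> I" for e using f(3) I that by auto
  have "(hnorm E z)\<^sup>2 = S"
    unfolding z_def S_def E.hnorm_lincomb[OF I(3,1) a] by (intro sum.cong) (auto simp: phi_f)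
  moreover have "f z = complex_of_real S"
  proof -
    have "f z = finsum (scalar_space K) (\<lambda>e. cnj (f (tens e)) * f (tens e)) I"
      unfolding z_def f.finsum[OF I(1) a tc] by simp
    also have "\<dots> = (\<Sum>e\<in>I. cnj (f (tens e)) * f (tens e))"
      by (intro finsum_scalar_space K_cases I Pi_I E.K_simps fK)
    also have "\<dots> = complex_of_real S"
      unfolding S_def of_real_sum
      by (intro sum.cong refl) (simp add: phi_f complex_norm_square mult.commute del: of_real_power)
    finally show ?thesis .
  qed
  ultimately have "S\<^sup>2 \<le> S"
    using f(2)[rule_format, OF z] S0 E.hnorm_nonneg[OF z]
    by (metis abs_of_nonneg norm_of_real power_mono)
  then show ?thesis
    unfolding S_def[symmetric] using S0 by (cases "S = 0") (auto simp: power2_eq_square)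
qed

end

section \<open>Moments of multilinear forms on random sign vectors\<close>

definition multi_sign_avg ::
    "(nat \<Rightarrow> 'b set) \<Rightarrow> nat \<Rightarrow> ((nat \<Rightarrow> 'b \<Rightarrow> real) \<Rightarrow> real) \<Rightarrow> real" where
  "multi_sign_avg F k g =
     (\<Sum>\<epsilon>\<in>PiE {..<k} (\<lambda>i. PiE (F i) (\<lambda>_. {-1, 1})). g \<epsilon>) / (\<Prod>i<k. 2 ^ card (F i))"

lemma multi_sign_avg_0: "multi_sign_avg F 0 g = g (\<lambda>_. undefined)"
  by (simp add: multi_sign_avg_def)

lemma multi_sign_avg_Suc:
  "multi_sign_avg F (Suc k) g = multi_sign_avg F k (\<lambda>\<epsilon>. sign_avg (F k) (\<lambda>\<delta>. g (\<epsilon>(k := \<delta>))))"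
proof -
  let ?P = "PiE {..<k} (\<lambda>i. PiE (F i) (\<lambda>_. {-1, 1 :: real}))"
    and ?Q = "PiE (F k) (\<lambda>_. {-1, 1 :: real})"
  have "(\<Sum>\<epsilon>\<in>PiE {..<Suc k} (\<lambda>i. PiE (F i) (\<lambda>_. {-1, 1})). g \<epsilon>) = (\<Sum>(\<delta>, \<epsilon>)\<in>?Q \<times> ?P. g (\<epsilon>(k := \<delta>)))"
    unfolding lessThan_Suc PiE_insert_eq
    by (subst sum.reindex[OF inj_combinator]) (simp_all add: case_prod_beta' comp_def)
  also have "\<dots> = (\<Sum>\<epsilon>\<in>?P. \<Sum>\<delta>\<in>?Q. g (\<epsilon>(k := \<delta>)))"
    by (subst sum.swap) (simp add: sum.cartesian_product)
  finally show ?thesis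
    by (simp add: multi_sign_avg_def sign_avg_def sum_divide_distrib[symmetric])
qed

lemma multi_sign_avg_mono:
  "(\<And>\<epsilon>. g \<epsilon> \<le> h \<epsilon>) \<Longrightarrow> multi_sign_avg F k g \<le> multi_sign_avg F k h"
  unfolding multi_sign_avg_def by (intro divide_right_mono sum_mono prod_nonneg) auto

lemma multi_sign_avg_cmult: "multi_sign_avg F k (\<lambda>\<epsilon>. c * g \<epsilon>) = c * multi_sign_avg F k g"
  by (simp add: multi_sign_avg_def sum_distrib_left)

lemma multi_sign_avg_add:
  "multi_sign_avg F k (\<lambda>\<epsilon>. g \<epsilon> + h \<epsilon>) = multi_sign_avg F k g + multi_sign_avg F k h"
  by (simp add: multi_sign_avg_def sum.distrib add_divide_distrib)

lemma multi_sign_avg_sum: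
  "multi_sign_avg F k (\<lambda>\<epsilon>. \<Sum>l\<in>L. g l \<epsilon>) = (\<Sum>l\<in>L. multi_sign_avg F k (g l))"
  unfolding multi_sign_avg_def by (subst sum.swap) (simp add: sum_divide_distrib)

lemma multi_sign_avg_const:
  "(\<And>i. i < k \<Longrightarrow> finite (F i)) \<Longrightarrow> multi_sign_avg F k (\<lambda>_. c) = c"
  by (induction k) (simp_all add: multi_sign_avg_0 multi_sign_avg_Suc sign_avg_const)

locale sign_vectors = tensor_space +
  fixes F :: "nat \<Rightarrow> 'a set"
  assumes finite_F: "\<And>i. i < n \<Longrightarrow> finite (F i)" and F_carrier: "\<And>i. i < n \<Longrightarrow> F i \<subseteq> carrier (H i)"
begin

definition sign_vec :: "nat \<Rightarrow> ('a \<Rightarrow> real) \<Rightarrow> 'a" where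
  "sign_vec i \<delta> = (\<Oplus>\<^bsub>H i\<^esub>b\<in>F i. complex_of_real (\<delta> b) \<odot>\<^bsub>H i\<^esub> b)"

definition mixed :: "nat \<Rightarrow> (nat \<Rightarrow> 'a \<Rightarrow> real) \<Rightarrow> (nat \<Rightarrow> 'a) \<Rightarrow> (nat \<Rightarrow> 'a)" where
  "mixed k \<epsilon> e = (\<lambda>i. if i < k then sign_vec i (\<epsilon> i) else e i)"

text \<open>
  Signs are averaged in the coordinates below \<open>k\<close>, while squares are summed over the basis vectors in
  the others. This interpolates between the sum of all squared coefficients (\<open>k = 0\<close>) and the squared
  modulus of the random multilinear form (\<open>k = n\<close>).
\<close>

definition square_sum :: "((nat \<Rightarrow> 'a) \<Rightarrow> complex) \<Rightarrow> nat \<Rightarrow> (nat \<Rightarrow> 'a \<Rightarrow> real) \<Rightarrow> real" where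
  "square_sum \<phi> k \<epsilon> = (\<Sum>e\<in>PiE {k..<n} F. (cmod (\<phi> (mixed k \<epsilon> e)))\<^sup>2)"

lemma sign_vec_closed: "i < n \<Longrightarrow> sign_vec i \<delta> \<in> carrier (H i)"
  unfolding sign_vec_def using F_carrier
  by (intro inner_space.finsum_closed[OF Hi'] Pi_I inner_space.smult_closed[OF Hi'] E.K_simps) auto

lemma mixed_tuples:
  assumes "k \<le> n" "e \<in> PiE {k..<n} F" shows "mixed k \<epsilon> e \<in> tuples n H"
  unfolding tuples_def mixed_def
proof (intro PiE_I)
  fix i assume "i \<in> {..<n}"
  then show "(if i < k then sign_vec i (\<epsilon> i) else e i) \<in> carrier (H i)"
    using assms(2) F_carrier[of i] sign_vec_closed[of i] by (auto simp: PiE_iff)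
next
  fix i assume "i \<notin> {..<n}"
  then show "(if i < k then sign_vec i (\<epsilon> i) else e i) = undefined"
    using assms by (auto simp: PiE_iff extensional_def)
qed

lemma PiE_upto_Suc: "k < n \<Longrightarrow> PiE {k..<n} F = PiE (insert k {Suc k..<n}) F"
  by (rule arg_cong[where f = "\<lambda>S. PiE S F"]) auto

context
  fixes \<phi> :: "(nat \<Rightarrow> 'a) \<Rightarrow> complex"
  assumes phi: "multilinear_op K n H (scalar_space K) \<phi>"
begin

text \<open>
  Linearity in coordinate \<open>k\<close> exhibits the form as a random signed sum of vectors that are indexed by the
  choices \<open>j\<close> of basis vectors in the later coordinates.
\<close>

lemma phi_sign_vec:
  assumes k: "k < n" and j: "j \<in> PiE {Suc k..<n} F"
  shows "\<phi> (mixed (Suc k) (\<epsilon>(k := \<delta>)) j) = rad_sum (F k) (\<lambda>b j. \<phi> (mixed k \<epsilon> (j(k := b)))) \<delta> j"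
proof -
  define u where "u = mixed (Suc k) (\<epsilon>(k := \<delta>)) j"
  have u: "u \<in> tuples n H" unfolding u_def by (rule mixed_tuples) (use k j in auto)
  interpret c: linear_operator K "H k" "scalar_space K" "\<lambda>x. \<phi> (u(k := x))"
    by (rule multilinear_op.coord[OF phi u k])
  have Fk: "(\<lambda>b. b) \<in> F k \<rightarrow> carrier (H k)" using F_carrier[OF k] by auto
  have upd: "u(k := b) = mixed k \<epsilon> (j(k := b))" for b
    unfolding u_def mixed_def by (auto simp: fun_eq_iff)
  have "u(k := sign_vec k \<delta>) = u"
    unfolding u_def mixed_def by (auto simp: fun_eq_iff)
  then have "\<phi> u = \<phi> (u(k := sign_vec k \<delta>))" by simp
  also have "\<dots> = finsum (scalar_space K) (\<lambda>b. complex_of_real (\<delta> b) * \<phi> (u(k := b))) (F k)"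
    unfolding sign_vec_def
    using c.finsum[OF finite_F[OF k] _ Fk, of "\<lambda>b. complex_of_real (\<delta> b)"] by simp
  also have "\<dots> = (\<Sum>b\<in>F k. complex_of_real (\<delta> b) * \<phi> (u(k := b)))"
    using c.closed Fk by (intro finsum_scalar_space K_cases finite_F k Pi_I E.K_simps) auto
  finally show ?thesis unfolding rad_sum_def u_def[symmetric] upd .
qed

lemma square_sum_Suc:
  assumes k: "k < n"
  shows "square_sum \<phi> (Suc k) (\<epsilon>(k := \<delta>))
    = (\<Sum>j\<in>PiE {Suc k..<n} F. (cmod (rad_sum (F k) (\<lambda>b j. \<phi> (mixed k \<epsilon> (j(k := b)))) \<delta> j))\<^sup>2)"
  unfolding square_sum_def by (intro sum.cong refl) (simp add: phi_sign_vec[OF k])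

lemma square_sum_split:
  assumes k: "k < n"
  shows "square_sum \<phi> k \<epsilon> = (\<Sum>b\<in>F k. \<Sum>j\<in>PiE {Suc k..<n} F. (cmod (\<phi> (mixed k \<epsilon> (j(k := b)))))\<^sup>2)"
proof -
  have "square_sum \<phi> k \<epsilon> = (\<Sum>(b, j)\<in>F k \<times> PiE {Suc k..<n} F. (cmod (\<phi> (mixed k \<epsilon> (j(k := b)))))\<^sup>2)"
    unfolding square_sum_def PiE_upto_Suc[OF k] PiE_insert_eq
    by (subst sum.reindex[OF inj_combinator]) (simp_all add: case_prod_beta' comp_def)
  then show ?thesis by (simp add: sum.cartesian_product)
qed

lemma square_sum_0: "square_sum \<phi> 0 \<epsilon> = (\<Sum>e\<in>PiE {..<n} F. (cmod (\<phi> e))\<^sup>2)"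
  by (simp add: square_sum_def mixed_def atLeast0LessThan)

lemma square_sum_n: "square_sum \<phi> n \<epsilon> = (cmod (\<phi> (mixed n \<epsilon> (\<lambda>_. undefined))))\<^sup>2"
  by (simp add: square_sum_def)

lemma chaos_second_moment:
  "multi_sign_avg F n (\<lambda>\<epsilon>. (cmod (\<phi> (mixed n \<epsilon> (\<lambda>_. undefined))))\<^sup>2) = (\<Sum>e\<in>PiE {..<n} F. (cmod (\<phi> e))\<^sup>2)"
proof -
  have "k \<le> n \<Longrightarrow> multi_sign_avg F k (square_sum \<phi> k) = (\<Sum>e\<in>PiE {..<n} F. (cmod (\<phi> e))\<^sup>2)" for k
  proof (induction k)
    case 0
    then show ?case by (simp add: multi_sign_avg_0 square_sum_0)
  next
    case (Suc k)
    then have k: "k < n" by simp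
    have "sign_avg (F k) (\<lambda>\<delta>. square_sum \<phi> (Suc k) (\<epsilon>(k := \<delta>))) = square_sum \<phi> k \<epsilon>" for \<epsilon>
      unfolding square_sum_Suc[OF k] square_sum_split[OF k] by (rule rad_sum_second_moment[OF finite_F[OF k]])
    then show ?case using Suc by (simp add: multi_sign_avg_Suc)
  qed
  from this[of n] show ?thesis by (simp add: square_sum_n[abs_def])
qed

text \<open>
  Each coordinate in turn costs one application of the vector-valued Khintchine inequality, whence the
  \<open>n\<close>-th power of the constant.
\<close>

lemma chaos_moment:
  assumes q: "0 < q"
  shows "multi_sign_avg F n (\<lambda>\<epsilon>. cmod (\<phi> (mixed n \<epsilon> (\<lambda>_. undefined))) powr q)
    \<le> khin_upper q ^ n * (\<Sum>e\<in>PiE {..<n} F. (cmod (\<phi> e))\<^sup>2) powr (q / 2)"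
proof -
  have "k \<le> n \<Longrightarrow> multi_sign_avg F k (\<lambda>\<epsilon>. square_sum \<phi> k \<epsilon> powr (q / 2))
      \<le> khin_upper q ^ k * (\<Sum>e\<in>PiE {..<n} F. (cmod (\<phi> e))\<^sup>2) powr (q / 2)" for k
  proof (induction k)
    case 0
    then show ?case by (simp add: multi_sign_avg_0 square_sum_0)
  next
    case (Suc k)
    then have k: "k < n" by simp
    have "multi_sign_avg F (Suc k) (\<lambda>\<epsilon>. square_sum \<phi> (Suc k) \<epsilon> powr (q / 2))
        \<le> multi_sign_avg F k (\<lambda>\<epsilon>. khin_upper q * square_sum \<phi> k \<epsilon> powr (q / 2))"
      unfolding multi_sign_avg_Suc square_sum_Suc[OF k] square_sum_split[OF k]
      by (intro multi_sign_avg_mono vector_Khintchine finite_F k q)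
    also have "\<dots> \<le> khin_upper q * (khin_upper q ^ k * (\<Sum>e\<in>PiE {..<n} F. (cmod (\<phi> e))\<^sup>2) powr (q / 2))"
      unfolding multi_sign_avg_cmult
      using Suc khin_upper_pos[of q] by (intro mult_left_mono) auto
    finally show ?case by (simp add: mult.assoc)
  qed
  from this[of n] show ?thesis
    by (simp add: square_sum_n[abs_def] sqrt_powr[symmetric])
qed

end

end


section \<open>Summing operators are Hilbert-Schmidt\<close>

context tensor_space
begin

definition zero_tuple :: "nat \<Rightarrow> 'a" where
  "zero_tuple = (\<lambda>i\<in>{..<n}. \<zero>\<^bsub>H i\<^esub>)"

lemma zero_tuple: "zero_tuple \<in> tuples n H"
  unfolding zero_tuple_def tuples_def by (intro restrict_PiE_iff[THEN iffD2] ballI inner_space.zero_closed[OF Hi']) simp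

lemma multilinear_zero_tuple:
  assumes "multilinear_op K n H G T" shows "T zero_tuple = \<zero>\<^bsub>G\<^esub>"
  by (rule multilinear_op.zero[OF assms zero_tuple, of 0]) (use n_pos in \<open>simp_all add: zero_tuple_def\<close>)

text \<open>
  Comparison with the tuple of zero vectors replaces differences of values by values, and an arbitrary
  finite index set replaces an initial segment of the natural numbers.
\<close>

lemma lip_summing_finite_family:
  assumes T: "multilinear_op K n H G T" and p: "1 \<le> p" and c: "0 \<le> c" and M: "0 \<le> M"
    and lip: "lip_const G p T c"
    and \<Omega>: "finite \<Omega>" and U: "\<And>\<omega>. \<omega> \<in> \<Omega> \<Longrightarrow> U \<omega> \<in> tuples n H"
    and weak: "\<And>\<phi>. \<phi> \<in> unit_ball \<Longrightarrow> (\<Sum>\<omega>\<in>\<Omega>. cmod (\<phi> (U \<omega>)) powr p) \<le> M"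
  shows "(\<Sum>\<omega>\<in>\<Omega>. hnorm G (T (U \<omega>)) powr p) \<le> c powr p * M"
proof -
  interpret T: multilinear_op K n H G T by (rule T)
  interpret G: inner_space K G by (rule T.target)
  obtain h where h: "bij_betw h {..<card \<Omega>} \<Omega>"
    using ex_bij_betw_nat_finite[OF \<Omega>] by (auto simp: atLeast0LessThan)
  have hU: "U (h i) \<in> tuples n H" if "i < card \<Omega>" for i
    using bij_betwE[OF h] that U by auto
  have "weak_norm p (card \<Omega>) (\<lambda>i. U (h i)) (\<lambda>_. zero_tuple) \<le> M powr (1 / p)"
  proof (rule weak_norm_least)
    fix \<phi> assume phi: "\<phi> \<in> unit_ball"
    have "\<phi> zero_tuple = 0"
      using multilinear_zero_tuple[OF LH_ball_multilinear[OF phi]] by simp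
    then have "(\<Sum>i<card \<Omega>. cmod (\<phi> (U (h i)) - \<phi> zero_tuple) powr p) = (\<Sum>\<omega>\<in>\<Omega>. cmod (\<phi> (U \<omega>)) powr p)"
      using sum.reindex_bij_betw[OF h, of "\<lambda>\<omega>. cmod (\<phi> (U \<omega>)) powr p"] by simp
    then show "(\<Sum>i<card \<Omega>. cmod (\<phi> (U (h i)) - \<phi> zero_tuple) powr p) powr (1 / p) \<le> M powr (1 / p)"
      using weak[OF phi] p by (intro powr_mono2) (auto intro: sum_nonneg)
  qed
  then have "c * weak_norm p (card \<Omega>) (\<lambda>i. U (h i)) (\<lambda>_. zero_tuple) \<le> c * M powr (1 / p)"
    by (rule mult_left_mono[OF _ c])
  moreover have "(\<Sum>i<card \<Omega>. hnorm G (T (U (h i)) \<ominus>\<^bsub>G\<^esub> T zero_tuple) powr p) powr (1 / p)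
      \<le> c * weak_norm p (card \<Omega>) (\<lambda>i. U (h i)) (\<lambda>_. zero_tuple)"
    using lip[unfolded lip_summing_const_iff] hU zero_tuple by auto
  moreover have "(\<Sum>i<card \<Omega>. hnorm G (T (U (h i)) \<ominus>\<^bsub>G\<^esub> T zero_tuple) powr p)
      = (\<Sum>i<card \<Omega>. hnorm G (T (U (h i))) powr p)"
    unfolding multilinear_zero_tuple[OF T]
    by (intro sum.cong refl) (simp add: G.minus_zero[OF T.closed[OF hU]])
  moreover have "\<dots> = (\<Sum>\<omega>\<in>\<Omega>. hnorm G (T (U \<omega>)) powr p)"
    by (rule sum.reindex_bij_betw[OF h])
  ultimately have "(\<Sum>\<omega>\<in>\<Omega>. hnorm G (T (U \<omega>)) powr p) powr (1 / p) \<le> c * M powr (1 / p)"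
    by simp
  then have "((\<Sum>\<omega>\<in>\<Omega>. hnorm G (T (U \<omega>)) powr p) powr (1 / p)) powr p \<le> (c * M powr (1 / p)) powr p"
    using p by (intro powr_mono2) auto
  then show ?thesis
    using p c M by (simp add: powr_powr powr_mult sum_nonneg)
qed

text \<open>
  Elementary tensors of basis vectors are orthonormal, so that their weak \<open>\<ell>\<^sub>2\<close> norm is at most \<open>1\<close>.
\<close>

lemma two_summing_basis_sum_le:
  assumes T: "multilinear_op K n H G T" and c: "0 \<le> c"
    and lip: "lip_const G 2 T c"
    and B: "\<And>i. i < n \<Longrightarrow> orthonormal_basis K (H i) (B i)"
    and I: "finite I" "I \<subseteq> PiE {..<n} B"
  shows "(\<Sum>e\<in>I. (hnorm G (T e))\<^sup>2) \<le> c\<^sup>2"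
proof -
  interpret T: multilinear_op K n H G T by (rule T)
  interpret G: inner_space K G by (rule T.target)
  have It: "I \<subseteq> tuples n H" using orthonormal_tens(2)[OF B] I(2) by blast
  have ort: "E.orthonormal_on I tens"
    by (rule E.orthonormal_on_subset[OF orthonormal_tens(1)[OF B] I(2)])
  have "(\<Sum>e\<in>I. hnorm G (T e) powr 2) \<le> c powr 2 * 1"
  proof (rule lip_summing_finite_family[OF T _ c _ lip I(1)])
    show "e \<in> tuples n H" if "e \<in> I" for e using It that by auto
    show "(\<Sum>e\<in>I. cmod (\<phi> e) powr 2) \<le> 1" if "\<phi> \<in> unit_ball" for \<phi>
      using LH_ball_orthonormal[OF that I(1) It ort] by simp
  qed simp_all
  moreover have "(\<Sum>e\<in>I. hnorm G (T e) powr 2) = (\<Sum>e\<in>I. (hnorm G (T e))\<^sup>2)"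
    by (intro sum.cong refl powr_numeral G.hnorm_nonneg T.closed) (use It in auto)
  ultimately show ?thesis using c by simp
qed

end

context sign_vectors
begin

text \<open>
  For \<open>q > 2\<close> single basis tensors are too weak a test, and random sign vectors take their place: their
  values have the sum of all \<open>\<parallel>T e\<parallel>\<^sup>2\<close> as second moment, while the moment of order \<open>q\<close> of a form in the
  unit ball is bounded independently of the finite sets \<open>F i\<close>. The second moment in \<open>G\<close> is reduced to
  scalar forms by a finite Parseval identity. Since finiteness is all that matters, \<open>x\<^sup>2 \<le> 1 + x\<^sup>q\<close>
  takes the place of Jensen's inequality.
\<close>

lemma summing_basis_sum_le:
  assumes T: "multilinear_op K n H G T" and q: "2 \<le> q" and c: "0 \<le> c"
    and lip: "lip_const G q T c"
    and B: "\<And>i. i < n \<Longrightarrow> orthonormal_basis K (H i) (B i)" and FB: "\<And>i. i < n \<Longrightarrow> F i \<subseteq> B i"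
  shows "(\<Sum>e\<in>PiE {..<n} F. (hnorm G (T e))\<^sup>2) \<le> 1 + c powr q * khin_upper q ^ n"
proof -
  interpret T: multilinear_op K n H G T by (rule T)
  interpret G: inner_space K G by (rule T.target)
  define I where "I = PiE {..<n} F"
  define \<Omega> where "\<Omega> = PiE {..<n} (\<lambda>i. PiE (F i) (\<lambda>_. {-1, 1 :: real}))"
  define D :: real where "D = (\<Prod>i<n. 2 ^ card (F i))"
  define U where "U \<epsilon> = mixed n \<epsilon> (\<lambda>_. undefined)" for \<epsilon>
  have fI: "finite I" unfolding I_def using finite_F by (intro finite_PiE) auto
  have IB: "I \<subseteq> PiE {..<n} B" unfolding I_def using FB by (intro PiE_mono) auto
  have It: "I \<subseteq> tuples n H" using orthonormal_tens(2)[OF B] IB by blast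
  have ort: "E.orthonormal_on I tens"
    by (rule E.orthonormal_on_subset[OF orthonormal_tens(1)[OF B] IB])
  have f\<Omega>: "finite \<Omega>" unfolding \<Omega>_def using finite_F by (intro finite_PiE) auto
  have D: "D > 0" unfolding D_def by (intro prod_pos) auto
  have Ut: "U \<epsilon> \<in> tuples n H" for \<epsilon> unfolding U_def by (rule mixed_tuples) auto
  have sum_avg: "(\<Sum>\<epsilon>\<in>\<Omega>. g \<epsilon>) = D * multi_sign_avg F n g" for g
    using D by (simp add: multi_sign_avg_def \<Omega>_def D_def)
  have C0: "0 \<le> khin_upper q ^ n" using khin_upper_pos[of q] by simp
  have "(\<Sum>\<epsilon>\<in>\<Omega>. hnorm G (T (U \<epsilon>)) powr q) \<le> c powr q * (D * khin_upper q ^ n)"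
  proof (rule lip_summing_finite_family[OF T _ c _ lip f\<Omega> Ut])
    fix \<phi> assume phi: "\<phi> \<in> unit_ball"
    have "multi_sign_avg F n (\<lambda>\<epsilon>. cmod (\<phi> (U \<epsilon>)) powr q)
        \<le> khin_upper q ^ n * (\<Sum>e\<in>I. (cmod (\<phi> e))\<^sup>2) powr (q / 2)"
      unfolding U_def I_def using q by (intro chaos_moment LH_ball_multilinear phi) simp
    also have "\<dots> \<le> khin_upper q ^ n * 1"
      using LH_ball_orthonormal[OF phi fI It ort] q C0 sum_nonneg[of I "\<lambda>e. (cmod (\<phi> e))\<^sup>2"]
      by (intro mult_left_mono powr_le1) simp_all
    finally show "(\<Sum>\<epsilon>\<in>\<Omega>. cmod (\<phi> (U \<epsilon>)) powr q) \<le> D * khin_upper q ^ n"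
      unfolding sum_avg using D by simp
  qed (use q D C0 in auto)
  then have upper: "multi_sign_avg F n (\<lambda>\<epsilon>. hnorm G (T (U \<epsilon>)) powr q) \<le> c powr q * khin_upper q ^ n"
    unfolding sum_avg using D by (simp add: mult.left_commute)
  have "T ` I \<subseteq> carrier G" using It T.closed by auto
  from G.finite_orthonormal_Parseval[OF finite_imageI[OF fI] this]
  obtain L where L: "finite L" "G.orthonormal_on L (\<lambda>g. g)"
    and P: "\<forall>y\<in>T ` I. (hnorm G y)\<^sup>2 = (\<Sum>g\<in>L. (cmod (hinner G y g))\<^sup>2)"
    by blast
  have Lc: "g \<in> L \<Longrightarrow> g \<in> carrier G" for g using L by (auto simp: G.orthonormal_on_def)
  have phi: "multilinear_op K n H (scalar_space K) (\<lambda>u. hinner G (T u) g)" if g: "g \<in> L" for g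
  proof (rule T.compose[where f = "\<lambda>y. hinner G y g"])
    show "linear_operator K G (scalar_space K) (\<lambda>y. hinner G y g)"
    proof
      show "linear_map K G (scalar_space K) (\<lambda>y. hinner G y g)"
        unfolding linear_map_def
        by (auto simp: G.hinner_lin[OF _ _ _ Lc[OF g]] intro!: G.hinner_K Lc[OF g])
    qed
  qed
  have "(\<Sum>e\<in>I. (hnorm G (T e))\<^sup>2) = (\<Sum>e\<in>I. \<Sum>g\<in>L. (cmod (hinner G (T e) g))\<^sup>2)"
    using P by (intro sum.cong) auto
  also have "\<dots> = (\<Sum>g\<in>L. \<Sum>e\<in>I. (cmod (hinner G (T e) g))\<^sup>2)" by (rule sum.swap)
  also have "\<dots> = (\<Sum>g\<in>L. multi_sign_avg F n (\<lambda>\<epsilon>. (cmod (hinner G (T (U \<epsilon>)) g))\<^sup>2))"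
    unfolding U_def I_def by (intro sum.cong refl chaos_second_moment[symmetric] phi)
  also have "\<dots> = multi_sign_avg F n (\<lambda>\<epsilon>. \<Sum>g\<in>L. (cmod (hinner G (T (U \<epsilon>)) g))\<^sup>2)"
    by (rule multi_sign_avg_sum[symmetric])
  also have "\<dots> \<le> multi_sign_avg F n (\<lambda>\<epsilon>. 1 + hnorm G (T (U \<epsilon>)) powr q)"
  proof (rule multi_sign_avg_mono)
    fix \<epsilon>
    have Tc: "T (U \<epsilon>) \<in> carrier G" by (rule T.closed[OF Ut])
    have "(\<Sum>g\<in>L. (cmod (hinner G (T (U \<epsilon>)) g))\<^sup>2) \<le> (hnorm G (T (U \<epsilon>)))\<^sup>2"
      by (rule G.Bessel[OF L(2,1) Tc])
    also have "\<dots> \<le> 1 + hnorm G (T (U \<epsilon>)) powr q"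
    proof (cases "hnorm G (T (U \<epsilon>)) \<le> 1")
      case True
      then have "(hnorm G (T (U \<epsilon>)))\<^sup>2 \<le> 1" using G.hnorm_nonneg[OF Tc] by (simp add: power_le_one)
      then show ?thesis by (simp add: add_increasing2)
    next
      case False
      then have "hnorm G (T (U \<epsilon>)) powr 2 \<le> hnorm G (T (U \<epsilon>)) powr q"
        using q by (intro powr_mono) auto
      then show ?thesis using False by simp
    qed
    finally show "(\<Sum>g\<in>L. (cmod (hinner G (T (U \<epsilon>)) g))\<^sup>2) \<le> 1 + hnorm G (T (U \<epsilon>)) powr q" .
  qed
  also have "\<dots> = 1 + multi_sign_avg F n (\<lambda>\<epsilon>. hnorm G (T (U \<epsilon>)) powr q)"
    by (simp only: multi_sign_avg_add multi_sign_avg_const[OF finite_F])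
  also have "\<dots> \<le> 1 + c powr q * khin_upper q ^ n"
    using upper by simp
  finally show ?thesis unfolding I_def .
qed

end

context tensor_space
begin

lemma LH_bounded_multilinear:
  assumes G: "inner_space K G" and T: "T \<in> LH K n H E tens G"
  shows "bounded_multilinear K n H G T"
proof -
  obtain f where f0: "is_linearization K n H E tens G T f" and ml: "multilinear K n H G T"
    using T unfolding LH_def by auto
  note f = is_linearizationD[OF f0 G]
  obtain C where "0 \<le> C" and C: "\<forall>z\<in>carrier E. hnorm G (f z) \<le> C * hnorm E z"
    by (rule linear_operator.bounded_if_continuous[OF f(1,2)])
  have "hnorm G (T u) \<le> C * (\<Prod>i<n. hnorm (H i) (u i))" if u: "u \<in> tuples n H" for u
    using C[rule_format, OF tens.closed[OF u]] unfolding f(3)[OF u] hnorm_tens[OF u] .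
  then show ?thesis using ml unfolding bounded_multilinear_def by blast
qed

text \<open>
  Orthonormal bases may be chosen at will. Every finite set of tuples of basis vectors lies in a
  product of finite sets, for which the partial sums are uniformly bounded.
\<close>

lemma Pi_Lip_imp_HS_bases:
  assumes G: "inner_space K G" and p: "1 \<le> p" and T: "T \<in> Pi_Lip K n H E tens G p"
  shows "\<exists>B. HS_bases K n H G T B"
proof -
  have ml: "multilinear_op K n H G T"
    using T Hi' G by (auto simp: Pi_Lip_def LH_def multilinear_op_def)
  obtain c where c: "c > 0" "lip_const G p T c"
    using T by (auto simp: Pi_Lip_def)
  \<comment> \<open>Random sign vectors detect the second moment only for exponents at least \<open>2\<close>.\<close>
  define q where "q = max p 2"
  have lip: "lip_const G q T c"
    by (rule lip_summing_const_mono[OF ml p _ _ c(2)]) (use c in \<open>simp_all add: q_def\<close>)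
  define B where "B i = (SOME B. orthonormal_basis K (H i) B)" for i
  have B: "orthonormal_basis K (H i) (B i)" if "i < n" for i
    unfolding B_def by (rule someI_ex[OF complete_inner_space.ex_orthonormal_basis[OF Hi[OF that]]])
  have "(\<lambda>e. (hnorm G (T e))\<^sup>2) summable_on (PiE {..<n} B)"
  proof (rule nonneg_bdd_above_summable_on)
    show "bdd_above (sum (\<lambda>e. (hnorm G (T e))\<^sup>2) ` {I. I \<subseteq> PiE {..<n} B \<and> finite I})"
    proof (rule bdd_aboveI2)
      fix I assume "I \<in> {I. I \<subseteq> PiE {..<n} B \<and> finite I}"
      then have I: "I \<subseteq> PiE {..<n} B" "finite I" by auto
      define F where "F i = (\<lambda>e. e i) ` I" for i
      have FB: "F i \<subseteq> B i" if "i < n" for i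
        unfolding F_def using I that by (auto simp: PiE_iff)
      interpret sign_vectors K n H E tens F
      proof
        show "finite (F i)" if "i < n" for i unfolding F_def using I by simp
        show "F i \<subseteq> carrier (H i)" if "i < n" for i
          using FB[OF that] B[OF that] by (auto simp: orthonormal_basis_def)
      qed
      have "(\<Sum>e\<in>I. (hnorm G (T e))\<^sup>2) \<le> (\<Sum>e\<in>PiE {..<n} F. (hnorm G (T e))\<^sup>2)"
      proof (rule sum_mono2)
        show "finite (PiE {..<n} F)" using finite_F by (intro finite_PiE) auto
        show "I \<subseteq> PiE {..<n} F" using I by (auto simp: F_def PiE_iff)
      qed simp
      also have "\<dots> \<le> 1 + c powr q * khin_upper q ^ n"
        by (rule summing_basis_sum_le[OF ml _ _ lip B FB]) (use c in \<open>simp_all add: q_def\<close>)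
      finally show "(\<Sum>e\<in>I. (hnorm G (T e))\<^sup>2) \<le> 1 + c powr q * khin_upper q ^ n" .
    qed
  qed simp
  then show ?thesis using B by (auto simp: HS_bases_def)
qed

lemma lip_summing_const_larger:
  assumes lip: "lip_const G p T c" and p: "1 \<le> p" and d: "c \<le> d"
  shows "lip_const G p T d"
  unfolding lip_summing_const_iff
proof (intro allI impI)
  fix k :: nat and u v assume u: "u \<in> {..<k} \<rightarrow> tuples n H" and v: "v \<in> {..<k} \<rightarrow> tuples n H"
  have "c * weak_norm p k u v \<le> d * weak_norm p k u v"
    by (rule mult_right_mono[OF d weak_norm_nonneg[OF p u v]])
  then show "(\<Sum>i<k. hnorm G (T (u i) \<ominus>\<^bsub>G\<^esub> T (v i)) powr p) powr (1 / p) \<le> d * weak_norm p k u v"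
    using lip[unfolded lip_summing_const_iff, rule_format, OF u v] by linarith
qed

end

context HS_op
begin

lemma T_in_Pi_Lip:
  assumes p: "1 \<le> p" shows "T \<in> Pi_Lip K n H E tens G p"
proof -
  have c: "(1 + ext.HS_sq) / khin_lower > 0"
    using ext.HS_sq_nonneg khin_lower_pos by (intro divide_pos_pos) auto
  have "lip_const G p T ((1 + ext.HS_sq) / khin_lower)"
    by (rule lip_summing_const_mono[OF T.multilinear_op_axioms _ p _ lip_summing_1]) (use c in simp_all)
  then show ?thesis using T_in_LH c unfolding Pi_Lip_def by blast
qed

text \<open>
  Equality, not just an estimate up to a constant. The number \<open>sqrt HS_sq\<close> itself need not be admissible in
  the infimum, which ranges over positive constants, if \<open>T\<close> vanishes; hence the \<open>\<delta>\<close>.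
\<close>

lemma pi_Lip_norm_2: "pi_Lip_norm K n H E tens G 2 T = sqrt ext.HS_sq"
proof (rule antisym)
  let ?C = "{c. c > 0 \<and> lip_const G 2 T c}"
  have mem: "sqrt ext.HS_sq + \<delta> \<in> ?C" if "\<delta> > 0" for \<delta>
    using that ext.HS_sq_nonneg lip_summing_const_larger[OF lip_summing_2, of "sqrt ext.HS_sq + \<delta>"]
    by (simp add: add_nonneg_pos)
  show "pi_Lip_norm K n H E tens G 2 T \<le> sqrt ext.HS_sq"
    unfolding pi_Lip_norm_def
  proof (rule field_le_epsilon)
    fix \<delta> :: real assume "\<delta> > 0"
    then show "Inf ?C \<le> sqrt ext.HS_sq + \<delta>"
      by (intro cInf_lower mem bdd_belowI[of _ 0]) auto
  qed
  show "sqrt ext.HS_sq \<le> pi_Lip_norm K n H E tens G 2 T"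
    unfolding pi_Lip_norm_def
  proof (rule cInf_greatest)
    show "?C \<noteq> {}" using mem[of 1] by auto
    fix c assume "c \<in> ?C"
    then have c: "c > 0" "lip_const G 2 T c" by auto
    have "ext.HS_sq \<le> c\<^sup>2"
      unfolding ext.HS_sq_def
    proof (rule infsum_le_finite_sums[OF ext.summable])
      fix I assume "finite I" "I \<subseteq> PiE {..<n} B"
      then show "(\<Sum>e\<in>I. (hnorm G (T e))\<^sup>2) \<le> c\<^sup>2"
        using c by (intro two_summing_basis_sum_le[OF T.multilinear_op_axioms _ _ B]) auto
    qed
    then show "sqrt ext.HS_sq \<le> c" using c(1) by (intro real_le_lsqrt) auto
  qed
qed

end

section \<open>The comparison of the two classes\<close>

theorem theorem5p2:
  fixes K :: "complex set"
    and n :: nat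
    and H :: "nat \<Rightarrow> 'a hspace"
    and G :: "'g hspace"
    and E :: "'e hspace"
    and tens :: "(nat \<Rightarrow> 'a) \<Rightarrow> 'e"
    and p :: real
  assumes "K = \<real> \<or> K = UNIV"
    and "1 \<le> n"
    and "\<And>i. i < n \<Longrightarrow> hilbert_space K (H i)"
    and "hilbert_space K G"
    and "hilbert_tensor K n H E tens"
    and "1 \<le> p"
  shows "L_HS K n H G = Pi_Lip K n H E tens G p \<and>
         (\<forall>T \<in> L_HS K n H G.
            HS_norm K n H G T \<le> pi_Lip_norm K n H E tens G 2 T \<and>
            pi_Lip_norm K n H E tens G 2 T \<le> khintchine_const K p ^ n * HS_norm K n H G T)"
proof -
  interpret tensor_space K n H E tens
    using assms(1-3,5) by (simp add: tensor_space_def)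
  interpret G: complete_inner_space K G
    using assms(1,4) by (simp add: complete_inner_space_iff)
  have HS: "HS_op K n H E tens G T (SOME B. HS_bases K n H G T B)" if "T \<in> L_HS K n H G" for T
  proof (intro HS_op.intro HS_op_axioms.intro tensor_space_axioms G.complete_inner_space_axioms)
    show "bounded_multilinear K n H G T" using that by (simp add: L_HS_def)
    have "\<exists>B. HS_bases K n H G T B" using that by (simp add: L_HS_def)
    then show "HS_bases K n H G T (SOME B. HS_bases K n H G T B)" by (rule someI_ex)
  qed
  have "L_HS K n H G \<subseteq> Pi_Lip K n H E tens G p"
    using HS_op.T_in_Pi_Lip[OF HS assms(6)] by blast
  moreover have "Pi_Lip K n H E tens G p \<subseteq> L_HS K n H G"
  proof
    fix T assume T: "T \<in> Pi_Lip K n H E tens G p"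
    then have "T \<in> LH K n H E tens G" by (simp add: Pi_Lip_def)
    then show "T \<in> L_HS K n H G"
      using LH_bounded_multilinear[OF G.inner_space_axioms]
        Pi_Lip_imp_HS_bases[OF G.inner_space_axioms assms(6) T]
      by (simp add: L_HS_def)
  qed
  moreover have "HS_norm K n H G T \<le> pi_Lip_norm K n H E tens G 2 T \<and>
      pi_Lip_norm K n H E tens G 2 T \<le> khintchine_const K p ^ n * HS_norm K n H G T"
    if T: "T \<in> L_HS K n H G" for T
  proof -
    interpret T: HS_op K n H E tens G T "SOME B. HS_bases K n H G T B" by (rule HS[OF T])
    have eq: "HS_norm K n H G T = pi_Lip_norm K n H E tens G 2 T"
      unfolding T.pi_Lip_norm_2 T.ext.HS_sq_def HS_norm_def ..
    have nonneg: "0 \<le> HS_norm K n H G T"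
      unfolding eq T.pi_Lip_norm_2 using T.ext.HS_sq_nonneg by simp
    have "1 \<le> khintchine_const K p ^ n"
      using khintchine_const_ge_1[OF K_1[OF assms(1)] assms(6)] by (rule one_le_power)
    from mult_right_mono[OF this nonneg] show ?thesis
      unfolding eq[symmetric] by simp
  qed
  ultimately show ?thesis by blast
qed

end
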